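(* Let $N\ge 1$, let $l_1,\dots,l_N>0$ with $\sum_{j=1}^N l_j=1$, and use the layers $L_\alpha$, interfaces $z_{\alpha+1/2}$, brackets $\langle\cdot\rangle_\alpha$, interface pressures $p_{\alpha+1/2}$, layer pressures $\langle p\rangle_\alpha$ and exchange terms $G_{\alpha+1/2}$ defined in the context. Consider the closed layer-averaged system, for $\alpha=1,\dots,N$, $$\frac{\partial}{\partial t}\langle\varphi\rangle_\alpha+\frac{\partial}{\partial x}\langle\varphi u\rangle_\alpha=G_{\alpha+1/2}-G_{\alpha-1/2},$$ $$\frac{\partial}{\partial t}\langle\varphi u\rangle_\alpha+\frac{\partial}{\partial x}\Big(\frac{\langle\varphi u\rangle_\alpha^2}{\langle\varphi\rangle_\alpha}+\langle p\rangle_\alpha\Big)=u_{\alpha+1/2}G_{\alpha+1/2}-u_{\alpha-1/2}G_{\alpha-1/2}+p_{\alpha+1/2}\frac{\partial z_{\alpha+1/2}}{\partial x}-p_{\alpha-1/2}\frac{\partial z_{\alpha-1/2}}{\partial x},$$ $$\frac{\partial}{\partial t}\langle\varphi z\rangle_\alpha+\frac{\partial}{\partial x}\Big(\langle\varphi z\rangle_\alpha\frac{\langle\varphi u\rangle_\alpha}{\langle\varphi\rangle_\alpha}\Big)=\langle\varphi w\rangle_\alpha+z_{\alpha+1/2}G_{\alpha+1/2}-z_{\alpha-1/2}G_{\alpha-1/2},$$ where $G_{\alpha+1/2}=\frac{\partial}{\partial t}\sum_{j=1}^\alpha\langle\varphi\rangle_j+\frac{\partial}{\partial x}\sum_{j=1}^\alpha\langle\varphi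 u\rangle_j$ with $G_{1/2}=G_{N+1/2}=0$, and $$u_{\alpha+1/2}=\frac{\langle\varphi u\rangle_\alpha}{\langle\varphi\rangle_\alpha}\ \text{ if } G_{\alpha+1/2}\le 0,\qquad u_{\alpha+1/2}=\frac{\langle\varphi u\rangle_{\alpha+1}}{\langle\varphi\rangle_{\alpha+1}}\ \text{ if } G_{\alpha+1/2}>0 .\qquad (\ast)$$ (1) Every solution of the free surface hydrostatic Euler system (given in the context, with its kinematic boundary conditions and zero surface pressure) which satisfies, for all $\alpha$, the closure relations $$\langle\varphi u^2\rangle_\alpha=\frac{\langle\varphi u\rangle_\alpha^2}{\langle\varphi\rangle_\alpha},\qquad \langle\varphi zu\rangle_\alpha=\langle\varphi z\rangle_\alpha\frac{\langle\varphi u\rangle_\alpha}{\langle\varphi\rangle_\alpha},$$ and whose interface velocities $u(x,z_{\alpha+1/2},t)=u_{\alpha+1/2}$ are given by $(\ast)$, is also a solution of the layer-averaged system above. (2) Smooth solutions of the layer-averaged system satisfy the energy equality $$\frac{\partial}{\partial t}\sum_{\alpha=1}^N\Big\langle E\Big(z;\frac{\langle\varphi u\rangle_\alpha}{\langle\varphi\rangle_\alpha}\Big)\Big\rangle_\alpha+\frac{\partial}{\partial x}\sum_{\alpha=1}^N\frac{\langle\varphi u\rangle_\alpha}{\langle\varphi\rangle_\alpha}\bigg(\Big\langle E\Big(z;\frac{\langle\varphi u\rangle_\alpha}{\langle\varphi\rangle_\alpha}\Big)\Big\rangle_\alpha+\langle p\rangle_\alpha\bigg)=-\frac12\sum_{\alpha=1}^N\Big(\frac{\langle\varphi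 u\rangle_{\alpha+1}}{\langle\varphi\rangle_{\alpha+1}}-\frac{\langle\varphi u\rangle_\alpha}{\langle\varphi\rangle_\alpha}\Big)^2|G_{\alpha+1/2}|,$$ the term $\alpha=N$ on the right being $0$ since $G_{N+1/2}=0$.
   Context: Here $x\in\mathbb R$ is horizontal, $z$ vertical, $g>0$ is gravity, $z_b(x)$ is a given time-independent bottom, $\eta(x,t)$ is the free surface, $H=\eta-z_b>0$ is the water depth. The function $\varphi(x,z,t)$ equals $1$ if $z_b(x)\le z\le\eta(x,t)$ and $0$ otherwise. Hydrostatic Euler system: $$\partial_t\varphi+\partial_x(\varphi u)+\partial_z(\varphi w)=0,\quad \partial_t(\varphi u)+\partial_x(\varphi u^2)+\partial_z(\varphi uw)+\partial_x p=0,\quad \partial_z p=-\varphi g,$$ with the kinematic conditions $\partial_t\eta+u_s\partial_x\eta-w_s=0$ at the free surface $z=\eta$ (subscript $s$) and $u_b\partial_x z_b-w_b=0$ at the bottom $z=z_b$ (subscript $b$), and $p=0$ at $z=\eta$; hence $p=\varphi g(\eta-z)$. Layers: $z_{\alpha+1/2}(x,t)=z_b(x)+\sum_{j=1}^\alpha l_jH(x,t)$ for $\alpha=0,\dots,N$, $L_\alpha=\,]z_{\alpha-1/2},z_{\alpha+1/2}[$, $h_\alpha=z_{\alpha+1/2}-z_{\alpha-1/2}=l_\alpha H$, $z_\alpha=(z_{\alpha+1/2}+z_{\alpha-1/2})/2$. For $f=f(x,z,t)$, $\langle f\rangle_\alpha(x,t)=\int_{z_{\alpha-1/2}}^{z_{\alpha+1/2}}f(x,z,t)\,dz$.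 In particular $\langle\varphi\rangle_\alpha=h_\alpha=l_\alpha H$ and $\langle\varphi z\rangle_\alpha=h_\alpha z_\alpha$. In the layer-averaged system the unknowns are $\langle\varphi\rangle_\alpha=l_\alpha H$, $\langle\varphi u\rangle_\alpha$, $\langle\varphi w\rangle_\alpha$ (functions of $(x,t)$), and $$p_{\alpha+1/2}=\sum_{j=\alpha+1}^N g\langle\varphi\rangle_j,\qquad \langle p\rangle_\alpha=\langle\varphi\rangle_\alpha\frac{p_{\alpha+1/2}+p_{\alpha-1/2}}2=\langle\varphi\rangle_\alpha p_{\alpha+1/2}+\frac g2\langle\varphi\rangle_\alpha^2 .$$ For an Euler solution, the mass flux through the interface is $G_{\alpha+1/2}=\partial_t z_{\alpha+1/2}+u(x,z_{\alpha+1/2},t)\,\partial_x z_{\alpha+1/2}-w(x,z_{\alpha+1/2},t)$, which agrees with the expression in the claim, and the kinematic conditions read $G_{1/2}=G_{N+1/2}=0$. The energy density is $E(z;u)=\frac{u^2}2+gz$, so $\langle E(z;\bar u)\rangle_\alpha=h_\alpha(\bar u^2/2+gz_\alpha)$ for $\bar u$ independent of $z$. *)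

theory Defs
  imports "HOL-Analysis.Analysis"
begin

section \<open>Regularity and distributional equations\<close>

definition C1_on :: "('a::real_normed_vector \<Rightarrow> 'b::real_normed_vector) \<Rightarrow> 'a set \<Rightarrow> bool" where
  "C1_on f S \<longleftrightarrow> (\<exists>f' :: 'a \<Rightarrow> ('a \<Rightarrow>\<^sub>L 'b).
     (\<forall>x\<in>S. (f has_derivative blinfun_apply (f' x)) (at x)) \<and> continuous_on S f')"

text \<open>Fields on space-time are curried: \<open>f x t\<close> or \<open>f x z t\<close>, with \<open>x\<close> horizontal, \<open>z\<close>
  vertical. The horizontal variable ranges over the whole line and \<open>t\<close> over an open set
  \<open>J\<close> of times.\<close>

definition C1_xt :: "real set \<Rightarrow> (real \<Rightarrow> real \<Rightarrow> real) \<Rightarrow> bool" where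
  "C1_xt J f \<longleftrightarrow> C1_on (\<lambda>(x, t). f x t) (UNIV \<times> J)"

definition C1_xzt :: "real set \<Rightarrow> (real \<Rightarrow> real \<Rightarrow> real \<Rightarrow> real) \<Rightarrow> bool" where
  "C1_xzt J f \<longleftrightarrow> C1_on (\<lambda>(x, z, t). f x z t) (UNIV \<times> UNIV \<times> J)"

definition test_function :: "(real \<times> real \<times> real) set \<Rightarrow> (real \<Rightarrow> real \<Rightarrow> real \<Rightarrow> real) \<Rightarrow> bool" where
  "test_function \<Omega> \<theta> \<longleftrightarrow> C1_xzt UNIV \<theta> \<and>
     (\<exists>K. compact K \<and> K \<subseteq> \<Omega> \<and> (\<forall>x z t. (x, z, t) \<notin> K \<longrightarrow> \<theta> x z t = 0))"

text \<open>The balance law \<open>\<partial>\<^sub>t A + \<partial>\<^sub>x B + \<partial>\<^sub>z C = S\<close> in the sense of distributions on \<open>\<Omega>\<close>.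
  Continuously differentiable test functions are used; for locally integrable fields this is
  equivalent to using infinitely differentiable ones.\<close>

definition weak_balance ::
  "(real \<times> real \<times> real) set \<Rightarrow> (real \<Rightarrow> real \<Rightarrow> real \<Rightarrow> real) \<Rightarrow> (real \<Rightarrow> real \<Rightarrow> real \<Rightarrow> real) \<Rightarrow>
   (real \<Rightarrow> real \<Rightarrow> real \<Rightarrow> real) \<Rightarrow> (real \<Rightarrow> real \<Rightarrow> real \<Rightarrow> real) \<Rightarrow> bool" where
  "weak_balance \<Omega> A B C S \<longleftrightarrow> (\<forall>\<theta>. test_function \<Omega> \<theta> \<longrightarrow>
     ((\<lambda>(x, z, t). A x z t * deriv (\<lambda>s. \<theta> x z s) t + B x z t * deriv (\<lambda>y. \<theta> y z t) x
          + C x z t * deriv (\<lambda>v. \<theta> x v t) z + S x z t * \<theta> x z t) has_integral 0) \<Omega>)"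


section \<open>Free surface hydrostatic Euler system\<close>

definition phi :: "(real \<Rightarrow> real) \<Rightarrow> (real \<Rightarrow> real \<Rightarrow> real) \<Rightarrow> real \<Rightarrow> real \<Rightarrow> real \<Rightarrow> real" where
  "phi zb \<eta> x z t = (if zb x \<le> z \<and> z \<le> \<eta> x t then 1 else 0)"

definition depth :: "(real \<Rightarrow> real) \<Rightarrow> (real \<Rightarrow> real \<Rightarrow> real) \<Rightarrow> real \<Rightarrow> real \<Rightarrow> real" where
  "depth zb \<eta> x t = \<eta> x t - zb x"

definition fluid_domain ::
  "(real \<Rightarrow> real) \<Rightarrow> (real \<Rightarrow> real \<Rightarrow> real) \<Rightarrow> real set \<Rightarrow> (real \<times> real \<times> real) set" where
  "fluid_domain zb \<eta> J = {(x, z, t). t \<in> J \<and> zb x < z \<and> z < \<eta> x t}"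

text \<open>The equations hold as distributions in the open fluid domain; the bottom and the free
  surface enter through the boundary conditions. (On the whole space the pressure
  \<open>\<phi> g (\<eta> - z)\<close> jumps at the bottom, so the equations could not hold across it.)
  Classical solutions are a special case, but velocities that are discontinuous in \<open>z\<close> are
  admitted: a continuous velocity subject to the closure relations below would have
  to be independent of \<open>z\<close> throughout the water column.\<close>

definition euler_solution ::
  "real \<Rightarrow> (real \<Rightarrow> real) \<Rightarrow> real set \<Rightarrow> (real \<Rightarrow> real \<Rightarrow> real) \<Rightarrow> (real \<Rightarrow> real \<Rightarrow> real \<Rightarrow> real) \<Rightarrow>
   (real \<Rightarrow> real \<Rightarrow> real \<Rightarrow> real) \<Rightarrow> (real \<Rightarrow> real \<Rightarrow> real \<Rightarrow> real) \<Rightarrow> bool" where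
  "euler_solution g zb J \<eta> u w p \<longleftrightarrow>
     C1_xt J \<eta> \<and> (\<forall>x. \<forall>t\<in>J. depth zb \<eta> x t > 0) \<and>
     (let \<phi> = phi zb \<eta>; \<Omega> = fluid_domain zb \<eta> J in
        weak_balance \<Omega> \<phi> (\<lambda>x z t. \<phi> x z t * u x z t) (\<lambda>x z t. \<phi> x z t * w x z t) (\<lambda>x z t. 0) \<and>
        weak_balance \<Omega> (\<lambda>x z t. \<phi> x z t * u x z t)
          (\<lambda>x z t. \<phi> x z t * (u x z t)\<^sup>2 + p x z t)
          (\<lambda>x z t. \<phi> x z t * u x z t * w x z t) (\<lambda>x z t. 0) \<and>
        weak_balance \<Omega> (\<lambda>x z t. 0) (\<lambda>x z t. 0) p (\<lambda>x z t. - \<phi> x z t * g)) \<and>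
     (\<forall>x. \<forall>t\<in>J.
        deriv (\<lambda>s. \<eta> x s) t + u x (\<eta> x t) t * deriv (\<lambda>y. \<eta> y t) x - w x (\<eta> x t) t = 0 \<and>
        u x (zb x) t * deriv zb x - w x (zb x) t = 0 \<and>
        p x (\<eta> x t) t = 0)"


section \<open>Layers\<close>

text \<open>The interface \<open>z\<^bsub>\<alpha>+1/2\<^esub>\<close> and all other quantities located at it (\<open>p\<^bsub>\<alpha>+1/2\<^esub>\<close>,
  \<open>G\<^bsub>\<alpha>+1/2\<^esub>\<close>, \<open>u\<^bsub>\<alpha>+1/2\<^esub>\<close>) are indexed by \<open>\<alpha>\<close>, with \<open>0 \<le> \<alpha> \<le> N\<close>; layer \<open>\<alpha>\<close>, with
  \<open>1 \<le> \<alpha> \<le> N\<close>, lies between the interfaces \<open>\<alpha> - 1\<close> and \<open>\<alpha>\<close>.\<close>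

definition interface ::
  "(real \<Rightarrow> real) \<Rightarrow> (nat \<Rightarrow> real) \<Rightarrow> (real \<Rightarrow> real \<Rightarrow> real) \<Rightarrow> nat \<Rightarrow> real \<Rightarrow> real \<Rightarrow> real" where
  "interface zb l H \<alpha> x t = zb x + (\<Sum>j=1..\<alpha>. l j * H x t)"

definition midpoint_z ::
  "(real \<Rightarrow> real) \<Rightarrow> (nat \<Rightarrow> real) \<Rightarrow> (real \<Rightarrow> real \<Rightarrow> real) \<Rightarrow> nat \<Rightarrow> real \<Rightarrow> real \<Rightarrow> real" where
  "midpoint_z zb l H \<alpha> x t = (interface zb l H \<alpha> x t + interface zb l H (\<alpha> - 1) x t) / 2"

definition thickness ::
  "(nat \<Rightarrow> real) \<Rightarrow> (real \<Rightarrow> real \<Rightarrow> real) \<Rightarrow> nat \<Rightarrow> real \<Rightarrow> real \<Rightarrow> real" where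
  "thickness l H \<alpha> x t = l \<alpha> * H x t"

text \<open>The bracket \<open>\<langle>f\<rangle>\<^sub>\<alpha>\<close>.\<close>

definition layer_int ::
  "(real \<Rightarrow> real) \<Rightarrow> (nat \<Rightarrow> real) \<Rightarrow> (real \<Rightarrow> real \<Rightarrow> real) \<Rightarrow> nat \<Rightarrow>
   (real \<Rightarrow> real \<Rightarrow> real \<Rightarrow> real) \<Rightarrow> real \<Rightarrow> real \<Rightarrow> real" where
  "layer_int zb l H \<alpha> f x t =
     integral {interface zb l H (\<alpha> - 1) x t .. interface zb l H \<alpha> x t} (\<lambda>z. f x z t)"

text \<open>\<open>f\<close> is continuously differentiable on every layer up to its boundary, i.e. it coincides
  there with a restriction of a continuously differentiable function. It may jump across the
  interior interfaces, where its values are not constrained.\<close>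

definition layerwise_C1 ::
  "nat \<Rightarrow> (nat \<Rightarrow> real) \<Rightarrow> (real \<Rightarrow> real) \<Rightarrow> real set \<Rightarrow> (real \<Rightarrow> real \<Rightarrow> real) \<Rightarrow>
   (real \<Rightarrow> real \<Rightarrow> real \<Rightarrow> real) \<Rightarrow> bool" where
  "layerwise_C1 N l zb J H f \<longleftrightarrow> (\<forall>\<alpha>\<in>{1..N}. \<exists>F. C1_xzt J F \<and>
     (\<forall>x. \<forall>t\<in>J. \<forall>z\<in>{interface zb l H (\<alpha> - 1) x t .. interface zb l H \<alpha> x t}.
        z \<notin> (\<lambda>j. interface zb l H j x t) ` {1..<N} \<longrightarrow> f x z t = F x z t))"

lemma interface_diff:
  assumes "1 \<le> \<alpha>"
  shows "interface zb l H \<alpha> x t - interface zb l H (\<alpha> - 1) x t = thickness l H \<alpha> x t"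
  using assms by (cases \<alpha>) (auto simp: interface_def thickness_def)

lemma layer_int_phi_aux:
  assumes H: "depth zb \<eta> x t \<ge> 0" and l: "\<forall>j\<in>{1..N}. l j > 0" "(\<Sum>j=1..N. l j) = 1"
    and \<alpha>: "\<alpha> \<in> {1..N}"
    and z: "z \<in> {interface zb l (depth zb \<eta>) (\<alpha> - 1) x t .. interface zb l (depth zb \<eta>) \<alpha> x t}"
  shows "phi zb \<eta> x z t = 1"
proof -
  have 1: "(\<Sum>j=1..\<alpha>. l j) \<le> 1"
    using l \<alpha> by (subst l(2)[symmetric], intro sum_mono2) (auto intro: less_imp_le)
  have 2: "(\<Sum>j=1..\<alpha>-1. l j) \<ge> 0"
    using l(1) \<alpha> by (intro sum_nonneg) (auto intro!: less_imp_le)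
  have e: "interface zb l (depth zb \<eta>) k x t = zb x + (\<Sum>j=1..k. l j) * depth zb \<eta> x t" for k
    by (simp add: interface_def sum_distrib_right)
  have "(\<Sum>j=1..\<alpha>. l j) * depth zb \<eta> x t \<le> depth zb \<eta> x t"
    using mult_right_mono[OF 1 H] by simp
  moreover have "(\<Sum>j=1..\<alpha>-1. l j) * depth zb \<eta> x t \<ge> 0"
    using 2 H by simp
  ultimately show ?thesis
    using z unfolding e phi_def depth_def by auto
qed

lemma layer_int_phi:
  assumes "depth zb \<eta> x t \<ge> 0" "\<forall>j\<in>{1..N}. l j > 0" "(\<Sum>j=1..N. l j) = 1" "\<alpha> \<in> {1..N}"
  shows "layer_int zb l (depth zb \<eta>) \<alpha> (phi zb \<eta>) x t = thickness l (depth zb \<eta>) \<alpha> x t"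
proof -
  let ?I = "interface zb l (depth zb \<eta>)"
  have "thickness l (depth zb \<eta>) \<alpha> x t \<ge> 0"
    using assms less_imp_le[of 0 "l \<alpha>"] by (simp add: thickness_def)
  moreover have "layer_int zb l (depth zb \<eta>) \<alpha> (phi zb \<eta>) x t
      = integral {?I (\<alpha> - 1) x t .. ?I \<alpha> x t} (\<lambda>z. 1)"
    unfolding layer_int_def using layer_int_phi_aux[OF assms] by (intro integral_cong) auto
  ultimately show ?thesis
    using interface_diff[of \<alpha> zb l "depth zb \<eta>" x t] assms(4) by simp
qed

lemma layer_int_phi_z:
  assumes "depth zb \<eta> x t \<ge> 0" "\<forall>j\<in>{1..N}. l j > 0" "(\<Sum>j=1..N. l j) = 1" "\<alpha> \<in> {1..N}"
  shows "layer_int zb l (depth zb \<eta>) \<alpha> (\<lambda>x z t. phi zb \<eta> x z t * z) x t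
    = thickness l (depth zb \<eta>) \<alpha> x t * midpoint_z zb l (depth zb \<eta>) \<alpha> x t"
proof -
  let ?I = "interface zb l (depth zb \<eta>)"
  have d: "?I \<alpha> x t - ?I (\<alpha> - 1) x t = thickness l (depth zb \<eta>) \<alpha> x t"
    using interface_diff assms(4) by auto
  have "thickness l (depth zb \<eta>) \<alpha> x t \<ge> 0"
    using assms less_imp_le[of 0 "l \<alpha>"] by (simp add: thickness_def)
  with d have le: "?I (\<alpha> - 1) x t \<le> ?I \<alpha> x t" by linarith
  have "layer_int zb l (depth zb \<eta>) \<alpha> (\<lambda>x z t. phi zb \<eta> x z t * z) x t
      = integral {?I (\<alpha> - 1) x t .. ?I \<alpha> x t} (\<lambda>z. z)"
    unfolding layer_int_def using layer_int_phi_aux[OF assms] by (intro integral_cong) auto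
  also have "\<dots> = ((?I \<alpha> x t)\<^sup>2 - (?I (\<alpha> - 1) x t)\<^sup>2) / 2"
    using ident_has_integral[OF le] by (simp add: integral_unique)
  also have "\<dots> = thickness l (depth zb \<eta>) \<alpha> x t * midpoint_z zb l (depth zb \<eta>) \<alpha> x t"
    unfolding midpoint_z_def d[symmetric] by (simp add: power2_eq_square algebra_simps)
  finally show ?thesis .
qed


section \<open>The layer-averaged system\<close>

text \<open>The unknowns are the water depth \<open>H\<close> and the families \<open>q \<alpha> = \<langle>\<phi> u\<rangle>\<^sub>\<alpha>\<close> and
  \<open>r \<alpha> = \<langle>\<phi> w\<rangle>\<^sub>\<alpha>\<close>; moreover \<open>\<langle>\<phi>\<rangle>\<^sub>\<alpha> = thickness l H \<alpha>\<close> and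
  \<open>\<langle>\<phi> z\<rangle>\<^sub>\<alpha> = thickness l H \<alpha> * midpoint_z zb l H \<alpha>\<close>, cf. \<open>layer_int_phi\<close> and
  \<open>layer_int_phi_z\<close>.\<close>

definition layer_velocity ::
  "(nat \<Rightarrow> real) \<Rightarrow> (real \<Rightarrow> real \<Rightarrow> real) \<Rightarrow> (nat \<Rightarrow> real \<Rightarrow> real \<Rightarrow> real) \<Rightarrow>
   nat \<Rightarrow> real \<Rightarrow> real \<Rightarrow> real" where
  "layer_velocity l H q \<alpha> x t = q \<alpha> x t / thickness l H \<alpha> x t"

definition interface_pressure ::
  "real \<Rightarrow> nat \<Rightarrow> (nat \<Rightarrow> real) \<Rightarrow> (real \<Rightarrow> real \<Rightarrow> real) \<Rightarrow> nat \<Rightarrow> real \<Rightarrow> real \<Rightarrow> real" where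
  "interface_pressure g N l H \<alpha> x t = (\<Sum>j=\<alpha>+1..N. g * thickness l H j x t)"

definition layer_pressure ::
  "real \<Rightarrow> nat \<Rightarrow> (nat \<Rightarrow> real) \<Rightarrow> (real \<Rightarrow> real \<Rightarrow> real) \<Rightarrow> nat \<Rightarrow> real \<Rightarrow> real \<Rightarrow> real" where
  "layer_pressure g N l H \<alpha> x t = thickness l H \<alpha> x t *
     ((interface_pressure g N l H \<alpha> x t + interface_pressure g N l H (\<alpha> - 1) x t) / 2)"

definition exchange ::
  "(nat \<Rightarrow> real) \<Rightarrow> (real \<Rightarrow> real \<Rightarrow> real) \<Rightarrow> (nat \<Rightarrow> real \<Rightarrow> real \<Rightarrow> real) \<Rightarrow>
   nat \<Rightarrow> real \<Rightarrow> real \<Rightarrow> real" where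
  "exchange l H q \<alpha> x t =
     deriv (\<lambda>s. \<Sum>j=1..\<alpha>. thickness l H j x s) t + deriv (\<lambda>y. \<Sum>j=1..\<alpha>. q j y t) x"

definition upwind_velocity ::
  "(nat \<Rightarrow> real) \<Rightarrow> (real \<Rightarrow> real \<Rightarrow> real) \<Rightarrow> (nat \<Rightarrow> real \<Rightarrow> real \<Rightarrow> real) \<Rightarrow>
   nat \<Rightarrow> real \<Rightarrow> real \<Rightarrow> real" where
  "upwind_velocity l H q \<alpha> x t =
     (if exchange l H q \<alpha> x t \<le> 0 then layer_velocity l H q \<alpha> x t
      else layer_velocity l H q (\<alpha> + 1) x t)"

text \<open>Classical solutions. No regularity is needed for \<open>r\<close>, which enters undifferentiated. The
  velocities \<open>layer_velocity l H q 0\<close> and \<open>layer_velocity l H q (N + 1)\<close> of nonexistent layers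
  only ever occur multiplied by a vanishing exchange term.\<close>

definition layer_averaged_solution ::
  "real \<Rightarrow> nat \<Rightarrow> (nat \<Rightarrow> real) \<Rightarrow> (real \<Rightarrow> real) \<Rightarrow> real set \<Rightarrow> (real \<Rightarrow> real \<Rightarrow> real) \<Rightarrow>
   (nat \<Rightarrow> real \<Rightarrow> real \<Rightarrow> real) \<Rightarrow> (nat \<Rightarrow> real \<Rightarrow> real \<Rightarrow> real) \<Rightarrow> bool" where
  "layer_averaged_solution g N l zb J H q r \<longleftrightarrow>
     C1_xt J H \<and> (\<forall>\<alpha>\<in>{1..N}. C1_xt J (q \<alpha>)) \<and>
     (\<forall>x. \<forall>t\<in>J. H x t > 0) \<and>
     (let h = thickness l H; zi = interface zb l H; zm = midpoint_z zb l H;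
          v = layer_velocity l H q; pif = interface_pressure g N l H; pl = layer_pressure g N l H;
          G = exchange l H q; ui = upwind_velocity l H q
      in \<forall>x. \<forall>t\<in>J.
        G 0 x t = 0 \<and> G N x t = 0 \<and>
        (\<forall>\<alpha>\<in>{1..N}.
          deriv (\<lambda>s. h \<alpha> x s) t + deriv (\<lambda>y. q \<alpha> y t) x = G \<alpha> x t - G (\<alpha> - 1) x t \<and>
          deriv (\<lambda>s. q \<alpha> x s) t + deriv (\<lambda>y. (q \<alpha> y t)\<^sup>2 / h \<alpha> y t + pl \<alpha> y t) x
            = ui \<alpha> x t * G \<alpha> x t - ui (\<alpha> - 1) x t * G (\<alpha> - 1) x t
              + pif \<alpha> x t * deriv (\<lambda>y. zi \<alpha> y t) x
              - pif (\<alpha> - 1) x t * deriv (\<lambda>y. zi (\<alpha> - 1) y t) x \<and>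
          deriv (\<lambda>s. h \<alpha> x s * zm \<alpha> x s) t + deriv (\<lambda>y. h \<alpha> y t * zm \<alpha> y t * v \<alpha> y t) x
            = r \<alpha> x t + zi \<alpha> x t * G \<alpha> x t - zi (\<alpha> - 1) x t * G (\<alpha> - 1) x t))"

definition energy_density :: "real \<Rightarrow> real \<Rightarrow> real \<Rightarrow> real" where
  "energy_density g z v = v\<^sup>2 / 2 + g * z"

definition layer_energy ::
  "real \<Rightarrow> (nat \<Rightarrow> real) \<Rightarrow> (real \<Rightarrow> real) \<Rightarrow> (real \<Rightarrow> real \<Rightarrow> real) \<Rightarrow>
   (nat \<Rightarrow> real \<Rightarrow> real \<Rightarrow> real) \<Rightarrow> nat \<Rightarrow> real \<Rightarrow> real \<Rightarrow> real" where
  "layer_energy g l zb H q \<alpha> x t =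
     layer_int zb l H \<alpha> (\<lambda>x z t. energy_density g z (layer_velocity l H q \<alpha> x t)) x t"

end

theory Submission
  imports Defs
begin

text \<open>Part 1. Inside a layer the weak equations hold pointwise; across an interface they give the
  Rankine-Hugoniot jump conditions, tested with bumps concentrated near the interface. The first
  closure relation is the equality case of the Cauchy-Schwarz inequality, so \<open>u\<close> does not depend on
  \<open>z\<close> in a layer; hence \<open>w\<close> is affine in \<open>z\<close> there, \<open>p = g (\<eta> - z)\<close>, the mass flux \<open>G\<close> is continuous
  across interfaces and \<open>G [u] = 0\<close>. The layer-averaged equations are then algebraic identities.

  Part 2. Multiplying the momentum equation of layer \<open>\<alpha>\<close> by its velocity and subtracting half the
  squared velocity times the mass equation, the exchange terms sum by parts to
  \<open>G (v\<^bsub>\<alpha>+1\<^esub> - v\<^bsub>\<alpha>\<^esub>) ((v\<^bsub>\<alpha>+1\<^esub> + v\<^bsub>\<alpha>\<^esub>) / 2 - u\<^bsub>\<alpha>+1/2\<^esub>)\<close>, which upwinding turns into the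
  dissipation; the remaining terms telescope.\<close>

section \<open>Calculus of continuously differentiable maps\<close>

text \<open>Test functions see the fields only up to null sets, and \<open>layerwise_C1\<close> does
  not tie the values at interior interfaces to the adjacent layers. Every statement about an
  interface is therefore made for the C1 extensions from the layer below and from the layer above,
  and only the weak equations link the two. The pressure has to be identified before the momentum.
  As a balance law with vertical flux only, the hydrostatic equation forces p to be continuous
  across interfaces; this removes p from the momentum jump, which then reads G [u] = 0. So at each
  interface either no mass crosses or the two layer velocities agree, and the upwind rule gives the
  same momentum exchange whichever side it selects. In the energy balance the interface pressures
  cancel against part of the derivative of the layer pressure and leave g h times the slope of the
  free surface. Together with the potential energy, all gravity terms collapse to g times the
  surface height times the total mass balance, which is G at the free surface and vanishes. The
  velocity of the fictitious layer N + 1 only occurs with this vanishing factor.\<close>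

lemma C1_on_iff_frechet:
  "C1_on f S \<longleftrightarrow> (\<forall>x\<in>S. f differentiable (at x)) \<and>
     continuous_on S (\<lambda>x. Blinfun (frechet_derivative f (at x)))"
proof
  assume "C1_on f S"
  then obtain f' where f': "\<And>x. x \<in> S \<Longrightarrow> (f has_derivative blinfun_apply (f' x)) (at x)"
    and "continuous_on S f'"
    unfolding C1_on_def by blast
  moreover have "f' x = Blinfun (frechet_derivative f (at x))" if "x \<in> S" for x
    using f'[OF that] frechet_derivative_at[of f "blinfun_apply (f' x)" x]
    by (metis blinfun_apply_inverse)
  ultimately show "(\<forall>x\<in>S. f differentiable (at x)) \<and>
      continuous_on S (\<lambda>x. Blinfun (frechet_derivative f (at x)))"
    unfolding differentiable_def by (metis (no_types, lifting) continuous_on_cong)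
next
  assume *: "(\<forall>x\<in>S. f differentiable (at x)) \<and>
      continuous_on S (\<lambda>x. Blinfun (frechet_derivative f (at x)))"
  have "(f has_derivative blinfun_apply (Blinfun (frechet_derivative f (at x)))) (at x)"
    if "x \<in> S" for x
    using * that bounded_linear_Blinfun_apply frechet_derivative_works has_derivative_bounded_linear
    by metis
  with * show "C1_on f S" unfolding C1_on_def
    by (intro exI[of _ "\<lambda>x. Blinfun (frechet_derivative f (at x))"]) auto
qed

lemma C1_on_frechet_apply:
  assumes "C1_on f S" "x \<in> S"
  shows "blinfun_apply (Blinfun (frechet_derivative f (at x))) = frechet_derivative f (at x)"
  using assms unfolding C1_on_iff_frechet
  by (metis bounded_linear_Blinfun_apply frechet_derivative_works has_derivative_bounded_linear)

lemma C1_on_has_derivative: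
  assumes "C1_on f S" "x \<in> S"
  shows "(f has_derivative frechet_derivative f (at x)) (at x)"
  using assms unfolding C1_on_iff_frechet frechet_derivative_works[symmetric] by blast

lemma C1_on_continuous_on_frechet:
  assumes "C1_on f S"
  shows "continuous_on S (\<lambda>x. frechet_derivative f (at x) v)"
proof -
  have "continuous_on S (\<lambda>x. blinfun_apply (Blinfun (frechet_derivative f (at x))) v)"
    using assms unfolding C1_on_iff_frechet by (intro continuous_intros) auto
  then show ?thesis
    using C1_on_frechet_apply[OF assms] by (metis (no_types, lifting) continuous_on_cong)
qed

lemma C1_on_imp_continuous_on: "C1_on f S \<Longrightarrow> continuous_on S f"
  by (meson C1_on_has_derivative continuous_at_imp_continuous_on has_derivative_continuous)

lemma C1_on_subset: "C1_on f S \<Longrightarrow> T \<subseteq> S \<Longrightarrow> C1_on f T"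
  unfolding C1_on_def by (meson continuous_on_subset subsetD)

text \<open>The derivative fields witnessing \<open>C1_on\<close> on S and on T are chosen
  separately. Expressed through \<open>frechet_derivative\<close> they become one field, so that
  only continuity has to be glued on an open union. This is how products with a cutoff are extended
  by zero.\<close>

lemma C1_on_Un:
  assumes "C1_on f S" "C1_on f T" "open S" "open T"
  shows "C1_on f (S \<union> T)"
  using assms continuous_on_open_Un unfolding C1_on_iff_frechet by blast

lemma C1_on_cong_open:
  assumes "C1_on f S" "open S" "\<And>x. x \<in> S \<Longrightarrow> f x = g x"
  shows "C1_on g S"
  using assms unfolding C1_on_def by (meson has_derivative_transform_within_open)

lemma C1_on_const: "C1_on (\<lambda>x. c) S"
  unfolding C1_on_def by (rule exI[of _ "\<lambda>x. 0"]) (auto simp: zero_blinfun.rep_eq)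

lemma C1_on_bounded_linear:
  assumes "bounded_linear f"
  shows "C1_on f S"
  unfolding C1_on_def
  by (rule exI[of _ "\<lambda>x. Blinfun f"])
    (use assms in \<open>auto simp: bounded_linear_Blinfun_apply intro: bounded_linear_imp_has_derivative\<close>)

lemma C1_on_add:
  assumes "C1_on f S" "C1_on g S"
  shows "C1_on (\<lambda>x. f x + g x) S"
proof -
  obtain f' g' where "\<And>x. x \<in> S \<Longrightarrow> (f has_derivative blinfun_apply (f' x)) (at x)"
    "\<And>x. x \<in> S \<Longrightarrow> (g has_derivative blinfun_apply (g' x)) (at x)"
    "continuous_on S f'" "continuous_on S g'"
    using assms unfolding C1_on_def by blast
  then show ?thesis unfolding C1_on_def
    by (intro exI[of _ "\<lambda>x. f' x + g' x"])
      (auto intro!: continuous_intros has_derivative_eq_rhs[OF has_derivative_add] simp: blinfun.add_left)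
qed

lemma C1_on_mult:
  fixes f g :: "'a::real_normed_vector \<Rightarrow> real"
  assumes "C1_on f S" "C1_on g S"
  shows "C1_on (\<lambda>x. f x * g x) S"
proof -
  obtain f' g' where "\<And>x. x \<in> S \<Longrightarrow> (f has_derivative blinfun_apply (f' x)) (at x)"
    "\<And>x. x \<in> S \<Longrightarrow> (g has_derivative blinfun_apply (g' x)) (at x)"
    "continuous_on S f'" "continuous_on S g'"
    using assms unfolding C1_on_def by blast
  moreover from assms have "continuous_on S f" "continuous_on S g"
    by (auto intro: C1_on_imp_continuous_on)
  ultimately show ?thesis unfolding C1_on_def
    by (intro exI[of _ "\<lambda>x. f x *\<^sub>R g' x + g x *\<^sub>R f' x"])
      (auto intro!: continuous_intros has_derivative_eq_rhs[OF has_derivative_mult]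
        simp: blinfun.add_left blinfun.scaleR_left)
qed

lemma C1_on_uminus: "C1_on f S \<Longrightarrow> C1_on (\<lambda>x. - f x :: real) S"
  using C1_on_mult[OF C1_on_const[of "-1"]] by simp

lemma C1_on_diff: "C1_on f S \<Longrightarrow> C1_on g S \<Longrightarrow> C1_on (\<lambda>x. f x - g x :: real) S"
  using C1_on_add[OF _ C1_on_uminus, of f S g] by simp

lemma C1_on_compose:
  assumes "C1_on f S" "C1_on g T" "f ` S \<subseteq> T"
  shows "C1_on (\<lambda>x. g (f x)) S"
proof -
  obtain f' g' where f': "\<And>x. x \<in> S \<Longrightarrow> (f has_derivative blinfun_apply (f' x)) (at x)"
    and g': "\<And>x. x \<in> T \<Longrightarrow> (g has_derivative blinfun_apply (g' x)) (at x)"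
    and c: "continuous_on S f'" "continuous_on T g'"
    using assms unfolding C1_on_def by blast
  have "((\<lambda>x. g (f x)) has_derivative blinfun_apply (g' (f x) o\<^sub>L f' x)) (at x)" if "x \<in> S" for x
    using has_derivative_compose[OF f'[OF that] g'[of "f x"]] that assms(3)
    by (auto simp: blinfun_compose.rep_eq o_def)
  moreover have "continuous_on S (\<lambda>x. g' (f x) o\<^sub>L f' x)"
    by (intro bounded_bilinear.continuous_on[OF bounded_bilinear_blinfun_compose] c
        continuous_on_compose2[OF c(2)] C1_on_imp_continuous_on[OF assms(1)] assms(3))
  ultimately show ?thesis unfolding C1_on_def by (intro exI[of _ "\<lambda>x. g' (f x) o\<^sub>L f' x"]) auto
qed

text \<open>A pair is the sum of its two coordinate embeddings, which are bounded linear.\<close>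

lemma C1_on_Pair:
  assumes "C1_on f S" "C1_on g S"
  shows "C1_on (\<lambda>x. (f x, g x)) S"
proof -
  have l: "bounded_linear (\<lambda>a. (a, 0 :: 'c))" and r: "bounded_linear (\<lambda>a. (0 :: 'b, a))"
    by (auto intro!: bounded_linear_Pair bounded_linear_ident bounded_linear_zero)
  have "C1_on (\<lambda>x. (f x, 0 :: 'c) + (0, g x)) S"
    by (rule C1_on_add)
     (rule C1_on_compose[OF assms(1) C1_on_bounded_linear[OF l, of UNIV]]
           C1_on_compose[OF assms(2) C1_on_bounded_linear[OF r, of UNIV]]; simp)+
  then show ?thesis by simp
qed

lemma C1_on_real_derivI:
  fixes f :: "real \<Rightarrow> real"
  assumes "\<And>x. x \<in> S \<Longrightarrow> (f has_real_derivative f' x) (at x)" "continuous_on S f'"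
  shows "C1_on f S"
proof -
  have "blinfun_apply (blinfun_scaleR_right (f' x)) = (*) (f' x)" for x
    by auto
  with assms show ?thesis unfolding C1_on_def
    by (intro exI[of _ "\<lambda>x. blinfun_scaleR_right (f' x)"])
      (auto intro!: continuous_intros simp: has_field_derivative_def)
qed

lemma C1_on_divide:
  fixes f g :: "'a::real_normed_vector \<Rightarrow> real"
  assumes "C1_on f S" "C1_on g S" "\<And>x. x \<in> S \<Longrightarrow> g x \<noteq> 0"
  shows "C1_on (\<lambda>x. f x / g x) S"
proof -
  have "C1_on (inverse :: real \<Rightarrow> real) (- {0})"
    by (rule C1_on_real_derivI[where f' = "\<lambda>x. - inverse (x ^ 2)"])
      (auto intro!: derivative_eq_intros continuous_intros simp: power2_eq_square)
  with assms(2,3) have "C1_on (\<lambda>x. inverse (g x)) S" by (auto intro: C1_on_compose)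
  with assms(1) show ?thesis unfolding divide_inverse by (rule C1_on_mult)
qed

lemma C1_on_sum:
  assumes "\<And>i. i \<in> I \<Longrightarrow> C1_on (f i) S"
  shows "C1_on (\<lambda>x. \<Sum>i\<in>I. f i x) S"
proof (cases "finite I")
  case True
  then show ?thesis using assms
    by (induction I rule: finite_induct) (auto intro: C1_on_const C1_on_add)
qed (auto intro: C1_on_const)

lemma C1_on_fst_snd:
  "C1_on fst S" "C1_on snd S" "C1_on (\<lambda>X. fst (snd X)) T" "C1_on (\<lambda>X. snd (snd X)) T"
  by (auto intro!: C1_on_bounded_linear bounded_linear_fst bounded_linear_snd
      bounded_linear_fst_comp bounded_linear_snd_comp)

lemmas C1_on_intros =
  C1_on_const C1_on_add C1_on_mult C1_on_uminus C1_on_diff C1_on_divide C1_on_sum C1_on_Pair C1_on_fst_snd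

section \<open>Test functions and integration by parts\<close>

lemma frechet_derivative_eq_zero_open:
  assumes "open S" "x \<in> S" "\<And>y. y \<in> S \<Longrightarrow> f y = 0"
  shows "frechet_derivative f (at x) = (\<lambda>v. 0)"
proof -
  have "(f has_derivative (\<lambda>v. 0)) (at x)"
    using assms by (intro has_derivative_transform_within_open[OF has_derivative_const[of 0]]) auto
  then show ?thesis by (metis frechet_derivative_at)
qed

lemma C1_on_directional_derivative:
  fixes f :: "'a::real_normed_vector \<Rightarrow> real"
  assumes "C1_on f S" "x \<in> S"
  shows "((\<lambda>s. f (x + s *\<^sub>R v)) has_real_derivative frechet_derivative f (at x) v) (at 0)"
proof -
  have 1: "((\<lambda>s. x + s *\<^sub>R v) has_derivative (\<lambda>s. s *\<^sub>R v)) (at (0::real))"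
    by (auto intro!: derivative_eq_intros)
  have D: "(f has_derivative frechet_derivative f (at x)) (at x)"
    using C1_on_has_derivative[OF assms] .
  then have "((\<lambda>s. f (x + s *\<^sub>R v)) has_derivative (\<lambda>s. frechet_derivative f (at x) (s *\<^sub>R v))) (at (0::real))"
    using has_derivative_compose[OF 1, of f "frechet_derivative f (at x)"] by simp
  moreover have "(\<lambda>s. frechet_derivative f (at x) (s *\<^sub>R v)) = (*) (frechet_derivative f (at x) v)"
    using linear_scale[OF has_derivative_linear[OF D]] by (auto simp: mult.commute)
  ultimately show ?thesis unfolding has_field_derivative_def by simp
qed

text \<open>Difference quotients have integral \<open>0\<close> by translation invariance, and they converge
  boundedly to the directional derivative.\<close>

lemma has_integral_frechet_derivative_compact_support:
  fixes f :: "'a::euclidean_space \<Rightarrow> real"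
  assumes f: "C1_on f UNIV" and K: "compact K" and f0: "\<And>x. x \<notin> K \<Longrightarrow> f x = 0"
  shows "((\<lambda>x. frechet_derivative f (at x) v) has_integral 0) UNIV"
proof -
  define B where "B x = Blinfun (frechet_derivative f (at x))" for x
  have B: "blinfun_apply (B x) = frechet_derivative f (at x)" for x
    unfolding B_def using C1_on_frechet_apply[OF f] by simp
  have D: "(f has_derivative blinfun_apply (B x)) (at x)" for x
    unfolding B using C1_on_has_derivative[OF f] by simp
  have "continuous_on K B"
    using f unfolding C1_on_iff_frechet B_def[abs_def] by (meson continuous_on_subset subset_UNIV)
  then obtain M where M: "\<And>x. x \<in> K \<Longrightarrow> norm (B x) \<le> M" "0 \<le> M"
    using compact_imp_bounded[OF compact_continuous_image[OF _ K]]
    by (metis bounded_pos image_eqI less_imp_le)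
  have M': "norm (B x) \<le> M" for x
  proof (cases "x \<in> K")
    case False
    have "frechet_derivative f (at x) = (\<lambda>v. 0)"
      by (rule frechet_derivative_eq_zero_open[of "- K"])
        (use K False f0 in \<open>auto simp: compact_imp_closed open_Compl\<close>)
    then have "B x = 0" using B[of x] by (auto intro!: blinfun_eqI)
    then show ?thesis using M(2) by simp
  qed (use M in auto)
  \<comment> \<open>The derivative is bounded on K by compactness and is 0 off K; the mean value
    inequality turns M into a global Lipschitz constant.\<close>
  have lip: "norm (f x - f y) \<le> M * norm (x - y)" for x y
    by (rule differentiable_bound[of UNIV f "\<lambda>x. blinfun_apply (B x)"])
      (use D M' in \<open>auto simp: norm_blinfun.rep_eq[symmetric]\<close>)
  define h :: "nat \<Rightarrow> real" where "h n = inverse (real (Suc n))" for n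
  have h: "0 < h n" "h n \<le> 1" "h n \<noteq> 0" for n unfolding h_def by (auto simp: field_simps)
  define q where "q n x = (f (x + h n *\<^sub>R v) - f x) / h n" for n x
  \<comment> \<open>All \<open>h n\<close> are at most 1, so K enlarged by a closed ball of radius
    \<open>norm v\<close> contains the support of every difference quotient and carries the
    dominating function.\<close>
  define W where "W = {x + y | x y. x \<in> K \<and> y \<in> cball 0 (norm v)}"
  have W: "compact W" unfolding W_def using K by (intro compact_sums) auto
  have qb: "norm (q n x) \<le> indicator W x *\<^sub>R (M * norm v)" for n x
  proof (cases "x \<in> W")
    case True
    have "norm (f (x + h n *\<^sub>R v) - f x) \<le> M * (h n * norm v)"
      using lip[of "x + h n *\<^sub>R v" x] h(1)[of n] by simp
    then show ?thesis using True h(1)[of n] unfolding q_def by (simp add: field_simps)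
  next
    case False
    have "x \<notin> K" using False unfolding W_def by force
    moreover have "x + h n *\<^sub>R v \<notin> K"
    proof
      assume "x + h n *\<^sub>R v \<in> K"
      moreover have "- (h n *\<^sub>R v) \<in> cball 0 (norm v)"
        using h[of n] by (simp add: mult_left_le_one_le)
      moreover have "x = (x + h n *\<^sub>R v) + - (h n *\<^sub>R v)" by simp
      ultimately show False using False unfolding W_def by blast
    qed
    ultimately show ?thesis using False f0 by (simp add: q_def)
  qed
  have fc: "continuous_on UNIV f" by (rule C1_on_imp_continuous_on[OF f])
  then have [measurable]: "f \<in> borel_measurable borel" by (rule borel_measurable_continuous_onI)
  have fi: "integrable lborel f"
  proof -
    have "integrable lborel (\<lambda>x. indicator K x *\<^sub>R f x)"
      by (rule borel_integrable_compact[OF K]) (use fc continuous_on_subset in auto)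
    moreover have "(\<lambda>x. indicator K x *\<^sub>R f x) = f" using f0 by (fastforce simp: indicator_def)
    ultimately show ?thesis by simp
  qed
  have shift: "integrable lborel (\<lambda>x. f (x + c))" "integral\<^sup>L lborel (\<lambda>x. f (x + c)) = integral\<^sup>L lborel f" for c
  proof -
    have eq: "lborel = distr lborel borel (\<lambda>x::'a. x + c)"
    proof -
      have "(\<lambda>x. x + c) = (+) c" by (auto simp: add.commute)
      then show ?thesis using lborel_distr_plus[of c] by simp
    qed
    show "integrable lborel (\<lambda>x. f (x + c))"
      using fi by (subst (asm) eq, subst (asm) integrable_distr_eq) auto
    show "integral\<^sup>L lborel (\<lambda>x. f (x + c)) = integral\<^sup>L lborel f"
      by (subst (2) eq, subst integral_distr) auto
  qed
  have q0: "integral\<^sup>L lborel (q n) = 0" for n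
    unfolding q_def[abs_def] using fi shift by simp
  have conv: "(\<lambda>n. q n x) \<longlonglongrightarrow> frechet_derivative f (at x) v" for x
  proof -
    have "((\<lambda>s. (f (x + s *\<^sub>R v) - f x) / s) \<longlongrightarrow> frechet_derivative f (at x) v) (at 0)"
      using C1_on_directional_derivative[OF f, of x v] unfolding DERIV_def by simp
    moreover have "filterlim h (at 0) sequentially"
      unfolding filterlim_at h_def[abs_def] using LIMSEQ_inverse_real_of_nat by auto
    ultimately show ?thesis unfolding q_def by (rule filterlim_compose)
  qed
  have meas: "(\<lambda>x. frechet_derivative f (at x) v) \<in> borel_measurable lborel"
    using borel_measurable_continuous_onI[OF C1_on_continuous_on_frechet[OF f, of v]] by simp
  have qm: "q n \<in> borel_measurable lborel" for n unfolding q_def[abs_def] by measurable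
  have wi: "integrable lborel (\<lambda>x. indicator W x *\<^sub>R (M * norm v))"
    by (rule borel_integrable_compact[OF W]) auto
  note dc = integral_dominated_convergence integrable_dominated_convergence
  have "(\<lambda>n. integral\<^sup>L lborel (q n)) \<longlonglongrightarrow> integral\<^sup>L lborel (\<lambda>x. frechet_derivative f (at x) v)"
    by (rule dc(1)[OF meas qm wi]) (use conv qb in auto)
  with q0 have "integral\<^sup>L lborel (\<lambda>x. frechet_derivative f (at x) v) = 0"
    by (simp add: LIMSEQ_const_iff)
  moreover have "integrable lborel (\<lambda>x. frechet_derivative f (at x) v)"
    by (rule dc(2)[where s = q, OF meas qm wi]) (use conv qb in auto)
  ultimately show ?thesis using has_integral_integral_lborel by metis
qed

text \<open>The product of f and \<theta>, zero off K, is C1 on both open sets U and -K, which cover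
  the space; the integral of its derivative vanishes. Off K the factor \<theta> is 0, so whatever f
  and its derivative are outside U has no effect.\<close>

lemma has_integral_by_parts_compact_support:
  fixes f \<theta> :: "'a::euclidean_space \<Rightarrow> real"
  assumes f: "C1_on f U" "open U" and \<theta>: "C1_on \<theta> UNIV"
    and K: "compact K" "K \<subseteq> U" "\<And>x. x \<notin> K \<Longrightarrow> \<theta> x = 0"
  shows "((\<lambda>x. f x * frechet_derivative \<theta> (at x) v + frechet_derivative f (at x) v * \<theta> x)
    has_integral 0) UNIV"
proof -
  have oK: "open (- K)" using K(1) by (simp add: compact_imp_closed open_Compl)
  have "C1_on (\<lambda>x. f x * \<theta> x) (U \<union> - K)"
  proof (rule C1_on_Un)
    show "C1_on (\<lambda>x. f x * \<theta> x) U"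
      by (rule C1_on_mult[OF f(1) C1_on_subset[OF \<theta> subset_UNIV]])
    show "C1_on (\<lambda>x. f x * \<theta> x) (- K)"
      by (rule C1_on_cong_open[OF C1_on_const[of 0]]) (use oK K in auto)
  qed (use f oK in auto)
  moreover have "U \<union> - K = UNIV" using K by auto
  ultimately have "C1_on (\<lambda>x. f x * \<theta> x) UNIV" by (simp only:)
  then have "((\<lambda>x. frechet_derivative (\<lambda>x. f x * \<theta> x) (at x) v) has_integral 0) UNIV"
    by (rule has_integral_frechet_derivative_compact_support[OF _ K(1)]) (use K in auto)
  moreover have "frechet_derivative (\<lambda>x. f x * \<theta> x) (at x) v =
      f x * frechet_derivative \<theta> (at x) v + frechet_derivative f (at x) v * \<theta> x" for x
  proof (cases "x \<in> K")
    case True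
    have "((\<lambda>x. f x * \<theta> x) has_derivative
       (\<lambda>v. f x * frechet_derivative \<theta> (at x) v + frechet_derivative f (at x) v * \<theta> x)) (at x)"
      using True K by (intro has_derivative_mult C1_on_has_derivative[OF f(1)] C1_on_has_derivative[OF \<theta>]) auto
    from fun_cong[OF frechet_derivative_at[OF this], of v] show ?thesis by (rule sym)
  next
    case False
    have "frechet_derivative (\<lambda>x. f x * \<theta> x) (at x) = (\<lambda>v. 0)"
      by (rule frechet_derivative_eq_zero_open[OF oK]) (use False K in auto)
    moreover have "frechet_derivative \<theta> (at x) = (\<lambda>v. 0)"
      by (rule frechet_derivative_eq_zero_open[OF oK]) (use False K in auto)
    ultimately show ?thesis using False K by simp
  qed
  ultimately show ?thesis by (simp only:)
qed

section \<open>Partial derivatives of curried fields as Frechet derivatives along basis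
  vectors\<close>

lemma has_real_derivative_shift_0:
  "((\<lambda>s. f (x + s)) has_real_derivative D) (at 0) \<Longrightarrow> (f has_real_derivative D) (at (x :: real))"
  using DERIV_shift[of f D 0 x] unfolding add_0 add.commute[of x] by blast

lemma C1_on_partial_xt:
  assumes "C1_on (\<lambda>(x, t). f x t) S" "(x, t) \<in> S"
  shows "((\<lambda>y. f y t) has_real_derivative frechet_derivative (\<lambda>(x, t). f x t) (at (x, t)) (1, 0)) (at x)"
    "((\<lambda>s. f x s) has_real_derivative frechet_derivative (\<lambda>(x, t). f x t) (at (x, t)) (0, 1)) (at t)"
proof -
  note D = C1_on_directional_derivative[OF assms]
  show "((\<lambda>y. f y t) has_real_derivative frechet_derivative (\<lambda>(x, t). f x t) (at (x, t)) (1, 0)) (at x)"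
    by (rule has_real_derivative_shift_0) (use D[of "(1, 0)"] in simp)
  show "((\<lambda>s. f x s) has_real_derivative frechet_derivative (\<lambda>(x, t). f x t) (at (x, t)) (0, 1)) (at t)"
    by (rule has_real_derivative_shift_0) (use D[of "(0, 1)"] in simp)
qed

lemma C1_on_partial_xzt:
  assumes "C1_on (\<lambda>(x, z, t). f x z t) S" "(x, z, t) \<in> S"
  shows "((\<lambda>y. f y z t) has_real_derivative
      frechet_derivative (\<lambda>(x, z, t). f x z t) (at (x, z, t)) (1, 0, 0)) (at x)"
    "((\<lambda>v. f x v t) has_real_derivative
      frechet_derivative (\<lambda>(x, z, t). f x z t) (at (x, z, t)) (0, 1, 0)) (at z)"
    "((\<lambda>s. f x z s) has_real_derivative
      frechet_derivative (\<lambda>(x, z, t). f x z t) (at (x, z, t)) (0, 0, 1)) (at t)"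
proof -
  let ?D = "frechet_derivative (\<lambda>(x, z, t). f x z t) (at (x, z, t))"
  note D = C1_on_directional_derivative[OF assms]
  show "((\<lambda>y. f y z t) has_real_derivative ?D (1, 0, 0)) (at x)"
    by (rule has_real_derivative_shift_0) (use D[of "(1, 0, 0)"] in simp)
  show "((\<lambda>v. f x v t) has_real_derivative ?D (0, 1, 0)) (at z)"
    by (rule has_real_derivative_shift_0) (use D[of "(0, 1, 0)"] in simp)
  show "((\<lambda>s. f x z s) has_real_derivative ?D (0, 0, 1)) (at t)"
    by (rule has_real_derivative_shift_0) (use D[of "(0, 0, 1)"] in simp)
qed

section \<open>Compactly supported C1 bumps, in one variable and along a graph\<close>

definition bump :: "real \<Rightarrow> real" where
  "bump s = (max 0 (1 - s\<^sup>2))\<^sup>2"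

text \<open>Closed form of the derivative of \<open>bump\<close>. It vanishes at 0 and at distance
  at least 1, and elsewhere its sign is opposite to that of s; the one-sided integrals of the
  rescaled bump rely on this.\<close>

definition bump' :: "real \<Rightarrow> real" where
  "bump' s = - 4 * s * max 0 (1 - s\<^sup>2)"

text \<open>The positive part has a kink at 0, but squaring it makes the difference quotient at 0
  bounded by \<bar>h\<bar>. This is why \<open>bump\<close> squares a truncated parabola: the result
  is C1, the class required of a test function.\<close>

lemma has_real_derivative_max_0_square:
  "((\<lambda>y. (max 0 y)\<^sup>2) has_real_derivative 2 * max 0 y) (at (y::real))"
proof -
  consider "y > 0" | "y < 0" | "y = 0" by linarith
  then show ?thesis
  proof cases
    case 1
    have "((\<lambda>y. y\<^sup>2) has_real_derivative 2 * max 0 y) (at y)"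
      using 1 by (auto intro!: derivative_eq_intros)
    then show ?thesis
      by (rule has_field_derivative_transform_within_open[where S = "{0<..}"]) (use 1 in auto)
  next
    case 2
    have "((\<lambda>y. 0) has_real_derivative 2 * max 0 y) (at y)"
      using 2 by (auto intro!: derivative_eq_intros)
    then show ?thesis
      by (rule has_field_derivative_transform_within_open[where S = "{..<0}"]) (use 2 in auto)
  next
    case 3
    have "((\<lambda>h. (max 0 h)\<^sup>2 / h) \<longlongrightarrow> 0) (at (0::real))"
    proof (rule Lim_null_comparison)
      show "\<forall>\<^sub>F h in at 0. norm ((max 0 h)\<^sup>2 / h) \<le> \<bar>h :: real\<bar>"
        by (auto simp: max_def power2_eq_square)
      show "((\<lambda>h. \<bar>h\<bar>) \<longlongrightarrow> 0) (at (0::real))" by (auto intro!: tendsto_eq_intros)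
    qed
    then show ?thesis using 3 by (simp add: DERIV_def)
  qed
qed

lemma bump_has_real_derivative: "(bump has_real_derivative bump' s) (at s)"
proof -
  have "((\<lambda>s. 1 - s\<^sup>2) has_real_derivative - 2 * s) (at s)" by (auto intro!: derivative_eq_intros)
  from DERIV_chain2[OF has_real_derivative_max_0_square this] show ?thesis
    unfolding bump_def[abs_def] bump'_def by (simp add: algebra_simps)
qed

lemma continuous_on_bump': "continuous_on S bump'"
  unfolding bump'_def[abs_def] by (intro continuous_intros)

lemma C1_on_bump: "C1_on bump S"
  by (rule C1_on_real_derivI[OF bump_has_real_derivative continuous_on_bump'])

lemma continuous_on_bump: "continuous_on S bump"
  using C1_on_imp_continuous_on[OF C1_on_bump] .

lemma bump_bounds: "0 \<le> bump s" "bump s \<le> 1"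
  unfolding bump_def by (auto simp: abs_square_le_1)

lemma bump_0 [simp]: "bump 0 = 1" by (simp add: bump_def)

lemma bump_outside: "1 \<le> \<bar>s\<bar> \<Longrightarrow> bump s = 0" "1 \<le> \<bar>s\<bar> \<Longrightarrow> bump' s = 0"
proof -
  assume "1 \<le> \<bar>s\<bar>"
  then have "max 0 (1 - s\<^sup>2) = 0" using abs_le_square_iff[of 1 s] by simp
  then show "bump s = 0" "bump' s = 0" by (simp_all add: bump_def bump'_def)
qed

text \<open>The horizontal and temporal width \<delta> and the vertical width \<epsilon> are
  separate because the jump condition is obtained by letting \<epsilon> tend to 0 while \<delta>
  stays fixed. With a constant \<gamma> it is an ordinary product bump.\<close>

definition graph_bump ::
  "(real \<Rightarrow> real \<Rightarrow> real) \<Rightarrow> real \<Rightarrow> real \<Rightarrow> real \<Rightarrow> real \<Rightarrow> real \<Rightarrow> real \<Rightarrow> real \<Rightarrow> real" where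
  "graph_bump \<gamma> x0 t0 \<delta> \<epsilon> x z t =
     bump ((x - x0) / \<delta>) * bump ((z - \<gamma> x t) / \<epsilon>) * bump ((t - t0) / \<delta>)"

lemma graph_bump_outside:
  assumes "\<delta> > 0" "\<epsilon> > 0" "\<delta> \<le> \<bar>x - x0\<bar> \<or> \<delta> \<le> \<bar>t - t0\<bar> \<or> \<epsilon> \<le> \<bar>z - \<gamma> x t\<bar>"
  shows "graph_bump \<gamma> x0 t0 \<delta> \<epsilon> x z t = 0"
  using assms by (auto simp: graph_bump_def bump_outside)

text \<open>The graph function \<gamma> is C1 only for times in J. The time factor vanishes outside
  a closed interval contained in J, so the function on J and the zero function on the complement of
  that interval glue to a C1 function on the whole space.\<close>

lemma C1_xzt_graph_bump:
  assumes "C1_xt J \<gamma>" "open J" "{t0 - \<delta>..t0 + \<delta>} \<subseteq> J" "\<delta> > 0" "\<epsilon> > 0"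
  shows "C1_xzt UNIV (graph_bump \<gamma> x0 t0 \<delta> \<epsilon>)"
proof -
  let ?\<theta> = "\<lambda>(x, z, t). graph_bump \<gamma> x0 t0 \<delta> \<epsilon> x z t"
  have [simp]: "open (UNIV \<times> UNIV \<times> J :: (real \<times> real \<times> real) set)"
    "open (UNIV \<times> UNIV \<times> - {t0 - \<delta>..t0 + \<delta>} :: (real \<times> real \<times> real) set)"
    using assms(2) by (auto intro!: open_Times)
  have "C1_on ?\<theta> (UNIV \<times> UNIV \<times> J \<union> UNIV \<times> UNIV \<times> - {t0 - \<delta>..t0 + \<delta>})"
  proof (rule C1_on_Un)
    have "C1_on (\<lambda>X. (\<lambda>(x, t). \<gamma> x t) (fst X, snd (snd X))) (UNIV \<times> UNIV \<times> J)"
      by (rule C1_on_compose[OF _ assms(1)[unfolded C1_xt_def]]) (auto intro!: C1_on_intros)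
    then show "C1_on ?\<theta> (UNIV \<times> UNIV \<times> J)"
      unfolding graph_bump_def case_prod_unfold using assms
      by (auto intro!: C1_on_mult C1_on_compose[OF _ C1_on_bump[of UNIV]] C1_on_intros)
    show "C1_on ?\<theta> (UNIV \<times> UNIV \<times> - {t0 - \<delta>..t0 + \<delta>})"
      by (rule C1_on_cong_open[OF C1_on_const[of 0]]) (use assms in \<open>auto simp: graph_bump_outside\<close>)
  qed auto
  moreover have "UNIV \<times> UNIV \<times> J \<union> UNIV \<times> UNIV \<times> - {t0 - \<delta>..t0 + \<delta>} = (UNIV :: (real \<times> real \<times> real) set)"
    using assms by auto
  ultimately show ?thesis unfolding C1_xzt_def by simp
qed

lemma test_function_graph_bump:
  assumes "C1_xt J \<gamma>" "open J" "{t0 - \<delta>..t0 + \<delta>} \<subseteq> J" "\<delta> > 0" "\<epsilon> > 0"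
    and "\<And>x t. \<bar>x - x0\<bar> \<le> \<delta> \<Longrightarrow> \<bar>t - t0\<bar> \<le> \<delta> \<Longrightarrow> \<bar>\<gamma> x t - z0\<bar> + \<epsilon> \<le> \<rho>"
    and "{x0 - \<delta>..x0 + \<delta>} \<times> {z0 - \<rho>..z0 + \<rho>} \<times> {t0 - \<delta>..t0 + \<delta>} \<subseteq> \<Omega>"
  shows "test_function \<Omega> (graph_bump \<gamma> x0 t0 \<delta> \<epsilon>)"
  unfolding test_function_def
proof (intro conjI exI[of _ "{x0 - \<delta>..x0 + \<delta>} \<times> {z0 - \<rho>..z0 + \<rho>} \<times> {t0 - \<delta>..t0 + \<delta>}"] allI impI)
  show "C1_xzt UNIV (graph_bump \<gamma> x0 t0 \<delta> \<epsilon>)" by (rule C1_xzt_graph_bump[OF assms(1-5)])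
next
  fix x z t
  assume *: "(x, z, t) \<notin> {x0 - \<delta>..x0 + \<delta>} \<times> {z0 - \<rho>..z0 + \<rho>} \<times> {t0 - \<delta>..t0 + \<delta>}"
  show "graph_bump \<gamma> x0 t0 \<delta> \<epsilon> x z t = 0"
  proof (cases "\<bar>x - x0\<bar> < \<delta> \<and> \<bar>t - t0\<bar> < \<delta>")
    case True
    then have "\<bar>\<gamma> x t - z0\<bar> + \<epsilon> \<le> \<rho>" using assms(6) by simp
    moreover have "\<not> \<bar>z - z0\<bar> \<le> \<rho>" using * True by (auto simp: abs_le_iff)
    ultimately show ?thesis by (intro graph_bump_outside assms(4,5)) linarith
  next
    case False
    then show ?thesis by (intro graph_bump_outside assms(4,5)) auto
  qed
qed (use assms(7) in \<open>auto intro!: compact_Times\<close>)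

section \<open>From a weak balance law to its pointwise form\<close>

lemma open_box_neighbourhood:
  assumes "open (U :: (real \<times> real \<times> real) set)" "(x, z, t) \<in> U"
  obtains \<delta> where "\<delta> > 0" "{x - \<delta>..x + \<delta>} \<times> {z - \<delta>..z + \<delta>} \<times> {t - \<delta>..t + \<delta>} \<subseteq> U"
proof -
  obtain e where e: "e > 0" "ball (x, z, t) e \<subseteq> U" using assms openE by blast
  \<comment> \<open>Three coordinate deviations of at most e / 4 add up to less than e.\<close>
  define d where "d = e / 4"
  have *: "(x', z', t') \<in> U" if "\<bar>x' - x\<bar> \<le> d" "\<bar>z' - z\<bar> \<le> d" "\<bar>t' - t\<bar> \<le> d" for x' z' t'
  proof -
    have "dist (x, z, t) (x', z', t') \<le> norm (x' - x) + (norm (z' - z) + norm (t' - t))"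
      using norm_Pair_le[of "x - x'" "(z - z', t - t')"] norm_Pair_le[of "z - z'" "t - t'"]
      by (simp add: dist_norm abs_minus_commute)
    also have "\<dots> < e" using that e(1) unfolding d_def by simp
    finally have "(x', z', t') \<in> ball (x, z, t) e" by simp
    then show ?thesis using e(2) by blast
  qed
  moreover have "d > 0" using e(1) by (simp add: d_def)
  ultimately show ?thesis by (intro that[of d]) (auto intro!: * simp: abs_le_iff)
qed

text \<open>Fundamental lemma of the calculus of variations: after integration by parts the residual
  R of the equation is orthogonal to every test function. If R were nonzero at a point, a bump
  supported where R keeps its sign would give a contradiction.\<close>

lemma weak_balance_interior:
  assumes wb: "weak_balance \<Omega> A B C S" and U: "open U" "U \<subseteq> \<Omega>" and X0: "(x0, z0, t0) \<in> U"
    and A: "C1_on (\<lambda>(x, z, t). A x z t) U" and B: "C1_on (\<lambda>(x, z, t). B x z t) U"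
    and C: "C1_on (\<lambda>(x, z, t). C x z t) U" and S: "continuous_on U (\<lambda>(x, z, t). S x z t)"
  shows "deriv (\<lambda>s. A x0 z0 s) t0 + deriv (\<lambda>y. B y z0 t0) x0 + deriv (\<lambda>v. C x0 v t0) z0 = S x0 z0 t0"
proof -
  let ?D = "\<lambda>F X. frechet_derivative (\<lambda>(x, z, t). F x z t :: real) (at (X :: real \<times> real \<times> real))"
  define R where "R X = (case X of (x, z, t) \<Rightarrow> S x z t) - ?D A X (0, 0, 1) - ?D B X (1, 0, 0) - ?D C X (0, 1, 0)" for X
  have Rc: "continuous_on U R"
    unfolding R_def by (intro continuous_intros S C1_on_continuous_on_frechet A B C)
  have "R (x0, z0, t0) = 0"
  proof (rule ccontr)
    assume nz: "R (x0, z0, t0) \<noteq> 0"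
    \<comment> \<open>Multiplying by the sign treats a positive and a negative residual at
      once.\<close>
    define \<sigma> where "\<sigma> = sgn (R (x0, z0, t0))"
    have \<sigma>: "\<sigma> * R (x0, z0, t0) > 0" unfolding \<sigma>_def using nz by (auto simp: sgn_if)
    have "open (U \<inter> (\<lambda>X. \<sigma> * R X) -` {0<..})"
      by (rule continuous_open_preimage[OF continuous_on_mult_left[OF Rc] U(1) open_greaterThan])
    moreover have "(x0, z0, t0) \<in> U \<inter> (\<lambda>X. \<sigma> * R X) -` {0<..}" using X0 \<sigma> by simp
    ultimately obtain \<delta> where \<delta>: "\<delta> > 0"
      "{x0 - \<delta>..x0 + \<delta>} \<times> {z0 - \<delta>..z0 + \<delta>} \<times> {t0 - \<delta>..t0 + \<delta>} \<subseteq> U \<inter> (\<lambda>X. \<sigma> * R X) -` {0<..}"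
      by (rule open_box_neighbourhood)
    define K where "K = {x0 - \<delta>..x0 + \<delta>} \<times> {z0 - \<delta>..z0 + \<delta>} \<times> {t0 - \<delta>..t0 + \<delta>}"
    have Kbox: "K = cbox (x0 - \<delta>, z0 - \<delta>, t0 - \<delta>) (x0 + \<delta>, z0 + \<delta>, t0 + \<delta>)"
      unfolding K_def cbox_Pair_eq by simp
    have K: "compact K" "K \<subseteq> U" "\<And>X. X \<in> K \<Longrightarrow> \<sigma> * R X > 0"
      unfolding Kbox using \<delta>(2) unfolding K_def[symmetric] Kbox by auto
    \<comment> \<open>Here the graph is the plane z = z0, so the bump is centred at (x0, z0, t0) and
      lives on the box K.\<close>
    define \<theta> where "\<theta> = graph_bump (\<lambda>x t. z0) x0 t0 \<delta> \<delta>"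
    have cz: "C1_xt UNIV (\<lambda>x t. z0)" unfolding C1_xt_def by (simp add: case_prod_unfold C1_on_const)
    have test: "test_function \<Omega> \<theta>"
      unfolding \<theta>_def using \<delta> U(2)
      by (intro test_function_graph_bump[OF cz, where ?z0.0 = z0 and \<rho> = \<delta>]) auto
    have \<theta>1: "C1_on (\<lambda>(x, z, t). \<theta> x z t) UNIV"
      using test unfolding test_function_def C1_xzt_def by simp
    have \<theta>0: "(\<lambda>(x, z, t). \<theta> x z t) X = 0" if "X \<notin> K" for X
      using that \<delta>(1) unfolding \<theta>_def K_def
      by (cases X) (auto intro!: graph_bump_outside simp: abs_if split: if_splits)
    define g where "g X = \<sigma> * (R X * (\<lambda>(x, z, t). \<theta> x z t) X)" for X
    have dv: "deriv (\<lambda>s. \<theta> x z s) t = ?D \<theta> (x, z, t) (0, 0, 1)"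
      "deriv (\<lambda>y. \<theta> y z t) x = ?D \<theta> (x, z, t) (1, 0, 0)"
      "deriv (\<lambda>v. \<theta> x v t) z = ?D \<theta> (x, z, t) (0, 1, 0)" for x z t
      using C1_on_partial_xzt[OF \<theta>1, of x z t] by (auto intro!: DERIV_imp_deriv)
    have D0: "?D \<theta> X = (\<lambda>v. 0)" if "X \<notin> K" for X
      by (rule frechet_derivative_eq_zero_open[of "- K"])
        (use K(1) that \<theta>0 in \<open>auto simp: compact_imp_closed open_Compl\<close>)
    have "((\<lambda>(x, z, t). A x z t * ?D \<theta> (x, z, t) (0, 0, 1) + B x z t * ?D \<theta> (x, z, t) (1, 0, 0)
          + C x z t * ?D \<theta> (x, z, t) (0, 1, 0) + S x z t * \<theta> x z t) has_integral 0) \<Omega>"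
      using wb[unfolded weak_balance_def, rule_format, OF test] unfolding dv .
    then have 1: "((\<lambda>(x, z, t). A x z t * ?D \<theta> (x, z, t) (0, 0, 1) + B x z t * ?D \<theta> (x, z, t) (1, 0, 0)
          + C x z t * ?D \<theta> (x, z, t) (0, 1, 0) + S x z t * \<theta> x z t) has_integral 0) UNIV"
    proof (rule has_integral_on_superset)
      fix X assume "X \<notin> \<Omega>"
      with K U have "X \<notin> K" by blast
      then show "(\<lambda>(x, z, t). A x z t * ?D \<theta> (x, z, t) (0, 0, 1) + B x z t * ?D \<theta> (x, z, t) (1, 0, 0)
          + C x z t * ?D \<theta> (x, z, t) (0, 1, 0) + S x z t * \<theta> x z t) X = 0"
        using \<theta>0[of X] D0[of X] by (cases X) simp
    qed simp
    note bp = has_integral_by_parts_compact_support[OF _ U(1) \<theta>1 K(1,2) \<theta>0]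
    \<comment> \<open>Subtracting the three integrations by parts from the weak equation removes
      every derivative of \<theta> and leaves R times \<theta>.\<close>
    note I = has_integral_diff[OF has_integral_diff[OF has_integral_diff[OF 1 bp[OF A, of "(0, 0, 1)"]]
          bp[OF B, of "(1, 0, 0)"]] bp[OF C, of "(0, 1, 0)"]]
    have "((\<lambda>X. R X * (\<lambda>(x, z, t). \<theta> x z t) X) has_integral 0 - 0 - 0 - 0) UNIV"
      by (rule has_integral_eq[OF _ I]) (auto simp: R_def algebra_simps)
    then have "((\<lambda>X. R X * (\<lambda>(x, z, t). \<theta> x z t) X) has_integral 0) UNIV"
      by (simp only: diff_zero)
    from has_integral_mult_right[OF this, of \<sigma>] have "(g has_integral 0) UNIV"
      unfolding g_def by (simp only: mult_zero_right)
    then have "((\<lambda>X. if X \<in> K then g X else 0) has_integral 0) UNIV"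
      by (rule has_integral_eq[rotated]) (simp add: g_def \<theta>0)
    then have gi: "(g has_integral 0) K" unfolding has_integral_restrict_UNIV .
    have gc: "continuous_on K g" unfolding g_def
      by (rule continuous_on_mult_left, rule continuous_on_mult, rule continuous_on_subset[OF Rc K(2)])
        (rule continuous_on_subset[OF C1_on_imp_continuous_on[OF \<theta>1]], simp)
    have g0: "0 \<le> g X" if "X \<in> box (x0 - \<delta>, z0 - \<delta>, t0 - \<delta>) (x0 + \<delta>, z0 + \<delta>, t0 + \<delta>)" for X
    proof -
      have "X \<in> K" using that box_subset_cbox unfolding Kbox by blast
      moreover have "0 \<le> (\<lambda>(x, z, t). \<theta> x z t) X"
        by (cases X) (simp add: \<theta>_def graph_bump_def bump_bounds)
      ultimately show ?thesis using mult_nonneg_nonneg[OF less_imp_le[OF K(3)[of X]]]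
        unfolding g_def by (simp only: mult.assoc)
    qed
    have ne: "box (x0 - \<delta>, z0 - \<delta>, t0 - \<delta>) (x0 + \<delta>, z0 + \<delta>, t0 + \<delta>) \<noteq> {}"
      unfolding box_ne_empty using \<delta>(1) by (auto simp: Basis_prod_def)
    have X0K: "(x0, z0, t0) \<in> K" unfolding K_def using \<delta>(1) by simp
    \<comment> \<open>A continuous function on a box, nonnegative in its interior and with zero
      integral, vanishes everywhere on it. At the centre the bump equals 1, so R would vanish
      there.\<close>
    have "g (x0, z0, t0) = 0"
      by (rule has_integral_0_cbox_imp_0[OF gc[unfolded Kbox] g0 gi[unfolded Kbox] ne X0K[unfolded Kbox]])
    moreover have "\<theta> x0 z0 t0 = 1" by (simp add: \<theta>_def graph_bump_def)
    ultimately show False using \<sigma> by (auto simp: g_def \<sigma>_def)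
  qed
  moreover have "deriv (\<lambda>s. A x0 z0 s) t0 = ?D A (x0, z0, t0) (0, 0, 1)"
    "deriv (\<lambda>y. B y z0 t0) x0 = ?D B (x0, z0, t0) (1, 0, 0)"
    "deriv (\<lambda>v. C x0 v t0) z0 = ?D C (x0, z0, t0) (0, 1, 0)"
    using C1_on_partial_xzt[OF A X0] C1_on_partial_xzt[OF B X0] C1_on_partial_xzt[OF C X0]
    by (auto intro!: DERIV_imp_deriv)
  ultimately show ?thesis unfolding R_def by simp
qed

section \<open>Jump conditions across a graph\<close>

lemma lborel_integral_translate:
  fixes k :: "real \<Rightarrow> real"
  shows "integral\<^sup>L lborel (\<lambda>z. k (z - c)) = integral\<^sup>L lborel k"
  using lborel_integral_real_affine[of 1 k "- c"] by (simp add: add.commute)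

text \<open>Integrating over z first, translation invariance makes the shift by
  \<open>\<gamma> x t\<close> disappear, and the triple integral factorises. Boundedness of \<gamma>
  on a compact square keeps the support compact, which justifies Fubini.\<close>

lemma has_integral_graph_product:
  fixes b k d :: "real \<Rightarrow> real" and \<gamma> :: "real \<Rightarrow> real \<Rightarrow> real"
  assumes c: "continuous_on UNIV b" "continuous_on UNIV k" "continuous_on UNIV d"
    and \<gamma>: "continuous_on UNIV (\<lambda>(x, t). \<gamma> x t)"
    and R: "\<And>s. R < \<bar>s\<bar> \<Longrightarrow> b s = 0 \<and> k s = 0 \<and> d s = 0"
  shows "((\<lambda>(x, z, t). b x * k (z - \<gamma> x t) * d t) has_integral
           integral UNIV b * integral UNIV k * integral UNIV d) UNIV"
proof -
  have \<gamma>': "continuous_on S (\<lambda>X. \<gamma> (f X) (g X))" if "continuous_on S f" "continuous_on S g"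
    for S :: "'b::topological_space set" and f g
    using continuous_on_compose2[OF \<gamma> continuous_on_Pair[OF that]] by auto
  have bc: "continuous_on S (\<lambda>X. b (f X))" "continuous_on S (\<lambda>X. k (f X))" "continuous_on S (\<lambda>X. d (f X))"
    if "continuous_on S f" for S :: "'b::topological_space set" and f
    using continuous_on_compose2[OF c(1) that] continuous_on_compose2[OF c(2) that]
      continuous_on_compose2[OF c(3) that] by auto
  have "compact ((\<lambda>(x, t). \<gamma> x t) ` ({-R..R} \<times> {-R..R}))"
    by (intro compact_continuous_image continuous_on_subset[OF \<gamma>]) (auto intro: compact_Times)
  then obtain \<Gamma> where "\<forall>y \<in> (\<lambda>(x, t). \<gamma> x t) ` ({-R..R} \<times> {-R..R}). \<bar>y\<bar> \<le> \<Gamma>"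
    using compact_imp_bounded bounded_real by blast
  then have \<Gamma>: "\<bar>\<gamma> x t\<bar> \<le> \<Gamma>" if "x \<in> {-R..R}" "t \<in> {-R..R}" for x t
    using that by force
  \<comment> \<open>For x and t within R the graph stays below \<bar>\<Gamma>\<bar> in absolute
    value; a height beyond R + \<bar>\<Gamma>\<bar> then puts the argument of k outside its
    support.\<close>
  define Z where "Z = R + \<bar>\<Gamma>\<bar>"
  define f where "f x z t = b x * k (z - \<gamma> x t) * d t" for x z t
  have f0: "f x z t = 0" if "R < \<bar>x\<bar> \<or> R < \<bar>t\<bar> \<or> Z < \<bar>z\<bar>" for x z t
  proof (cases "R < \<bar>x\<bar> \<or> R < \<bar>t\<bar>")
    case False
    then have "\<bar>\<gamma> x t\<bar> \<le> \<bar>\<Gamma>\<bar>" using \<Gamma>[of x t] by force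
    then have "R < \<bar>z - \<gamma> x t\<bar>" using that False unfolding Z_def by auto
    then show ?thesis using R unfolding f_def by simp
  qed (use R in \<open>auto simp: f_def\<close>)
  have ib: "integrable lborel b" and ik: "integrable lborel k" and id: "integrable lborel d"
  proof -
    have *: "integrable lborel h" if "continuous_on UNIV h" "\<And>s. R < \<bar>s\<bar> \<Longrightarrow> h s = 0" for h :: "real \<Rightarrow> real"
    proof -
      have "integrable lborel (\<lambda>s. indicator {-R..R} s *\<^sub>R h s)"
        by (rule borel_integrable_compact) (auto intro: continuous_on_subset[OF that(1)])
      moreover have "(\<lambda>s. indicator {-R..R} s *\<^sub>R h s) = h"
        using that(2) by (force simp: indicator_def)
      ultimately show ?thesis by simp
    qed
    show "integrable lborel b" "integrable lborel k" "integrable lborel d"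
      using * c R by blast+
  qed
  have i2: "integrable lborel (\<lambda>(z, t). f x z t)" for x
  proof -
    have "integrable lborel (\<lambda>X. indicator ({-Z..Z} \<times> {-R..R}) X *\<^sub>R (\<lambda>(z, t). f x z t) X)"
      unfolding f_def case_prod_unfold
      by (rule borel_integrable_compact) (auto intro!: compact_Times continuous_intros \<gamma>' bc)
    moreover have "indicator ({-Z..Z} \<times> {-R..R}) X *\<^sub>R (\<lambda>(z, t). f x z t) X = (\<lambda>(z, t). f x z t) X" for X
    proof -
      obtain z t where X: "X = (z, t)" by (cases X)
      show ?thesis
      proof (cases "(z, t) \<in> ({-Z..Z} \<times> {-R..R})")
        case False
        then have "R < \<bar>x\<bar> \<or> R < \<bar>t\<bar> \<or> Z < \<bar>z\<bar>" by auto
        with False show ?thesis unfolding X by (simp add: f0)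
      qed (simp add: X)
    qed
    ultimately show ?thesis by (simp only:)
  qed
  have i3: "integrable lborel (\<lambda>(x, z, t). f x z t)"
  proof -
    have "integrable lborel (\<lambda>X. indicator ({-R..R} \<times> {-Z..Z} \<times> {-R..R}) X *\<^sub>R (\<lambda>(x, z, t). f x z t) X)"
      unfolding f_def case_prod_unfold
      by (rule borel_integrable_compact) (auto intro!: compact_Times continuous_intros \<gamma>' bc)
    moreover have "indicator ({-R..R} \<times> {-Z..Z} \<times> {-R..R}) X *\<^sub>R (\<lambda>(x, z, t). f x z t) X = (\<lambda>(x, z, t). f x z t) X" for X
    proof -
      obtain x z t where X: "X = (x, z, t)" by (cases X)
      show ?thesis
      proof (cases "(x, z, t) \<in> ({-R..R} \<times> {-Z..Z} \<times> {-R..R})")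
        case False
        then have "R < \<bar>x\<bar> \<or> R < \<bar>t\<bar> \<or> Z < \<bar>z\<bar>" by auto
        with False show ?thesis unfolding X by (simp add: f0)
      qed (simp add: X)
    qed
    ultimately show ?thesis by (simp only:)
  qed
  have I2: "integral\<^sup>L lborel (\<lambda>(z, t). f x z t) = b x * (integral\<^sup>L lborel k * integral\<^sup>L lborel d)" for x
  proof -
    \<comment> \<open>The order is exchanged so that z is innermost, where the translation acts for
      fixed x and t.\<close>
    have "integral\<^sup>L lborel (\<lambda>(z, t). f x z t) = (\<integral>t. (\<integral>z. f x z t \<partial>lborel) \<partial>lborel)"
      using lborel_pair.integral_snd[of "f x"] i2[of x] unfolding lborel_prod by simp
    also have "(\<lambda>t. \<integral>z. f x z t \<partial>lborel) = (\<lambda>t. b x * integral\<^sup>L lborel k * d t)"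
      unfolding f_def by (simp add: lborel_integral_translate)
    finally show ?thesis by simp
  qed
  have "integral\<^sup>L lborel (\<lambda>(x, z, t). f x z t) = (\<integral>x. (\<integral>Y. (\<lambda>(z, t). f x z t) Y \<partial>lborel) \<partial>lborel)"
    using lborel_pair.integral_fst'[of "\<lambda>(x, z, t). f x z t"] i3 unfolding lborel_prod
    by (simp add: case_prod_unfold)
  also have "\<dots> = integral\<^sup>L lborel b * (integral\<^sup>L lborel k * integral\<^sup>L lborel d)"
    unfolding I2 by simp
  finally have "((\<lambda>(x, z, t). f x z t) has_integral
      integral\<^sup>L lborel b * (integral\<^sup>L lborel k * integral\<^sup>L lborel d)) UNIV"
    using has_integral_integral_lborel[OF i3] by simp
  then show ?thesis
    using ib ik id by (simp add: f_def integral_lborel mult.assoc)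
qed

text \<open>The graph is the image of the null hyperplane z = 0 under the shear that adds
  \<open>\<gamma> x t\<close> to z. This shear is C1, and differentiable maps between spaces of
  equal dimension preserve null sets.\<close>

lemma negligible_graph:
  assumes "C1_xt J \<gamma>"
  shows "negligible {(x, z, t). t \<in> J \<and> z = \<gamma> x t}"
proof -
  define S where "S = {(x, z, t). t \<in> J \<and> z = (0 :: real)} \<inter> (UNIV :: (real \<times> real \<times> real) set)"
  define g where "g X = (fst X, \<gamma> (fst X) (snd (snd X)) + fst (snd X), snd (snd X))" for X :: "real \<times> real \<times> real"
  have C: "C1_on g (UNIV \<times> UNIV \<times> J)"
  proof -
    have "C1_on (\<lambda>X. (\<lambda>(x, t). \<gamma> x t) (fst X, snd (snd X))) (UNIV \<times> UNIV \<times> J)"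
      by (rule C1_on_compose[OF _ assms[unfolded C1_xt_def]]) (auto intro!: C1_on_intros)
    then show ?thesis unfolding g_def[abs_def] by (intro C1_on_intros) (simp_all)
  qed
  have "negligible {X :: real \<times> real \<times> real. X \<bullet> (0, 1, 0) = 0}"
    by (rule negligible_standard_hyperplane) (auto simp: Basis_prod_def)
  then have "negligible S" by (rule negligible_subset) (auto simp: S_def)
  moreover have "g differentiable_on S"
    unfolding differentiable_on_def
  proof
    fix X assume "X \<in> S"
    then have "X \<in> UNIV \<times> UNIV \<times> J" by (auto simp: S_def)
    then show "g differentiable at X within S"
      using C1_on_has_derivative[OF C] differentiable_at_withinI differentiable_def by blast
  qed
  ultimately have "negligible (g ` S)" by (intro negligible_differentiable_image_negligible) auto
  moreover have "{(x, z, t). t \<in> J \<and> z = \<gamma> x t} \<subseteq> g ` S"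
  proof clarify
    fix x z t assume "t \<in> J"
    then show "(x, \<gamma> x t, t) \<in> g ` S"
      by (intro image_eqI[of _ _ "(x, 0, t)"]) (auto simp: S_def g_def)
  qed
  ultimately show ?thesis by (rule negligible_subset)
qed

section \<open>One-dimensional bumps rescaled to a given width\<close>

definition sbump :: "real \<Rightarrow> real \<Rightarrow> real \<Rightarrow> real" where
  "sbump \<delta> a s = bump ((s - a) / \<delta>)"

definition sbump' :: "real \<Rightarrow> real \<Rightarrow> real \<Rightarrow> real" where
  "sbump' \<delta> a s = bump' ((s - a) / \<delta>) / \<delta>"

lemma sbump_has_real_derivative:
  "\<delta> > 0 \<Longrightarrow> (sbump \<delta> a has_real_derivative sbump' \<delta> a s) (at s)"
proof -
  assume "\<delta> > 0"
  have "((\<lambda>s. (s - a) / \<delta>) has_real_derivative 1 / \<delta>) (at s)"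
    using \<open>\<delta> > 0\<close> by (auto intro!: derivative_eq_intros)
  from DERIV_chain2[OF bump_has_real_derivative this] show ?thesis
    unfolding sbump_def[abs_def] sbump'_def by simp
qed

lemma continuous_on_sbump: "\<delta> > 0 \<Longrightarrow> continuous_on S (sbump \<delta> a)"
  unfolding sbump_def[abs_def]
  by (rule continuous_on_compose2[OF continuous_on_bump[of UNIV]]) (auto intro!: continuous_intros)

lemma continuous_on_sbump': "\<delta> > 0 \<Longrightarrow> continuous_on S (sbump' \<delta> a)"
  unfolding sbump'_def[abs_def]
  by (intro continuous_intros continuous_on_compose2[OF continuous_on_bump'[of UNIV]]) auto

lemma sbump_outside:
  assumes "\<delta> > 0" "\<delta> \<le> \<bar>s - a\<bar>"
  shows "sbump \<delta> a s = 0" "sbump' \<delta> a s = 0"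
  using assms by (auto simp: sbump_def sbump'_def bump_outside)

lemma sbump_bounds: "0 \<le> sbump \<delta> a s" "sbump \<delta> a s \<le> 1"
  by (simp_all add: sbump_def bump_bounds)

lemma sbump_integral:
  assumes "\<delta> > 0"
  shows "integral UNIV (sbump \<delta> a) > 0" "integral UNIV (sbump \<delta> a) \<le> 2 * \<delta>"
proof -
  have i: "(sbump \<delta> a) integrable_on {a - \<delta>..a + \<delta>}"
    using continuous_on_sbump[OF assms] by (rule integrable_continuous_interval)
  have eq: "integral UNIV (sbump \<delta> a) = integral {a - \<delta>..a + \<delta>} (sbump \<delta> a)"
  proof -
    have "((sbump \<delta> a) has_integral integral {a - \<delta>..a + \<delta>} (sbump \<delta> a)) UNIV"
      by (rule has_integral_on_superset[OF integrable_integral[OF i]])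
        (use assms in \<open>auto intro!: sbump_outside simp: abs_if split: if_splits\<close>)
    then show ?thesis by (rule integral_unique)
  qed
  have "integral {a - \<delta>..a + \<delta>} (sbump \<delta> a) \<noteq> 0"
  proof
    assume "integral {a - \<delta>..a + \<delta>} (sbump \<delta> a) = 0"
    then have "(sbump \<delta> a has_integral 0) (cbox (a - \<delta>) (a + \<delta>))"
      using integrable_integral[OF i] by simp
    then have "sbump \<delta> a a = 0"
      by (rule has_integral_0_cbox_imp_0[where f = "sbump \<delta> a", OF continuous_on_sbump[OF assms] sbump_bounds(1)])
        (use assms in auto)
    then show False by (simp add: sbump_def)
  qed
  moreover have "integral {a - \<delta>..a + \<delta>} (sbump \<delta> a) \<ge> 0"
    by (rule integral_nonneg[OF i]) (simp add: sbump_bounds)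
  ultimately show "integral UNIV (sbump \<delta> a) > 0" unfolding eq by simp
  have "integral {a - \<delta>..a + \<delta>} (sbump \<delta> a) \<le> integral {a - \<delta>..a + \<delta>} (\<lambda>s. 1)"
    by (rule integral_le[OF i]) (auto simp: sbump_bounds intro: integrable_continuous_interval)
  then show "integral UNIV (sbump \<delta> a) \<le> 2 * \<delta>" unfolding eq using assms by simp
qed

text \<open>By the fundamental theorem of calculus the two halves of the derivative have masses -1
  and 1 for every \<delta>. As the width shrinks they behave like Dirac masses, one seeing only the
  upper side of the graph and one only the lower. Cutting with \<open>max s 0\<close> and
  \<open>min s 0\<close> keeps them continuous since \<open>sbump' \<delta> 0\<close> vanishes at
  0.\<close>

lemma sbump'_one_sided_integral:
  assumes "\<delta> > 0"
  shows "integral UNIV (\<lambda>s. sbump' \<delta> 0 (max s 0)) = - 1"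
    "integral UNIV (\<lambda>s. sbump' \<delta> 0 (min s 0)) = 1"
proof -
  have z: "sbump' \<delta> 0 0 = 0" by (simp add: sbump'_def bump'_def)
  have F: "(sbump' \<delta> 0 has_integral sbump \<delta> 0 v - sbump \<delta> 0 u) {u..v}" if "u \<le> v" for u v
    using that sbump_has_real_derivative[OF assms, of 0]
    by (intro fundamental_theorem_of_calculus)
      (auto simp: has_real_derivative_iff_has_vector_derivative[symmetric] intro: has_field_derivative_at_within)
  have v: "sbump \<delta> 0 \<delta> = 0" "sbump \<delta> 0 (- \<delta>) = 0" "sbump \<delta> 0 0 = 1"
    using assms by (auto simp: sbump_outside) (simp add: sbump_def)
  have "((\<lambda>s. sbump' \<delta> 0 (max s 0)) has_integral sbump \<delta> 0 \<delta> - sbump \<delta> 0 0) {0..\<delta>}"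
    by (rule has_integral_eq[OF _ F]) (use assms in auto)
  then have "((\<lambda>s. sbump' \<delta> 0 (max s 0)) has_integral sbump \<delta> 0 \<delta> - sbump \<delta> 0 0) UNIV"
    by (rule has_integral_on_superset)
      (use assms z in \<open>auto simp: max_def sbump_outside not_le\<close>)
  then show "integral UNIV (\<lambda>s. sbump' \<delta> 0 (max s 0)) = - 1"
    using v by (simp add: integral_unique)
  have "((\<lambda>s. sbump' \<delta> 0 (min s 0)) has_integral sbump \<delta> 0 0 - sbump \<delta> 0 (- \<delta>)) {-\<delta>..0}"
    by (rule has_integral_eq[OF _ F]) (use assms in auto)
  then have "((\<lambda>s. sbump' \<delta> 0 (min s 0)) has_integral sbump \<delta> 0 0 - sbump \<delta> 0 (- \<delta>)) UNIV"
    by (rule has_integral_on_superset)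
      (use assms z in \<open>auto simp: min_def sbump_outside not_le\<close>)
  then show "integral UNIV (\<lambda>s. sbump' \<delta> 0 (min s 0)) = 1"
    using v by (simp add: integral_unique)
qed

lemma sbump'_sign:
  assumes "\<delta> > 0"
  shows "s \<ge> 0 \<Longrightarrow> sbump' \<delta> 0 s \<le> 0" "s \<le> 0 \<Longrightarrow> sbump' \<delta> 0 s \<ge> 0"
proof -
  have eq: "sbump' \<delta> 0 s = - (s * (4 * max 0 (1 - (s / \<delta>)\<^sup>2) / \<delta>\<^sup>2))"
    using assms by (simp add: sbump'_def bump'_def power2_eq_square)
  have nn: "4 * max 0 (1 - (s / \<delta>)\<^sup>2) / \<delta>\<^sup>2 \<ge> 0" by simp
  show "s \<ge> 0 \<Longrightarrow> sbump' \<delta> 0 s \<le> 0" "s \<le> 0 \<Longrightarrow> sbump' \<delta> 0 s \<ge> 0"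
    unfolding eq using mult_nonneg_nonneg[OF _ nn] mult_nonpos_nonneg[OF _ nn]
    by (simp_all only: neg_le_0_iff_le neg_0_le_iff_le)
qed

section \<open>Derivatives of graph bumps and neighbourhoods of a point on a graph\<close>

lemma C1_xt_partials:
  assumes "C1_xt J f" "t \<in> J"
  shows "((\<lambda>y. f y t) has_real_derivative deriv (\<lambda>y. f y t) x) (at x)"
    "((\<lambda>s. f x s) has_real_derivative deriv (\<lambda>s. f x s) t) (at t)"
proof -
  have X: "(x, t) \<in> UNIV \<times> J" using assms(2) by simp
  note D = C1_on_partial_xt[OF assms(1)[unfolded C1_xt_def] X]
  show "((\<lambda>y. f y t) has_real_derivative deriv (\<lambda>y. f y t) x) (at x)"
    using D(1) unfolding DERIV_imp_deriv[OF D(1)] .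
  show "((\<lambda>s. f x s) has_real_derivative deriv (\<lambda>s. f x s) t) (at t)"
    using D(2) unfolding DERIV_imp_deriv[OF D(2)] .
qed

lemma C1_xt_continuous_partials:
  assumes "C1_xt J f"
  shows "continuous_on (UNIV \<times> J) (\<lambda>(x, t). deriv (\<lambda>y. f y t) x)"
    "continuous_on (UNIV \<times> J) (\<lambda>(x, t). deriv (\<lambda>s. f x s) t)"
proof -
  note C = assms[unfolded C1_xt_def]
  have *: "deriv (\<lambda>y. f y t) x = frechet_derivative (\<lambda>(x, t). f x t) (at (x, t)) (1, 0)"
    "deriv (\<lambda>s. f x s) t = frechet_derivative (\<lambda>(x, t). f x t) (at (x, t)) (0, 1)" if "t \<in> J" for x t
    using C1_on_partial_xt[OF C, of x t] that by (auto intro!: DERIV_imp_deriv)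
  show "continuous_on (UNIV \<times> J) (\<lambda>(x, t). deriv (\<lambda>y. f y t) x)"
    by (rule continuous_on_eq[OF C1_on_continuous_on_frechet[OF C, of "(1, 0)"]]) (auto simp: *)
  show "continuous_on (UNIV \<times> J) (\<lambda>(x, t). deriv (\<lambda>s. f x s) t)"
    by (rule continuous_on_eq[OF C1_on_continuous_on_frechet[OF C, of "(0, 1)"]]) (auto simp: *)
qed

lemma graph_bump_sbump:
  "graph_bump \<gamma> x0 t0 \<delta> \<epsilon> x z t = sbump \<delta> x0 x * sbump \<epsilon> 0 (z - \<gamma> x t) * sbump \<delta> t0 t"
  by (simp add: graph_bump_def sbump_def)

text \<open>Through \<open>z - \<gamma> x t\<close> the x and t derivatives also fall on the
  vertical profile. These terms are of size 1 / \<epsilon> and carry the slopes of the graph into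
  the jump condition.\<close>

lemma graph_bump_derivs:
  assumes "C1_xt J \<gamma>" "t \<in> J" "\<delta> > 0" "\<epsilon> > 0"
  shows "deriv (\<lambda>y. graph_bump \<gamma> x0 t0 \<delta> \<epsilon> y z t) x =
      sbump' \<delta> x0 x * sbump \<epsilon> 0 (z - \<gamma> x t) * sbump \<delta> t0 t
      - deriv (\<lambda>y. \<gamma> y t) x * sbump \<delta> x0 x * sbump' \<epsilon> 0 (z - \<gamma> x t) * sbump \<delta> t0 t"
    "deriv (\<lambda>v. graph_bump \<gamma> x0 t0 \<delta> \<epsilon> x v t) z =
      sbump \<delta> x0 x * sbump' \<epsilon> 0 (z - \<gamma> x t) * sbump \<delta> t0 t"
    "deriv (\<lambda>s. graph_bump \<gamma> x0 t0 \<delta> \<epsilon> x z s) t =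
      sbump \<delta> x0 x * sbump \<epsilon> 0 (z - \<gamma> x t) * sbump' \<delta> t0 t
      - deriv (\<lambda>s. \<gamma> x s) t * sbump \<delta> x0 x * sbump' \<epsilon> 0 (z - \<gamma> x t) * sbump \<delta> t0 t"
proof -
  note D = sbump_has_real_derivative
  note \<gamma> = C1_xt_partials[OF assms(1,2)]
  have 1: "((\<lambda>y. sbump \<epsilon> 0 (z - \<gamma> y t)) has_real_derivative
      sbump' \<epsilon> 0 (z - \<gamma> x t) * (- deriv (\<lambda>y. \<gamma> y t) x)) (at x)"
    by (rule DERIV_chain2[OF D[OF assms(4)]]) (auto intro!: derivative_eq_intros \<gamma>)
  have 2: "((\<lambda>s. sbump \<epsilon> 0 (z - \<gamma> x s)) has_real_derivative
      sbump' \<epsilon> 0 (z - \<gamma> x t) * (- deriv (\<lambda>s. \<gamma> x s) t)) (at t)"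
    by (rule DERIV_chain2[OF D[OF assms(4)]]) (auto intro!: derivative_eq_intros \<gamma>)
  have 3: "((\<lambda>v. sbump \<epsilon> 0 (v - \<gamma> x t)) has_real_derivative sbump' \<epsilon> 0 (z - \<gamma> x t) * 1) (at z)"
    by (rule DERIV_chain2[OF D[OF assms(4)]]) (auto intro!: derivative_eq_intros)
  show "deriv (\<lambda>y. graph_bump \<gamma> x0 t0 \<delta> \<epsilon> y z t) x =
      sbump' \<delta> x0 x * sbump \<epsilon> 0 (z - \<gamma> x t) * sbump \<delta> t0 t
      - deriv (\<lambda>y. \<gamma> y t) x * sbump \<delta> x0 x * sbump' \<epsilon> 0 (z - \<gamma> x t) * sbump \<delta> t0 t"
    unfolding graph_bump_sbump
    by (rule DERIV_imp_deriv) (rule derivative_eq_intros 1 D[OF assms(3)] refl | simp add: algebra_simps)+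
  show "deriv (\<lambda>v. graph_bump \<gamma> x0 t0 \<delta> \<epsilon> x v t) z =
      sbump \<delta> x0 x * sbump' \<epsilon> 0 (z - \<gamma> x t) * sbump \<delta> t0 t"
    unfolding graph_bump_sbump
    by (rule DERIV_imp_deriv) (rule derivative_eq_intros 3 refl | simp add: algebra_simps)+
  show "deriv (\<lambda>s. graph_bump \<gamma> x0 t0 \<delta> \<epsilon> x z s) t =
      sbump \<delta> x0 x * sbump \<epsilon> 0 (z - \<gamma> x t) * sbump' \<delta> t0 t
      - deriv (\<lambda>s. \<gamma> x s) t * sbump \<delta> x0 x * sbump' \<epsilon> 0 (z - \<gamma> x t) * sbump \<delta> t0 t"
    unfolding graph_bump_sbump
    by (rule DERIV_imp_deriv) (rule derivative_eq_intros 2 D[OF assms(3)] refl | simp add: algebra_simps)+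
qed

text \<open>The base width is shrunk after the height \<rho> is fixed, so that \<gamma> uses up only
  half of the height; the other half leaves room for bumps of vertical width up to \<rho> /
  2.\<close>

lemma box_neighbourhood_graph:
  assumes "open (U :: (real \<times> real \<times> real) set)" "(x0, \<gamma> x0 t0, t0) \<in> U"
    and "open J" "t0 \<in> J" "continuous_on (UNIV \<times> J) (\<lambda>(x, t). \<gamma> x t)"
  obtains \<delta> \<rho> where "\<delta> > 0" "\<rho> > 0"
    "{x0 - \<delta>..x0 + \<delta>} \<times> {\<gamma> x0 t0 - \<rho>..\<gamma> x0 t0 + \<rho>} \<times> {t0 - \<delta>..t0 + \<delta>} \<subseteq> U"
    "{t0 - \<delta>..t0 + \<delta>} \<subseteq> J"
    "\<And>x t. x \<in> {x0 - \<delta>..x0 + \<delta>} \<Longrightarrow> t \<in> {t0 - \<delta>..t0 + \<delta>} \<Longrightarrow> \<bar>\<gamma> x t - \<gamma> x0 t0\<bar> \<le> \<rho> / 2"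
proof -
  obtain \<rho> where \<rho>: "\<rho> > 0"
    "{x0 - \<rho>..x0 + \<rho>} \<times> {\<gamma> x0 t0 - \<rho>..\<gamma> x0 t0 + \<rho>} \<times> {t0 - \<rho>..t0 + \<rho>} \<subseteq> U"
    using open_box_neighbourhood[OF assms(1,2)] .
  have "open ((UNIV \<times> J) \<inter> (\<lambda>(x, t). \<gamma> x t) -` {\<gamma> x0 t0 - \<rho> / 2<..<\<gamma> x0 t0 + \<rho> / 2})"
    using assms(3) by (intro continuous_open_preimage assms(5) open_Times) auto
  \<comment> \<open>The condition on (x, t) is pulled back to triples so that the neighbourhood
    lemma for triples applies; the middle coordinate 0 used below is a dummy.\<close>
  then have "open ((\<lambda>(x, z :: real, t). (x, t)) -` ((UNIV \<times> J) \<inter> (\<lambda>(x, t). \<gamma> x t) -` {\<gamma> x0 t0 - \<rho> / 2<..<\<gamma> x0 t0 + \<rho> / 2}))"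
    by (rule open_vimage) (auto simp: case_prod_unfold intro!: continuous_intros)
  then obtain \<delta> where \<delta>: "\<delta> > 0" "{x0 - \<delta>..x0 + \<delta>} \<times> {0 - \<delta>..0 + \<delta>} \<times> {t0 - \<delta>..t0 + \<delta>}
     \<subseteq> (\<lambda>(x, z :: real, t). (x, t)) -` ((UNIV \<times> J) \<inter> (\<lambda>(x, t). \<gamma> x t) -` {\<gamma> x0 t0 - \<rho> / 2<..<\<gamma> x0 t0 + \<rho> / 2})"
    by (rule open_box_neighbourhood[of _ x0 0 t0]) (use \<rho>(1) assms(4) in auto)
  have *: "t \<in> J \<and> \<gamma> x0 t0 - \<rho> / 2 < \<gamma> x t \<and> \<gamma> x t < \<gamma> x0 t0 + \<rho> / 2"
    if "x \<in> {x0 - \<delta>..x0 + \<delta>}" "t \<in> {t0 - \<delta>..t0 + \<delta>}" for x t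
  proof -
    have "(x, 0, t) \<in> {x0 - \<delta>..x0 + \<delta>} \<times> {0 - \<delta>..0 + \<delta>} \<times> {t0 - \<delta>..t0 + \<delta>}" using that \<delta>(1) by auto
    from subsetD[OF \<delta>(2) this] show ?thesis by simp
  qed
  show ?thesis
  proof (rule that[of "min \<rho> \<delta>" \<rho>])
    show "{x0 - min \<rho> \<delta>..x0 + min \<rho> \<delta>} \<times> {\<gamma> x0 t0 - \<rho>..\<gamma> x0 t0 + \<rho>} \<times> {t0 - min \<rho> \<delta>..t0 + min \<rho> \<delta>} \<subseteq> U"
      by (rule order_trans[OF Sigma_mono \<rho>(2)]) auto
    show "{t0 - min \<rho> \<delta>..t0 + min \<rho> \<delta>} \<subseteq> J"
    proof
      fix t assume "t \<in> {t0 - min \<rho> \<delta>..t0 + min \<rho> \<delta>}"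
      then have "t \<in> {t0 - \<delta>..t0 + \<delta>}" by auto
      then show "t \<in> J" using *[of x0 t] \<delta>(1) by auto
    qed
    show "\<bar>\<gamma> x t - \<gamma> x0 t0\<bar> \<le> \<rho> / 2"
      if "x \<in> {x0 - min \<rho> \<delta>..x0 + min \<rho> \<delta>}" "t \<in> {t0 - min \<rho> \<delta>..t0 + min \<rho> \<delta>}" for x t
    proof -
      have "x \<in> {x0 - \<delta>..x0 + \<delta>}" "t \<in> {t0 - \<delta>..t0 + \<delta>}" using that by auto
      from *[OF this] show ?thesis unfolding abs_le_iff by linarith
    qed
  qed (use \<rho> \<delta> in auto)
qed

lemma test_function_derivs_outside:
  assumes "C1_xzt UNIV \<theta>" "compact K" "\<And>x z t. (x, z, t) \<notin> K \<Longrightarrow> \<theta> x z t = 0" "(x, z, t) \<notin> K"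
  shows "deriv (\<lambda>y. \<theta> y z t) x = 0" "deriv (\<lambda>v. \<theta> x v t) z = 0" "deriv (\<lambda>s. \<theta> x z s) t = 0"
proof -
  have "frechet_derivative (\<lambda>(x, z, t). \<theta> x z t) (at (x, z, t)) = (\<lambda>v. 0)"
    by (rule frechet_derivative_eq_zero_open[of "- K"])
      (use assms in \<open>auto simp: compact_imp_closed open_Compl\<close>)
  then show "deriv (\<lambda>y. \<theta> y z t) x = 0" "deriv (\<lambda>v. \<theta> x v t) z = 0" "deriv (\<lambda>s. \<theta> x z s) t = 0"
    using C1_on_partial_xzt[OF assms(1)[unfolded C1_xzt_def], of x z t]
    by (auto intro!: DERIV_imp_deriv)
qed

lemma compact_bounded_triple:
  fixes f :: "real \<Rightarrow> real \<Rightarrow> real \<Rightarrow> real"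
  assumes "continuous_on Q (\<lambda>(x, z, t). f x z t)" "compact Q"
  obtains M where "\<And>x z t. (x, z, t) \<in> Q \<Longrightarrow> \<bar>f x z t\<bar> \<le> M"
proof -
  have "bounded ((\<lambda>(x, z, t). f x z t) ` Q)"
    using assms compact_continuous_image compact_imp_bounded by blast
  then obtain M where "\<forall>y \<in> (\<lambda>(x, z, t). f x z t) ` Q. \<bar>y\<bar> \<le> M"
    unfolding bounded_real by blast
  then show ?thesis by (intro that[of M]) force
qed

text \<open>For a non-integrable function the default value 0 of \<open>integral\<close> gives the
  inequality.\<close>

lemma integral_abs_nonneg: "0 \<le> integral S (\<lambda>x. \<bar>f x :: real\<bar>)"
  by (cases "(\<lambda>x. \<bar>f x\<bar>) integrable_on S") (auto intro: integral_nonneg simp: not_integrable_integral)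

text \<open>Rankine-Hugoniot condition. In a bump of vertical width \<epsilon> around the graph, the
  terms with undifferentiated vertical profile contribute O(\<epsilon>), while the derivative of the
  profile has mass -1 above and 1 below and multiplies the flux through the graph, \<open>F1\<close>
  above and \<open>F2\<close> below. The integrand is compared with an explicit product in which the
  two fluxes are frozen at the base point, and the error is dominated by another explicit
  product.\<close>

lemma weak_balance_jump:
  fixes A B C S A1 B1 C1 A2 B2 C2 :: "real \<Rightarrow> real \<Rightarrow> real \<Rightarrow> real" and \<gamma> :: "real \<Rightarrow> real \<Rightarrow> real"
  defines "F1 \<equiv> \<lambda>x z t. C1 x z t - deriv (\<lambda>s. \<gamma> x s) t * A1 x z t - deriv (\<lambda>y. \<gamma> y t) x * B1 x z t"
    and "F2 \<equiv> \<lambda>x z t. C2 x z t - deriv (\<lambda>s. \<gamma> x s) t * A2 x z t - deriv (\<lambda>y. \<gamma> y t) x * B2 x z t"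
  assumes wb: "weak_balance \<Omega> A B C S" and U: "open U" "U \<subseteq> \<Omega>"
    and J: "open J" "t0 \<in> J" and \<gamma>: "C1_xt J \<gamma>" and X0: "(x0, \<gamma> x0 t0, t0) \<in> U"
    and c1: "continuous_on U (\<lambda>(x, z, t). A1 x z t)" "continuous_on U (\<lambda>(x, z, t). B1 x z t)"
      "continuous_on U (\<lambda>(x, z, t). C1 x z t)"
    and c2: "continuous_on U (\<lambda>(x, z, t). A2 x z t)" "continuous_on U (\<lambda>(x, z, t). B2 x z t)"
      "continuous_on U (\<lambda>(x, z, t). C2 x z t)"
    and cS: "continuous_on U (\<lambda>(x, z, t). S x z t)"
    and above: "\<And>x z t. (x, z, t) \<in> U \<Longrightarrow> \<gamma> x t < z \<Longrightarrow>
       A x z t = A1 x z t \<and> B x z t = B1 x z t \<and> C x z t = C1 x z t"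
    and below: "\<And>x z t. (x, z, t) \<in> U \<Longrightarrow> z < \<gamma> x t \<Longrightarrow>
       A x z t = A2 x z t \<and> B x z t = B2 x z t \<and> C x z t = C2 x z t"
  shows "F1 x0 (\<gamma> x0 t0) t0 = F2 x0 (\<gamma> x0 t0) t0"
proof -
  define z0 where "z0 = \<gamma> x0 t0"
  define a1 where "a1 = F1 x0 z0 t0"
  define a2 where "a2 = F2 x0 z0 t0"
  \<comment> \<open>The slopes of \<gamma> are known to be continuous only at times in J.\<close>
  define U' where "U' = U \<inter> (UNIV \<times> UNIV \<times> J)"
  have U': "open U'" unfolding U'_def using U J by (intro open_Int open_Times) auto
  have g1: "continuous_on U' (\<lambda>X. deriv (\<lambda>y. \<gamma> y (snd (snd X))) (fst X))"
    "continuous_on U' (\<lambda>X. deriv (\<lambda>s. \<gamma> (fst X) s) (snd (snd X)))"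
  proof -
    have c: "continuous_on U' (\<lambda>X. (fst X, snd (snd X)))" by (intro continuous_intros)
    have i: "(\<lambda>X. (fst X, snd (snd X))) ` U' \<subseteq> UNIV \<times> J" unfolding U'_def by auto
    show "continuous_on U' (\<lambda>X. deriv (\<lambda>y. \<gamma> y (snd (snd X))) (fst X))"
      "continuous_on U' (\<lambda>X. deriv (\<lambda>s. \<gamma> (fst X) s) (snd (snd X)))"
      using continuous_on_compose2[OF C1_xt_continuous_partials(1)[OF \<gamma>] c i]
        continuous_on_compose2[OF C1_xt_continuous_partials(2)[OF \<gamma>] c i]
      by simp_all
  qed
  have sub: "continuous_on U' f" if "continuous_on U f" for f :: "real \<times> real \<times> real \<Rightarrow> real"
    using that continuous_on_subset unfolding U'_def by blast
  have F1c: "continuous_on U' (\<lambda>(x, z, t). F1 x z t)" and F2c: "continuous_on U' (\<lambda>(x, z, t). F2 x z t)"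
    unfolding F1_def F2_def case_prod_unfold
    by (intro continuous_intros g1 sub c1[unfolded case_prod_unfold] c2[unfolded case_prod_unfold])+
  \<comment> \<open>\<kappa> bounds the variation of both fluxes near the base point; the factor 2
    counts the two sides of the graph, each of mass 1.\<close>
  have main: "\<bar>a1 - a2\<bar> \<le> 2 * \<kappa>" if \<kappa>: "\<kappa> > 0" for \<kappa>
  proof -
    define V where "V = (U' \<inter> (\<lambda>(x, z, t). F1 x z t) -` {a1 - \<kappa><..<a1 + \<kappa>}) \<inter>
      (U' \<inter> (\<lambda>(x, z, t). F2 x z t) -` {a2 - \<kappa><..<a2 + \<kappa>})"
    have V: "open V" unfolding V_def
      by (intro open_Int[of "_ \<inter> _" "_ \<inter> _"] continuous_open_preimage[OF F1c U'] continuous_open_preimage[OF F2c U'])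
        (rule open_greaterThanLessThan)+
    have X0V: "(x0, \<gamma> x0 t0, t0) \<in> V"
      using X0 J \<kappa> unfolding V_def U'_def by (simp add: a1_def a2_def z0_def)
    obtain \<delta> \<rho> where \<delta>: "\<delta> > 0" "\<rho> > 0"
      "{x0 - \<delta>..x0 + \<delta>} \<times> {\<gamma> x0 t0 - \<rho>..\<gamma> x0 t0 + \<rho>} \<times> {t0 - \<delta>..t0 + \<delta>} \<subseteq> V"
      "{t0 - \<delta>..t0 + \<delta>} \<subseteq> J"
      "\<And>x t. x \<in> {x0 - \<delta>..x0 + \<delta>} \<Longrightarrow> t \<in> {t0 - \<delta>..t0 + \<delta>} \<Longrightarrow> \<bar>\<gamma> x t - \<gamma> x0 t0\<bar> \<le> \<rho> / 2"
      by (rule box_neighbourhood_graph[where \<gamma> = \<gamma>,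
            OF V X0V J C1_on_imp_continuous_on[OF \<gamma>[unfolded C1_xt_def]]]) blast
    define Q where "Q = {x0 - \<delta>..x0 + \<delta>} \<times> {z0 - \<rho>..z0 + \<rho>} \<times> {t0 - \<delta>..t0 + \<delta>}"
    have Q: "compact Q" "Q \<subseteq> V" "Q \<subseteq> U'" "Q \<subseteq> U"
      using \<delta>(3) unfolding Q_def z0_def V_def U'_def by (auto intro!: compact_Times)
    obtain M1 M2 M3 M4 M5 where M: "\<And>x z t. (x, z, t) \<in> Q \<Longrightarrow> \<bar>A1 x z t\<bar> \<le> M1"
      "\<And>x z t. (x, z, t) \<in> Q \<Longrightarrow> \<bar>A2 x z t\<bar> \<le> M2" "\<And>x z t. (x, z, t) \<in> Q \<Longrightarrow> \<bar>B1 x z t\<bar> \<le> M3"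
      "\<And>x z t. (x, z, t) \<in> Q \<Longrightarrow> \<bar>B2 x z t\<bar> \<le> M4" "\<And>x z t. (x, z, t) \<in> Q \<Longrightarrow> \<bar>S x z t\<bar> \<le> M5"
      using compact_bounded_triple[OF continuous_on_subset[OF c1(1) Q(4)] Q(1)]
        compact_bounded_triple[OF continuous_on_subset[OF c2(1) Q(4)] Q(1)]
        compact_bounded_triple[OF continuous_on_subset[OF c1(2) Q(4)] Q(1)]
        compact_bounded_triple[OF continuous_on_subset[OF c2(2) Q(4)] Q(1)]
        compact_bounded_triple[OF continuous_on_subset[OF cS Q(4)] Q(1)] by metis
    define M where "M = \<bar>M1\<bar> + \<bar>M2\<bar> + \<bar>M3\<bar> + \<bar>M4\<bar> + \<bar>M5\<bar>"
    have MM: "\<bar>A1 x z t\<bar> \<le> M" "\<bar>A2 x z t\<bar> \<le> M" "\<bar>B1 x z t\<bar> \<le> M" "\<bar>B2 x z t\<bar> \<le> M" "\<bar>S x z t\<bar> \<le> M"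
      if "(x, z, t) \<in> Q" for x z t
      using M[OF that] unfolding M_def by linarith+
    have M0: "M \<ge> 0" unfolding M_def by simp
    \<comment> \<open>Clamping the coordinates to the box replaces \<gamma>, controlled only over J,
      by a function that is continuous on the whole plane, agrees with \<gamma> over the box and has
      the same bound on its oscillation. The product formula for integrals along a graph can then be
      used.\<close>
    define cl where "cl a s = max (a - \<delta>) (min (a + \<delta>) s)" for a s
    have cl: "cl a s \<in> {a - \<delta>..a + \<delta>}" "s \<in> {a - \<delta>..a + \<delta>} \<Longrightarrow> cl a s = s" for a s
      using \<delta>(1) by (auto simp: cl_def)
    define \<gamma>' where "\<gamma>' x t = \<gamma> (cl x0 x) (cl t0 t)" for x t
    have \<gamma>'c: "continuous_on UNIV (\<lambda>(x, t). \<gamma>' x t)"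
    proof -
      have "continuous_on UNIV (\<lambda>X. (cl x0 (fst X), cl t0 (snd X)))"
        unfolding cl_def by (intro continuous_intros)
      moreover have "range (\<lambda>X. (cl x0 (fst X), cl t0 (snd X))) \<subseteq> UNIV \<times> J"
        using cl(1) \<delta>(4) by blast
      ultimately show ?thesis
        using continuous_on_compose2[OF C1_on_imp_continuous_on[OF \<gamma>[unfolded C1_xt_def]]]
        unfolding \<gamma>'_def case_prod_unfold by fastforce
    qed
    have \<gamma>'b: "\<bar>\<gamma>' x t - z0\<bar> \<le> \<rho> / 2" for x t
      unfolding \<gamma>'_def z0_def by (intro \<delta>(5) cl)
    have \<gamma>'e: "\<gamma>' x t = \<gamma> x t" if "x \<in> {x0 - \<delta>..x0 + \<delta>}" "t \<in> {t0 - \<delta>..t0 + \<delta>}" for x t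
      unfolding \<gamma>'_def using that cl(2) by simp
    define b where "b = sbump \<delta> x0"
    define b' where "b' = sbump' \<delta> x0"
    define d where "d = sbump \<delta> t0"
    define d' where "d' = sbump' \<delta> t0"
    note bd_defs = b_def b'_def d_def d'_def
    define \<beta> where "\<beta> = integral UNIV b * integral UNIV d"
    define K where "K = M * (integral UNIV b * integral UNIV (\<lambda>t. \<bar>d' t\<bar>)
        + integral UNIV (\<lambda>x. \<bar>b' x\<bar>) * integral UNIV d + integral UNIV b * integral UNIV d)"
    have \<beta>0: "\<beta> > 0" unfolding \<beta>_def bd_defs by (intro mult_pos_pos sbump_integral \<delta>)
    \<comment> \<open>Everything except the integral of the vertical profile is independent of
      \<epsilon>, and that integral is at most 2 \<epsilon>; so the K term disappears in the
      limit.\<close>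
    have est: "\<bar>a1 - a2\<bar> * \<beta> \<le> 2 * \<kappa> * \<beta> + integral UNIV (sbump \<epsilon> 0) * K" if \<epsilon>: "0 < \<epsilon>" "\<epsilon> \<le> \<rho> / 2" for \<epsilon>
    proof -
      define c where "c = sbump \<epsilon> 0"
      define c' where "c' = sbump' \<epsilon> 0"
      \<comment> \<open>Upper and lower half of c', continuous because c' vanishes at 0.\<close>
      define k1 where "k1 s = c' (max s 0)" for s
      define k2 where "k2 s = c' (min s 0)" for s
      have c'0: "c' 0 = 0" unfolding c'_def sbump'_def bump'_def by simp
      define \<theta> where "\<theta> = graph_bump \<gamma> x0 t0 \<delta> \<epsilon>"
      have zQ: "\<epsilon> < \<bar>z - \<gamma>' x t\<bar>" if "z \<notin> {z0 - \<rho>..z0 + \<rho>}" for x z t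
        using \<gamma>'b[of x t] \<epsilon> that by (auto simp: abs_if split: if_splits)
      have \<theta>0: "\<theta> x z t = 0" if "(x, z, t) \<notin> Q" for x z t
      proof (cases "x \<in> {x0 - \<delta>..x0 + \<delta>} \<and> t \<in> {t0 - \<delta>..t0 + \<delta>}")
        case True
        then have "z \<notin> {z0 - \<rho>..z0 + \<rho>}" using that unfolding Q_def by auto
        from zQ[OF this, of x t] show ?thesis
          unfolding \<theta>_def using True \<gamma>'e \<delta>(1) \<epsilon>(1) by (intro graph_bump_outside) auto
      next
        case False
        then show ?thesis unfolding \<theta>_def using \<delta>(1) \<epsilon>(1)
          by (intro graph_bump_outside) (auto simp: abs_if split: if_splits)
      qed
      have C\<theta>: "C1_xzt UNIV \<theta>" unfolding \<theta>_def by (rule C1_xzt_graph_bump[OF \<gamma> J(1) \<delta>(4,1) \<epsilon>(1)])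
      have test: "test_function \<Omega> \<theta>" unfolding test_function_def
        using C\<theta> Q U \<theta>0 by blast
      define f where "f = (\<lambda>(x, z, t). A x z t * deriv (\<lambda>s. \<theta> x z s) t + B x z t * deriv (\<lambda>y. \<theta> y z t) x
          + C x z t * deriv (\<lambda>v. \<theta> x v t) z + S x z t * \<theta> x z t)"
      have fQ: "f X = 0" if "X \<notin> Q" for X
        using test_function_derivs_outside[OF C\<theta> Q(1) \<theta>0] \<theta>0 that unfolding f_def by (cases X) simp
      have "(f has_integral 0) \<Omega>"
        using wb[unfolded weak_balance_def, rule_format, OF test] unfolding f_def .
      then have fi: "(f has_integral 0) UNIV"
        by (rule has_integral_on_superset) (use fQ Q U in blast)+
      \<comment> \<open>The singular part of f with both fluxes frozen at the base point: a1 weighs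
        the upper half of the derivative profile, a2 the lower half. Its integral is (a2 - a1)
        \<beta>.\<close>
      define f0 where "f0 = (\<lambda>X. a1 * (\<lambda>(x, z, t). b x * k1 (z - \<gamma>' x t) * d t) X
          + a2 * (\<lambda>(x, z, t). b x * k2 (z - \<gamma>' x t) * d t) X)"
      \<comment> \<open>Since k1 is nonpositive and k2 nonnegative, k2 - k1 is the absolute value of
        c'. Its coefficient \<kappa> pays for freezing the fluxes; M pays for the terms in which c
        is not differentiated.\<close>
      define e where "e = (\<lambda>X. \<kappa> * ((\<lambda>(x, z, t). b x * k2 (z - \<gamma>' x t) * d t) X
            - (\<lambda>(x, z, t). b x * k1 (z - \<gamma>' x t) * d t) X)
          + M * ((\<lambda>(x, z, t). b x * c (z - \<gamma>' x t) * \<bar>d' t\<bar>) X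
            + (\<lambda>(x, z, t). \<bar>b' x\<bar> * c (z - \<gamma>' x t) * d t) X
            + (\<lambda>(x, z, t). b x * c (z - \<gamma>' x t) * d t) X))"
      define N where "N = {(x, z, t). t \<in> J \<and> z = \<gamma> x t}"
      \<comment> \<open>On the graph the fields A, B, C are arbitrary. The graph is a null set, so f
        may be replaced there by f0 without changing its integral.\<close>
      define fs where "fs X = (if X \<in> N then f0 X else f X)" for X
      have fsi: "(fs has_integral 0) UNIV"
        by (rule has_integral_spike[OF negligible_graph[OF \<gamma>] _ fi]) (auto simp: fs_def N_def)
      \<comment> \<open>A common radius outside of which all one-dimensional factors vanish,
        whatever their centres.\<close>
      define R where "R = \<bar>x0\<bar> + \<bar>t0\<bar> + \<delta> + \<epsilon>"
      have R: "b s = 0" "b' s = 0" "d s = 0" "d' s = 0" "c s = 0" "k1 s = 0" "k2 s = 0" if "R < \<bar>s\<bar>" for s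
        using that \<delta>(1) \<epsilon>(1) c'0 unfolding bd_defs c_def k1_def k2_def R_def max_def min_def
        by (auto intro!: sbump_outside simp: c'_def)
      have cont: "continuous_on UNIV b" "continuous_on UNIV d" "continuous_on UNIV c"
        "continuous_on UNIV (\<lambda>x. \<bar>b' x\<bar>)" "continuous_on UNIV (\<lambda>x. \<bar>d' x\<bar>)"
        "continuous_on UNIV k1" "continuous_on UNIV k2"
        unfolding bd_defs c_def k1_def[abs_def] k2_def[abs_def] c'_def using \<delta>(1) \<epsilon>(1)
        by (auto intro!: continuous_on_sbump continuous_on_sbump' continuous_on_rabs
            continuous_on_compose2[OF continuous_on_sbump'[of \<epsilon> UNIV]] continuous_intros)
      have k1: "integral UNIV k1 = - 1" and k2: "integral UNIV k2 = 1"
        unfolding k1_def[abs_def] k2_def[abs_def] c'_def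
        by (rule sbump'_one_sided_integral[OF \<epsilon>(1)])+
      note P = has_integral_graph_product[OF _ _ _ \<gamma>'c, of _ _ _ R]
      have P1: "((\<lambda>(x, z, t). b x * k1 (z - \<gamma>' x t) * d t) has_integral - \<beta>) UNIV"
        using P[of b k1 d] cont R k1 unfolding \<beta>_def by simp
      have P2: "((\<lambda>(x, z, t). b x * k2 (z - \<gamma>' x t) * d t) has_integral \<beta>) UNIV"
        using P[of b k2 d] cont R k2 unfolding \<beta>_def by simp
      have P3: "((\<lambda>(x, z, t). b x * c (z - \<gamma>' x t) * \<bar>d' t\<bar>) has_integral
          integral UNIV b * integral UNIV c * integral UNIV (\<lambda>t. \<bar>d' t\<bar>)) UNIV"
        using P[of b c "\<lambda>t. \<bar>d' t\<bar>"] cont R by simp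
      have P4: "((\<lambda>(x, z, t). \<bar>b' x\<bar> * c (z - \<gamma>' x t) * d t) has_integral
          integral UNIV (\<lambda>x. \<bar>b' x\<bar>) * integral UNIV c * integral UNIV d) UNIV"
        using P[of "\<lambda>x. \<bar>b' x\<bar>" c d] cont R by simp
      have P5: "((\<lambda>(x, z, t). b x * c (z - \<gamma>' x t) * d t) has_integral
          integral UNIV b * integral UNIV c * integral UNIV d) UNIV"
        using P[of b c d] cont R by simp
      have f0i: "(f0 has_integral a1 * - \<beta> + a2 * \<beta>) UNIV"
        unfolding f0_def by (intro has_integral_add has_integral_mult_right P1 P2)
      have ei: "(e has_integral \<kappa> * (\<beta> - - \<beta>) + M * (integral UNIV b * integral UNIV c * integral UNIV (\<lambda>t. \<bar>d' t\<bar>)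
           + integral UNIV (\<lambda>x. \<bar>b' x\<bar>) * integral UNIV c * integral UNIV d
           + integral UNIV b * integral UNIV c * integral UNIV d)) UNIV"
        unfolding e_def by (intro has_integral_add has_integral_diff has_integral_mult_right P1 P2 P3 P4 P5)
      have pos: "0 \<le> b s" "0 \<le> d s" "0 \<le> c s" "k1 s \<le> 0" "0 \<le> k2 s" for s
        unfolding bd_defs c_def k1_def k2_def c'_def using sbump_bounds sbump'_sign[OF \<epsilon>(1)] by auto
      have bound: "norm (fs X - f0 X) \<le> e X" for X
      proof -
        obtain x z t where X: "X = (x, z, t)" by (cases X)
        have e0: "0 \<le> e X" unfolding X e_def using pos M0 \<kappa>
          by (auto intro!: add_nonneg_nonneg mult_nonneg_nonneg simp: mult_nonneg_nonneg mult_nonneg_nonpos mult_nonpos_nonneg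
              order_trans[of _ 0])
        show ?thesis
        proof (cases "X \<in> Q")
          case False
          have "f0 X = 0"
          proof (cases "x \<in> {x0 - \<delta>..x0 + \<delta>} \<and> t \<in> {t0 - \<delta>..t0 + \<delta>}")
            case True
            then have "z \<notin> {z0 - \<rho>..z0 + \<rho>}" using False unfolding Q_def X by auto
            from zQ[OF this, of x t] have "k1 (z - \<gamma>' x t) = 0 \<and> k2 (z - \<gamma>' x t) = 0"
              using \<epsilon>(1) c'0 unfolding k1_def k2_def max_def min_def
              by (auto intro!: sbump_outside simp: c'_def)
            then show ?thesis unfolding f0_def X by simp
          next
            case False
            then have "b x = 0 \<or> d t = 0" using \<delta>(1) unfolding bd_defs by (auto intro!: sbump_outside simp: abs_if split: if_splits)
            then show ?thesis unfolding f0_def X by auto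
          qed
          then show ?thesis using e0 fQ[OF False] unfolding fs_def by simp
        next
          case True
          show ?thesis
          proof (cases "X \<in> N")
            case False
            define s where "s = z - \<gamma> x t"
            have t: "x \<in> {x0 - \<delta>..x0 + \<delta>}" "t \<in> {t0 - \<delta>..t0 + \<delta>}" "t \<in> J" and XU: "(x, z, t) \<in> U" and XV: "(x, z, t) \<in> V"
              using True \<delta>(4) Q unfolding X Q_def by auto
            have s: "z - \<gamma>' x t = s" unfolding s_def \<gamma>'e[OF t(1,2)] ..
            have s0: "s \<noteq> 0" using False t unfolding X N_def s_def by auto
            \<comment> \<open>All terms in which the vertical profile is not differentiated.\<close>
            define T where "T p q r = c s * (p * b x * d' t + q * b' x * d t + r * b x * d t)" for p q r
            have Tb: "\<bar>T p q r\<bar> \<le> M * (b x * c s * \<bar>d' t\<bar> + \<bar>b' x\<bar> * c s * d t + b x * c s * d t)"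
              if "\<bar>p\<bar> \<le> M" "\<bar>q\<bar> \<le> M" "\<bar>r\<bar> \<le> M" for p q r
            proof -
              have "\<bar>p * (c s * b x * d' t)\<bar> \<le> M * (c s * b x * \<bar>d' t\<bar>)"
                unfolding abs_mult using that pos[of x] pos[of s] by (intro mult_mono) auto
              moreover have "\<bar>q * (c s * b' x * d t)\<bar> \<le> M * (c s * \<bar>b' x\<bar> * d t)"
                unfolding abs_mult using that pos[of t] pos[of s] by (intro mult_mono) auto
              moreover have "\<bar>r * (c s * b x * d t)\<bar> \<le> M * (c s * b x * d t)"
                unfolding abs_mult using that pos[of x] pos[of t] pos[of s] by (intro mult_mono) auto
              ultimately show ?thesis unfolding T_def by (simp add: algebra_simps)
            qed
            have "f X = A x z t * (b x * c s * d' t - deriv (\<lambda>s. \<gamma> x s) t * b x * c' s * d t)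
                + B x z t * (b' x * c s * d t - deriv (\<lambda>y. \<gamma> y t) x * b x * c' s * d t)
                + C x z t * (b x * c' s * d t) + S x z t * (b x * c s * d t)"
              unfolding f_def X \<theta>_def s_def bd_defs c_def c'_def
                prod.case graph_bump_derivs[OF \<gamma> t(3) \<delta>(1) \<epsilon>(1)]
              unfolding graph_bump_sbump by (simp add: algebra_simps)
            \<comment> \<open>Collecting the terms with c' produces as their common coefficient the
              flux through the moving graph, which is \<open>F1\<close> or \<open>F2\<close>
              according to the side.\<close>
            also have "\<dots> = T (A x z t) (B x z t) (S x z t)
               + b x * c' s * d t * (C x z t - deriv (\<lambda>s. \<gamma> x s) t * A x z t - deriv (\<lambda>y. \<gamma> y t) x * B x z t)"
              unfolding T_def by (simp add: algebra_simps)
            finally have fX: "f X = \<dots>" .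
            consider "s > 0" | "s < 0" using s0 by linarith
            then show ?thesis
            proof cases
              case 1
              have k: "k1 s = c' s" "k2 s = 0" using 1 c'0 by (auto simp: k1_def k2_def)
              have ABC: "A x z t = A1 x z t" "B x z t = B1 x z t" "C x z t = C1 x z t"
                using above[OF XU] 1 unfolding s_def by auto
              have "fs X - f0 X = T (A1 x z t) (B1 x z t) (S x z t) + b x * c' s * d t * (F1 x z t - a1)"
              proof -
                have "fs X = T (A1 x z t) (B1 x z t) (S x z t) + b x * c' s * d t * F1 x z t"
                  using False unfolding fs_def fX ABC F1_def by simp
                moreover have "f0 X = b x * c' s * d t * a1"
                  unfolding f0_def X prod.case s k by simp
                ultimately show ?thesis by (simp only: right_diff_distrib)
              qed
              also have "\<bar>\<dots>\<bar> \<le> M * (b x * c s * \<bar>d' t\<bar> + \<bar>b' x\<bar> * c s * d t + b x * c s * d t)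
                  + \<kappa> * (b x * - c' s * d t)"
              proof -
                have Fb: "\<bar>F1 x z t - a1\<bar> \<le> \<kappa>" using XV unfolding V_def by auto
                have "\<bar>b x * c' s * d t * (F1 x z t - a1)\<bar> \<le> (b x * - c' s * d t) * \<kappa>"
                proof -
                  have "\<bar>b x * c' s * d t\<bar> = b x * - c' s * d t"
                    using pos(1)[of x] pos(2)[of t] pos(4,5)[of s] k by (simp add: abs_mult)
                  moreover note Fb
                  ultimately show ?thesis
                    unfolding abs_mult[of _ "F1 x z t - a1"] by (metis abs_ge_zero mult_left_mono)
                qed
                moreover have XQ: "(x, z, t) \<in> Q" using True X by simp
                note Tb[OF MM(1)[OF XQ] MM(3)[OF XQ] MM(5)[OF XQ]]
                  abs_triangle_ineq[of "T (A1 x z t) (B1 x z t) (S x z t)" "b x * c' s * d t * (F1 x z t - a1)"]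
                ultimately show ?thesis unfolding mult.commute[of \<kappa>] by linarith
              qed
              also have "\<dots> = e X" unfolding e_def X using s k by (simp add: algebra_simps)
              finally show ?thesis by simp
            next
              case 2
              have k: "k2 s = c' s" "k1 s = 0" using 2 c'0 by (auto simp: k1_def k2_def)
              have ABC: "A x z t = A2 x z t" "B x z t = B2 x z t" "C x z t = C2 x z t"
                using below[OF XU] 2 unfolding s_def by auto
              have "fs X - f0 X = T (A2 x z t) (B2 x z t) (S x z t) + b x * c' s * d t * (F2 x z t - a2)"
              proof -
                have "fs X = T (A2 x z t) (B2 x z t) (S x z t) + b x * c' s * d t * F2 x z t"
                  using False unfolding fs_def fX ABC F2_def by simp
                moreover have "f0 X = b x * c' s * d t * a2"
                  unfolding f0_def X prod.case s k by simp
                ultimately show ?thesis by (simp only: right_diff_distrib)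
              qed
              also have "\<bar>\<dots>\<bar> \<le> M * (b x * c s * \<bar>d' t\<bar> + \<bar>b' x\<bar> * c s * d t + b x * c s * d t)
                  + \<kappa> * (b x * c' s * d t)"
              proof -
                have Fb: "\<bar>F2 x z t - a2\<bar> \<le> \<kappa>" using XV unfolding V_def by auto
                have "\<bar>b x * c' s * d t * (F2 x z t - a2)\<bar> \<le> (b x * c' s * d t) * \<kappa>"
                proof -
                  have "\<bar>b x * c' s * d t\<bar> = b x * c' s * d t"
                    using pos(1)[of x] pos(2)[of t] pos(4,5)[of s] k by (simp add: abs_mult)
                  moreover note Fb
                  ultimately show ?thesis
                    unfolding abs_mult[of _ "F2 x z t - a2"] by (metis abs_ge_zero mult_left_mono)
                qed
                moreover have XQ: "(x, z, t) \<in> Q" using True X by simp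
                note Tb[OF MM(2)[OF XQ] MM(4)[OF XQ] MM(5)[OF XQ]]
                  abs_triangle_ineq[of "T (A2 x z t) (B2 x z t) (S x z t)" "b x * c' s * d t * (F2 x z t - a2)"]
                ultimately show ?thesis unfolding mult.commute[of \<kappa>] by linarith
              qed
              also have "\<dots> = e X" unfolding e_def X using s k by (simp add: algebra_simps)
              finally show ?thesis by simp
            qed
          qed (use e0 in \<open>simp add: fs_def\<close>)
        qed
      qed
      \<comment> \<open>The weak equation says that fs has integral 0, so the integral of the
        difference is (a1 - a2) \<beta>, and it is bounded by the integral of e.\<close>
      have "norm (integral UNIV (\<lambda>X. fs X - f0 X)) \<le> integral UNIV e"
        by (rule integral_norm_bound_integral)
          (use fsi f0i ei bound in \<open>auto intro!: integrable_diff simp: has_integral_integrable\<close>)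
      moreover have "integral UNIV (\<lambda>X. fs X - f0 X) = 0 - (a1 * - \<beta> + a2 * \<beta>)"
        by (rule integral_unique[OF has_integral_diff[OF fsi f0i]])
      moreover have "\<bar>(a1 - a2) * \<beta>\<bar> = \<bar>a1 - a2\<bar> * \<beta>" using \<beta>0 by (simp add: abs_mult)
      ultimately show ?thesis
        unfolding integral_unique[OF ei] K_def c_def[symmetric] by (simp add: algebra_simps)
    qed
    have K0: "K \<ge> 0"
      unfolding K_def bd_defs using M0
      by (intro mult_nonneg_nonneg add_nonneg_nonneg less_imp_le[OF sbump_integral(1)] \<delta>(1)
          integral_abs_nonneg) auto
    have "\<bar>a1 - a2\<bar> * \<beta> \<le> 2 * \<kappa> * \<beta>"
    proof (rule field_le_epsilon)
      fix e :: real assume e: "e > 0"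
      \<comment> \<open>Chosen so that 2 \<epsilon> (K + 1) is at most e; K + 1 instead of K avoids
        a division by 0.\<close>
      define \<epsilon> where "\<epsilon> = min (\<rho> / 2) (e / (2 * (K + 1)))"
      have \<epsilon>: "0 < \<epsilon>" "\<epsilon> \<le> \<rho> / 2"
        unfolding \<epsilon>_def using \<delta>(2) e K0 by (simp, intro min.cobounded1)
      have "integral UNIV (sbump \<epsilon> 0) * K \<le> 2 * \<epsilon> * (K + 1)"
        using sbump_integral[OF \<epsilon>(1), of 0] K0 \<epsilon>(1) by (intro mult_mono) auto
      also have "\<dots> \<le> 2 * (e / (2 * (K + 1))) * (K + 1)"
        using K0 by (intro mult_right_mono mult_left_mono) (auto simp: \<epsilon>_def)
      also have "\<dots> = e" using K0 by (simp add: field_simps)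
      finally show "\<bar>a1 - a2\<bar> * \<beta> \<le> 2 * \<kappa> * \<beta> + e" using est[OF \<epsilon>] by linarith
    qed
    then show ?thesis using \<beta>0 by simp
  qed
  have "\<bar>a1 - a2\<bar> \<le> 0"
  proof (rule field_le_epsilon)
    fix e :: real assume "e > 0"
    then show "\<bar>a1 - a2\<bar> \<le> 0 + e" using main[of "e / 2"] by simp
  qed
  then show ?thesis unfolding a1_def a2_def z0_def by simp
qed

section \<open>Energy equality of the layer-averaged system\<close>

text \<open>Abel summation. It is applied with c a multiple of the exchange term, which vanishes at
  0 and at N, so that the boundary terms drop out, including the value of a at the fictitious index
  N + 1.\<close>

lemma sum_by_parts_1:
  fixes a c :: "nat \<Rightarrow> 'a::comm_ring"
  shows "(\<Sum>\<alpha>=1..N. a \<alpha> * (c \<alpha> - c (\<alpha> - 1)))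
    = a (N + 1) * c N - a 1 * c 0 - (\<Sum>\<alpha>=1..N. c \<alpha> * (a (\<alpha> + 1) - a \<alpha>))"
  by (induction N) (simp_all add: algebra_simps)

lemma sum_telescope_1:
  fixes c :: "nat \<Rightarrow> 'a::ab_group_add"
  shows "(\<Sum>\<alpha>=1..N. c \<alpha> - c (\<alpha> - 1)) = c N - c 0"
  by (induction N) (simp_all add: algebra_simps)

section \<open>Geometry, pressure and energy of the layers\<close>

locale layered_flow =
  fixes g :: real and N :: nat and l :: "nat \<Rightarrow> real" and zb :: "real \<Rightarrow> real" and J :: "real set"
    and H :: "real \<Rightarrow> real \<Rightarrow> real"
  assumes N: "N \<ge> 1" and l_pos: "\<And>j. j \<in> {1..N} \<Longrightarrow> l j > 0" and l_sum: "(\<Sum>j=1..N. l j) = 1"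
    and zb: "C1_on zb UNIV" and J: "open J" and H: "C1_xt J H" and H_pos: "\<And>x t. t \<in> J \<Longrightarrow> H x t > 0"
begin

abbreviation "h \<equiv> thickness l H"
abbreviation "Z \<equiv> interface zb l H"

lemma Z_0 [simp]: "Z 0 x t = zb x" by (simp add: interface_def)

lemma Z_eq: "Z \<alpha> x t = zb x + (\<Sum>j=1..\<alpha>. l j) * H x t"
  by (simp add: interface_def sum_distrib_right)

lemma Z_N: "Z N x t = zb x + H x t" unfolding Z_eq l_sum by simp

lemma Z_diff: "\<alpha> \<in> {1..N} \<Longrightarrow> h \<alpha> x t = Z \<alpha> x t - Z (\<alpha> - 1) x t"
  using interface_diff[of \<alpha> zb l H x t] by simp

lemma h_pos: "\<alpha> \<in> {1..N} \<Longrightarrow> t \<in> J \<Longrightarrow> h \<alpha> x t > 0"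
  by (simp add: thickness_def l_pos H_pos)

lemma Z_less: "\<alpha> \<in> {1..N} \<Longrightarrow> t \<in> J \<Longrightarrow> Z (\<alpha> - 1) x t < Z \<alpha> x t"
  using h_pos[of \<alpha> t x] Z_diff[of \<alpha> x t] by simp

lemma C1_xt_zb: "C1_xt J (\<lambda>x t. zb x)"
  unfolding C1_xt_def case_prod_unfold by (rule C1_on_compose[OF C1_on_fst_snd(1) zb]) simp

lemma C1_xt_Z: "C1_xt J (Z \<alpha>)"
proof -
  have "C1_on (\<lambda>X. (\<lambda>(x, t). zb x) X + (\<Sum>j=1..\<alpha>. l j) * (\<lambda>(x, t). H x t) X) (UNIV \<times> J)"
    by (intro C1_on_add C1_on_mult C1_on_const H[unfolded C1_xt_def] C1_xt_zb[unfolded C1_xt_def])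
  then show ?thesis unfolding C1_xt_def by (simp add: Z_eq case_prod_unfold)
qed

lemma C1_xt_h: "C1_xt J (h \<alpha>)"
proof -
  have "C1_on (\<lambda>X. l \<alpha> * (\<lambda>(x, t). H x t) X) (UNIV \<times> J)"
    by (intro C1_on_mult C1_on_const H[unfolded C1_xt_def])
  then show ?thesis unfolding C1_xt_def by (simp add: thickness_def case_prod_unfold)
qed

lemmas Z_derivs = C1_xt_partials[OF C1_xt_Z]
lemmas h_derivs = C1_xt_partials[OF C1_xt_h]

lemma h_deriv_diff:
  assumes "\<alpha> \<in> {1..N}" "t \<in> J"
  shows "deriv (\<lambda>y. h \<alpha> y t) x = deriv (\<lambda>y. Z \<alpha> y t) x - deriv (\<lambda>y. Z (\<alpha> - 1) y t) x"
    "deriv (\<lambda>s. h \<alpha> x s) t = deriv (\<lambda>s. Z \<alpha> x s) t - deriv (\<lambda>s. Z (\<alpha> - 1) x s) t"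
  unfolding Z_diff[OF assms(1)]
  by (rule DERIV_imp_deriv DERIV_diff Z_derivs assms)+

lemma Z_0_deriv_t: "deriv (\<lambda>s. Z 0 x s) t = 0" by simp

text \<open>The interface pressure is the weight of the water above; the thicknesses of the layers
  above add up to the distance from the free surface \<open>Z N\<close>.\<close>

lemma interface_pressure_eq:
  assumes "\<alpha> \<le> N"
  shows "interface_pressure g N l H \<alpha> x t = g * (Z N x t - Z \<alpha> x t)"
proof -
  have "(\<Sum>j=1..N. l j) = (\<Sum>j=1..\<alpha>. l j) + (\<Sum>j=\<alpha>+1..N. l j)"
    using sum.ub_add_nat[of 1 \<alpha> l "N - \<alpha>"] assms by simp
  then show ?thesis
    by (simp add: interface_pressure_def thickness_def Z_eq sum_distrib_left[symmetric]
        sum_distrib_right[symmetric] algebra_simps)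
qed

text \<open>The hydrostatic pressure is linear in z, so thickness times the mean of the two
  interface values is its exact integral over the layer, a difference of squares.\<close>

lemma layer_pressure_eq:
  assumes "\<alpha> \<in> {1..N}"
  shows "layer_pressure g N l H \<alpha> x t
    = g / 2 * ((Z N x t - Z (\<alpha> - 1) x t)\<^sup>2 - (Z N x t - Z \<alpha> x t)\<^sup>2)"
proof -
  have "\<alpha> \<le> N" "\<alpha> - 1 \<le> N" using assms by auto
  then show ?thesis
    by (simp add: layer_pressure_def interface_pressure_eq Z_diff[OF assms] power2_eq_square field_simps)
qed

lemma layer_pressure_deriv:
  assumes "\<alpha> \<in> {1..N}" "t \<in> J"
  shows "((\<lambda>y. layer_pressure g N l H \<alpha> y t) has_real_derivative
     g * ((Z N x t - Z (\<alpha> - 1) x t) * (deriv (\<lambda>y. Z N y t) x - deriv (\<lambda>y. Z (\<alpha> - 1) y t) x)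
        - (Z N x t - Z \<alpha> x t) * (deriv (\<lambda>y. Z N y t) x - deriv (\<lambda>y. Z \<alpha> y t) x))) (at x)"
  unfolding layer_pressure_eq[OF assms(1)]
  by (rule derivative_eq_intros Z_derivs assms refl | simp add: algebra_simps)+

lemma thickness_midpoint:
  assumes "\<alpha> \<in> {1..N}"
  shows "h \<alpha> x t * midpoint_z zb l H \<alpha> x t = ((Z \<alpha> x t)\<^sup>2 - (Z (\<alpha> - 1) x t)\<^sup>2) / 2"
  by (simp add: Z_diff[OF assms] midpoint_z_def power2_eq_square field_simps)

lemma exchange_eq:
  assumes q: "\<And>\<alpha>. \<alpha> \<in> {1..N} \<Longrightarrow> C1_xt J (q \<alpha>)" and "t \<in> J" "\<alpha> \<le> N"
  shows "exchange l H q \<alpha> x t = (\<Sum>j=1..\<alpha>. deriv (\<lambda>s. h j x s) t + deriv (\<lambda>y. q j y t) x)"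
proof -
  have "((\<lambda>s. \<Sum>j=1..\<alpha>. h j x s) has_real_derivative (\<Sum>j=1..\<alpha>. deriv (\<lambda>s. h j x s) t)) (at t)"
    by (rule DERIV_sum) (rule h_derivs[OF assms(2)])
  moreover have "((\<lambda>y. \<Sum>j=1..\<alpha>. q j y t) has_real_derivative (\<Sum>j=1..\<alpha>. deriv (\<lambda>y. q j y t) x)) (at x)"
    by (rule DERIV_sum, rule C1_xt_partials(1)[OF q assms(2)]) (use assms(3) in auto)
  ultimately show ?thesis
    unfolding exchange_def by (simp add: DERIV_imp_deriv sum.distrib)
qed

text \<open>The potential part is written as a difference of squares of interface heights because
  its sum over the layers then telescopes.\<close>

lemma layer_energy_eq:
  assumes "\<alpha> \<in> {1..N}" "t \<in> J"
  shows "layer_energy g l zb H q \<alpha> x t = (q \<alpha> x t)\<^sup>2 / (2 * h \<alpha> x t)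
     + g / 2 * ((Z \<alpha> x t)\<^sup>2 - (Z (\<alpha> - 1) x t)\<^sup>2)"
proof -
  let ?v = "layer_velocity l H q \<alpha> x t"
  have le: "Z (\<alpha> - 1) x t \<le> Z \<alpha> x t" using Z_less[OF assms, of x] by simp
  have "((\<lambda>z. ?v\<^sup>2 / 2 + g * z) has_integral
      (Z \<alpha> x t - Z (\<alpha> - 1) x t) *\<^sub>R (?v\<^sup>2 / 2) + g * (((Z \<alpha> x t)\<^sup>2 - (Z (\<alpha> - 1) x t)\<^sup>2) / 2))
      {Z (\<alpha> - 1) x t..Z \<alpha> x t}"
    using has_integral_const_real[of "?v\<^sup>2 / 2" "Z (\<alpha> - 1) x t" "Z \<alpha> x t"] le
    by (intro has_integral_add has_integral_mult_right ident_has_integral) auto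
  then have "layer_energy g l zb H q \<alpha> x t
     = h \<alpha> x t * (?v\<^sup>2 / 2) + g * (((Z \<alpha> x t)\<^sup>2 - (Z (\<alpha> - 1) x t)\<^sup>2) / 2)"
    unfolding layer_energy_def layer_int_def energy_density_def Z_diff[OF assms(1)]
    by (simp add: integral_unique)
  also have "h \<alpha> x t * (?v\<^sup>2 / 2) = (q \<alpha> x t)\<^sup>2 / (2 * h \<alpha> x t)"
    using h_pos[OF assms, of x] by (simp add: layer_velocity_def power2_eq_square field_simps)
  finally show ?thesis by simp
qed

text \<open>The potential energy flux and the pressure work combine to the single term
  \<open>g Z\<^sub>N q\<close>, where \<open>Z\<^sub>N\<close> is the free surface.\<close>

lemma layer_energy_flux_eq:
  assumes "\<alpha> \<in> {1..N}" "t \<in> J"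
  shows "layer_velocity l H q \<alpha> x t * (layer_energy g l zb H q \<alpha> x t + layer_pressure g N l H \<alpha> x t)
    = q \<alpha> x t * ((q \<alpha> x t / h \<alpha> x t)\<^sup>2 / 2 + g * Z N x t)"
proof -
  have e: "layer_energy g l zb H q \<alpha> x t + layer_pressure g N l H \<alpha> x t
     = (q \<alpha> x t)\<^sup>2 / (2 * h \<alpha> x t) + g * Z N x t * h \<alpha> x t"
    unfolding layer_energy_eq[OF assms] layer_pressure_eq[OF assms(1)] Z_diff[OF assms(1)]
    by (simp add: power2_eq_square field_simps)
  have "a / b * (a\<^sup>2 / (2 * b) + c * b) = a * ((a / b)\<^sup>2 / 2 + c)" if "b > 0" for a b c :: real
  proof -
    have "a\<^sup>2 / (2 * b) + c * b = b * ((a / b)\<^sup>2 / 2 + c)"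
      using that by (simp add: power_divide power2_eq_square distrib_left)
    then show ?thesis using that by simp
  qed
  from this[OF h_pos[OF assms, of x]] show ?thesis unfolding e layer_velocity_def .
qed

text \<open>Differentiating the integral of g (Z N - z) over a layer with moving ends yields the two
  interface pressure terms of the momentum equation plus g h times the surface slope. The interface
  terms thus cancel from the momentum equation, in the energy balance as well as in the derivation
  from the Euler system.\<close>

lemma momentum_flux_deriv:
  fixes x t :: real
  assumes "\<alpha> \<in> {1..N}" "t \<in> J" "C1_xt J (q \<alpha>)"
  defines "v \<equiv> layer_velocity l H q \<alpha> x t"
  shows "deriv (\<lambda>y. (q \<alpha> y t)\<^sup>2 / h \<alpha> y t + layer_pressure g N l H \<alpha> y t) x
     = 2 * v * deriv (\<lambda>y. q \<alpha> y t) x - v\<^sup>2 * deriv (\<lambda>y. h \<alpha> y t) x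
       + (interface_pressure g N l H \<alpha> x t * deriv (\<lambda>y. Z \<alpha> y t) x
         - interface_pressure g N l H (\<alpha> - 1) x t * deriv (\<lambda>y. Z (\<alpha> - 1) y t) x)
       + g * h \<alpha> x t * deriv (\<lambda>y. Z N y t) x"
proof -
  have h: "h \<alpha> x t \<noteq> 0" using h_pos[OF assms(1,2), of x] by simp
  have "((\<lambda>y. (q \<alpha> y t)\<^sup>2 / h \<alpha> y t) has_real_derivative
      2 * v * deriv (\<lambda>y. q \<alpha> y t) x - v\<^sup>2 * deriv (\<lambda>y. h \<alpha> y t) x) (at x)"
    by (rule DERIV_cong[OF DERIV_divide[OF DERIV_power[OF C1_xt_partials(1)[OF assms(3,2)], of 2]
            h_derivs(1)[OF assms(2)] h]])
      (use h in \<open>simp add: v_def layer_velocity_def power2_eq_square field_simps\<close>)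
  note D = DERIV_imp_deriv[OF DERIV_add[OF this layer_pressure_deriv[OF assms(1,2)]]]
  have "\<alpha> \<le> N" "\<alpha> - 1 \<le> N" using assms(1) by auto
  note p = this[THEN interface_pressure_eq, of x t]
  show ?thesis
    unfolding D p Z_diff[OF assms(1), of x t] by (simp add: algebra_simps)
qed

text \<open>The left side is G times the velocity jump times the excess of the interface velocity
  over the mean of its neighbours. The upwind choice makes that excess half the jump with the sign
  of G, so the product is half the squared jump times \<bar>G\<bar>.\<close>

lemma upwind_dissipation:
  "exchange l H q \<alpha> x t * (upwind_velocity l H q \<alpha> x t * (layer_velocity l H q (\<alpha> + 1) x t - layer_velocity l H q \<alpha> x t)
      - ((layer_velocity l H q (\<alpha> + 1) x t)\<^sup>2 / 2 - (layer_velocity l H q \<alpha> x t)\<^sup>2 / 2))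
   = 1 / 2 * ((layer_velocity l H q (\<alpha> + 1) x t - layer_velocity l H q \<alpha> x t)\<^sup>2 * \<bar>exchange l H q \<alpha> x t\<bar>)"
  by (simp add: upwind_velocity_def power2_eq_square algebra_simps add_divide_distrib diff_divide_distrib)

lemma energy_equality:
  assumes sol: "layer_averaged_solution g N l zb J H q r" and t: "t \<in> J"
  shows "deriv (\<lambda>s. \<Sum>\<alpha>=1..N. layer_energy g l zb H q \<alpha> x s) t
          + deriv (\<lambda>y. \<Sum>\<alpha>=1..N. layer_velocity l H q \<alpha> y t
              * (layer_energy g l zb H q \<alpha> y t + layer_pressure g N l H \<alpha> y t)) x
          = - (1 / 2) * (\<Sum>\<alpha>=1..N.
              (layer_velocity l H q (\<alpha> + 1) x t - layer_velocity l H q \<alpha> x t)\<^sup>2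
                * \<bar>exchange l H q \<alpha> x t\<bar>)"
proof -
  define v where "v \<alpha> = layer_velocity l H q \<alpha> x t" for \<alpha>
  define G where "G \<alpha> = exchange l H q \<alpha> x t" for \<alpha>
  define u where "u \<alpha> = upwind_velocity l H q \<alpha> x t" for \<alpha>
  define qx where "qx \<alpha> = deriv (\<lambda>y. q \<alpha> y t) x" for \<alpha>
  define qt where "qt \<alpha> = deriv (\<lambda>s. q \<alpha> x s) t" for \<alpha>
  define hx where "hx \<alpha> = deriv (\<lambda>y. h \<alpha> y t) x" for \<alpha>
  define ht where "ht \<alpha> = deriv (\<lambda>s. h \<alpha> x s) t" for \<alpha>
  define Zt where "Zt \<alpha> = deriv (\<lambda>s. Z \<alpha> x s) t" for \<alpha>
  define ZNx where "ZNx = deriv (\<lambda>y. Z N y t) x"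
  have q: "C1_xt J (q \<alpha>)" if "\<alpha> \<in> {1..N}" for \<alpha>
    using sol that unfolding layer_averaged_solution_def by blast
  have G0: "G 0 = 0" "G N = 0"
    and mass: "\<And>\<alpha>. \<alpha> \<in> {1..N} \<Longrightarrow> ht \<alpha> + qx \<alpha> = G \<alpha> - G (\<alpha> - 1)"
    and mom: "\<And>\<alpha>. \<alpha> \<in> {1..N} \<Longrightarrow>
       qt \<alpha> + deriv (\<lambda>y. (q \<alpha> y t)\<^sup>2 / h \<alpha> y t + layer_pressure g N l H \<alpha> y t) x
            = u \<alpha> * G \<alpha> - u (\<alpha> - 1) * G (\<alpha> - 1)
              + interface_pressure g N l H \<alpha> x t * deriv (\<lambda>y. Z \<alpha> y t) x
              - interface_pressure g N l H (\<alpha> - 1) x t * deriv (\<lambda>y. Z (\<alpha> - 1) y t) x"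
    using sol t unfolding layer_averaged_solution_def Let_def G_def u_def qx_def qt_def ht_def by blast+
  \<comment> \<open>The interface pressure terms have cancelled; gravity survives only through the
    slope of the free surface.\<close>
  have mom': "qt \<alpha> = u \<alpha> * G \<alpha> - u (\<alpha> - 1) * G (\<alpha> - 1) - 2 * v \<alpha> * qx \<alpha> + (v \<alpha>)\<^sup>2 * hx \<alpha> - g * h \<alpha> x t * ZNx"
    if "\<alpha> \<in> {1..N}" for \<alpha>
    using mom[OF that] momentum_flux_deriv[where q = q and \<alpha> = \<alpha>, OF that t q[OF that], of x]
    unfolding v_def qx_def hx_def ZNx_def by linarith
  have E: "((\<lambda>s. \<Sum>\<alpha>=1..N. layer_energy g l zb H q \<alpha> x s) has_real_derivative
      (\<Sum>\<alpha>=1..N. v \<alpha> * qt \<alpha> - (v \<alpha>)\<^sup>2 / 2 * ht \<alpha> + g * (Z \<alpha> x t * Zt \<alpha> - Z (\<alpha> - 1) x t * Zt (\<alpha> - 1)))) (at t)"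
  proof (rule DERIV_sum)
    fix \<alpha> assume a: "\<alpha> \<in> {1..N}"
    have h: "h \<alpha> x t \<noteq> 0" using h_pos[OF a t, of x] by simp
    have "((\<lambda>s. (q \<alpha> x s)\<^sup>2 / (2 * h \<alpha> x s)) has_real_derivative v \<alpha> * qt \<alpha> - (v \<alpha>)\<^sup>2 / 2 * ht \<alpha>) (at t)"
    proof -
      have h2: "2 * h \<alpha> x t \<noteq> 0" using h by simp
      have Dq: "((\<lambda>s. q \<alpha> x s) has_real_derivative qt \<alpha>) (at t)"
        unfolding qt_def by (rule C1_xt_partials(2)[OF q[OF a] t])
      have Dh: "((\<lambda>s. h \<alpha> x s) has_real_derivative ht \<alpha>) (at t)"
        unfolding ht_def by (rule h_derivs(2)[OF t])
      show ?thesis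
        by (rule DERIV_cong[OF DERIV_divide[OF DERIV_power[OF Dq, of 2] DERIV_cmult[OF Dh, of 2] h2]]) (use h in \<open>simp add: v_def layer_velocity_def power2_eq_square field_simps\<close>)
    qed
    moreover have "((\<lambda>s. g / 2 * ((Z \<alpha> x s)\<^sup>2 - (Z (\<alpha> - 1) x s)\<^sup>2)) has_real_derivative
        g * (Z \<alpha> x t * Zt \<alpha> - Z (\<alpha> - 1) x t * Zt (\<alpha> - 1))) (at t)"
      unfolding Zt_def by (rule derivative_eq_intros Z_derivs t refl | simp add: algebra_simps)+
    ultimately have "((\<lambda>s. (q \<alpha> x s)\<^sup>2 / (2 * h \<alpha> x s) + g / 2 * ((Z \<alpha> x s)\<^sup>2 - (Z (\<alpha> - 1) x s)\<^sup>2))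
        has_real_derivative v \<alpha> * qt \<alpha> - (v \<alpha>)\<^sup>2 / 2 * ht \<alpha> + g * (Z \<alpha> x t * Zt \<alpha> - Z (\<alpha> - 1) x t * Zt (\<alpha> - 1))) (at t)"
      by (rule DERIV_add)
    \<comment> \<open>The closed form of the layer energy is available only at times in J; openness
      of J lets it be used under the time derivative.\<close>
    then show "((\<lambda>s. layer_energy g l zb H q \<alpha> x s) has_real_derivative
        v \<alpha> * qt \<alpha> - (v \<alpha>)\<^sup>2 / 2 * ht \<alpha> + g * (Z \<alpha> x t * Zt \<alpha> - Z (\<alpha> - 1) x t * Zt (\<alpha> - 1))) (at t)"
      by (rule has_field_derivative_transform_within_open[OF _ J t]) (simp add: layer_energy_eq[OF a])
  qed
  have F: "((\<lambda>y. \<Sum>\<alpha>=1..N. layer_velocity l H q \<alpha> y t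
              * (layer_energy g l zb H q \<alpha> y t + layer_pressure g N l H \<alpha> y t)) has_real_derivative
      (\<Sum>\<alpha>=1..N. qx \<alpha> * ((v \<alpha>)\<^sup>2 / 2 + g * Z N x t) + (v \<alpha>)\<^sup>2 * (qx \<alpha> - v \<alpha> * hx \<alpha>) + q \<alpha> x t * (g * ZNx))) (at x)"
  proof (rule DERIV_sum)
    fix \<alpha> assume a: "\<alpha> \<in> {1..N}"
    have h: "h \<alpha> x t \<noteq> 0" using h_pos[OF a t, of x] by simp
    show "((\<lambda>y. layer_velocity l H q \<alpha> y t
         * (layer_energy g l zb H q \<alpha> y t + layer_pressure g N l H \<alpha> y t)) has_real_derivative
       qx \<alpha> * ((v \<alpha>)\<^sup>2 / 2 + g * Z N x t) + (v \<alpha>)\<^sup>2 * (qx \<alpha> - v \<alpha> * hx \<alpha>) + q \<alpha> x t * (g * ZNx)) (at x)"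
    proof -
      have hv: "h \<alpha> x t * v \<alpha> = q \<alpha> x t" using h by (simp add: v_def layer_velocity_def)
      have D: "((\<lambda>y. q \<alpha> y t) has_real_derivative qx \<alpha>) (at x)"
        unfolding qx_def by (rule C1_xt_partials(1)[OF q[OF a] t])
      have "((\<lambda>y. q \<alpha> y t / h \<alpha> y t) has_real_derivative
          (qx \<alpha> * h \<alpha> x t - q \<alpha> x t * hx \<alpha>) / (h \<alpha> x t * h \<alpha> x t)) (at x)"
        unfolding hx_def by (rule DERIV_divide[OF D h_derivs(1)[OF t] h])
      then have W: "((\<lambda>y. q \<alpha> y t / h \<alpha> y t) has_real_derivative (qx \<alpha> - v \<alpha> * hx \<alpha>) / h \<alpha> x t) (at x)"
        by (rule DERIV_cong) (use h in \<open>simp add: hv[symmetric] field_simps\<close>)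
      have "((\<lambda>y. (q \<alpha> y t / h \<alpha> y t)\<^sup>2 / 2) has_real_derivative
          2 * (q \<alpha> x t / h \<alpha> x t) ^ 1 * ((qx \<alpha> - v \<alpha> * hx \<alpha>) / h \<alpha> x t) / 2) (at x)"
        using DERIV_cdivide[OF DERIV_power[OF W, of 2], of 2] by (simp add: mult_ac)
      then have "((\<lambda>y. (q \<alpha> y t / h \<alpha> y t)\<^sup>2 / 2) has_real_derivative
          v \<alpha> * ((qx \<alpha> - v \<alpha> * hx \<alpha>) / h \<alpha> x t)) (at x)"
        by (simp add: v_def layer_velocity_def)
      from DERIV_mult[OF D DERIV_add[OF this DERIV_cmult[OF Z_derivs(1)[OF t, of N], of g]]]
      show ?thesis
        unfolding layer_energy_flux_eq[OF a t]
        by (rule DERIV_cong)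
          (use h in \<open>simp add: v_def layer_velocity_def ZNx_def power2_eq_square field_simps\<close>)
    qed
  qed
  \<comment> \<open>The work of the surface slope, - g h v times the slope, cancels the slope term
    of the energy flux because q = h v. The mass equation replaces the time derivative of h.\<close>
  have layer: "v \<alpha> * qt \<alpha> - (v \<alpha>)\<^sup>2 / 2 * ht \<alpha> + g * (Z \<alpha> x t * Zt \<alpha> - Z (\<alpha> - 1) x t * Zt (\<alpha> - 1))
       + (qx \<alpha> * ((v \<alpha>)\<^sup>2 / 2 + g * Z N x t) + (v \<alpha>)\<^sup>2 * (qx \<alpha> - v \<alpha> * hx \<alpha>) + q \<alpha> x t * (g * ZNx))
     = v \<alpha> * (u \<alpha> * G \<alpha> - u (\<alpha> - 1) * G (\<alpha> - 1)) - (v \<alpha>)\<^sup>2 / 2 * (G \<alpha> - G (\<alpha> - 1))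
       + g * Z N x t * qx \<alpha> + g * (Z \<alpha> x t * Zt \<alpha> - Z (\<alpha> - 1) x t * Zt (\<alpha> - 1))" if a: "\<alpha> \<in> {1..N}" for \<alpha>
  proof -
    have "q \<alpha> x t = h \<alpha> x t * v \<alpha>"
      using h_pos[OF a t, of x] by (simp add: v_def layer_velocity_def)
    then show ?thesis
      unfolding mom'[OF a] mass[OF a, symmetric] by (simp add: power2_eq_square algebra_simps)
  qed
  \<comment> \<open>This is the vanishing of G at the free surface, read as total mass balance: the
    bottom is fixed, so the thickness rates telescope to the rate of the surface height.\<close>
  have GN: "Zt N + (\<Sum>\<alpha>=1..N. qx \<alpha>) = 0"
  proof -
    have "(\<Sum>\<alpha>=1..N. ht \<alpha>) = (\<Sum>\<alpha>=1..N. Zt \<alpha> - Zt (\<alpha> - 1))"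
      by (rule sum.cong) (auto simp: ht_def Zt_def h_deriv_diff(2) t)
    also have "\<dots> = Zt N" unfolding sum_telescope_1 by (simp add: Zt_def)
    finally show ?thesis
      using G0(2) exchange_eq[where q = q and x = x, OF q t order_refl] by (simp add: G_def ht_def qx_def sum.distrib)
  qed
  have "(\<Sum>\<alpha>=1..N. v \<alpha> * (u \<alpha> * G \<alpha> - u (\<alpha> - 1) * G (\<alpha> - 1)))
      = - (\<Sum>\<alpha>=1..N. u \<alpha> * G \<alpha> * (v (\<alpha> + 1) - v \<alpha>))"
    unfolding sum_by_parts_1[of v "\<lambda>\<alpha>. u \<alpha> * G \<alpha>"] by (simp add: G0)
  moreover have "(\<Sum>\<alpha>=1..N. (v \<alpha>)\<^sup>2 / 2 * (G \<alpha> - G (\<alpha> - 1)))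
      = - (\<Sum>\<alpha>=1..N. G \<alpha> * ((v (\<alpha> + 1))\<^sup>2 / 2 - (v \<alpha>)\<^sup>2 / 2))"
    unfolding sum_by_parts_1[of "\<lambda>\<alpha>. (v \<alpha>)\<^sup>2 / 2" G] by (simp add: G0)
  ultimately have K: "(\<Sum>\<alpha>=1..N. v \<alpha> * (u \<alpha> * G \<alpha> - u (\<alpha> - 1) * G (\<alpha> - 1)))
      - (\<Sum>\<alpha>=1..N. (v \<alpha>)\<^sup>2 / 2 * (G \<alpha> - G (\<alpha> - 1)))
      = - (\<Sum>\<alpha>=1..N. G \<alpha> * (u \<alpha> * (v (\<alpha> + 1) - v \<alpha>) - ((v (\<alpha> + 1))\<^sup>2 / 2 - (v \<alpha>)\<^sup>2 / 2)))"
    by (simp add: sum_subtractf[symmetric] sum_negf[symmetric] algebra_simps)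
  \<comment> \<open>The rate of potential energy telescopes to g Z Zt at the free surface, and the
    remaining flux has the same factor g Z; together they are g Z times the total mass
    balance.\<close>
  have P: "(\<Sum>\<alpha>=1..N. g * Z N x t * qx \<alpha>)
      + (\<Sum>\<alpha>=1..N. g * (Z \<alpha> x t * Zt \<alpha> - Z (\<alpha> - 1) x t * Zt (\<alpha> - 1))) = 0"
  proof -
    have "(\<Sum>\<alpha>=1..N. Z \<alpha> x t * Zt \<alpha> - Z (\<alpha> - 1) x t * Zt (\<alpha> - 1)) = Z N x t * Zt N"
      unfolding sum_telescope_1[of "\<lambda>\<alpha>. Z \<alpha> x t * Zt \<alpha>"] by (simp add: Zt_def)
    then have "(\<Sum>\<alpha>=1..N. g * Z N x t * qx \<alpha>)
      + (\<Sum>\<alpha>=1..N. g * (Z \<alpha> x t * Zt \<alpha> - Z (\<alpha> - 1) x t * Zt (\<alpha> - 1)))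
      = g * Z N x t * (Zt N + (\<Sum>\<alpha>=1..N. qx \<alpha>))"
      unfolding sum_distrib_left[symmetric] by (simp add: algebra_simps)
    then show ?thesis by (simp only: GN mult_zero_right)
  qed
  have D: "(\<Sum>\<alpha>=1..N. G \<alpha> * (u \<alpha> * (v (\<alpha> + 1) - v \<alpha>) - ((v (\<alpha> + 1))\<^sup>2 / 2 - (v \<alpha>)\<^sup>2 / 2)))
      = 1 / 2 * (\<Sum>\<alpha>=1..N. (v (\<alpha> + 1) - v \<alpha>)\<^sup>2 * \<bar>G \<alpha>\<bar>)"
    unfolding G_def u_def v_def upwind_dissipation sum_distrib_left ..
  have L: "(\<Sum>\<alpha>=1..N. v \<alpha> * qt \<alpha> - (v \<alpha>)\<^sup>2 / 2 * ht \<alpha> + g * (Z \<alpha> x t * Zt \<alpha> - Z (\<alpha> - 1) x t * Zt (\<alpha> - 1)))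
      + (\<Sum>\<alpha>=1..N. qx \<alpha> * ((v \<alpha>)\<^sup>2 / 2 + g * Z N x t) + (v \<alpha>)\<^sup>2 * (qx \<alpha> - v \<alpha> * hx \<alpha>) + q \<alpha> x t * (g * ZNx))
      = (\<Sum>\<alpha>=1..N. v \<alpha> * (u \<alpha> * G \<alpha> - u (\<alpha> - 1) * G (\<alpha> - 1)) - (v \<alpha>)\<^sup>2 / 2 * (G \<alpha> - G (\<alpha> - 1))
       + g * Z N x t * qx \<alpha> + g * (Z \<alpha> x t * Zt \<alpha> - Z (\<alpha> - 1) x t * Zt (\<alpha> - 1)))"
    unfolding sum.distrib[symmetric] by (rule sum.cong[OF refl layer])
  show ?thesis
    unfolding DERIV_imp_deriv[OF E] DERIV_imp_deriv[OF F] L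
    using K P D unfolding G_def[symmetric] v_def[symmetric] sum.distrib sum_subtractf by linarith
qed

end

section \<open>Layer averages of Euler solutions\<close>

text \<open>A test function on the smaller set is one on the larger set, and off its compact support
  both the function and its derivatives vanish, so the two integrals coincide.\<close>

lemma weak_balance_subset:
  assumes "weak_balance \<Omega> A B C S" "\<Omega>' \<subseteq> \<Omega>"
  shows "weak_balance \<Omega>' A B C S"
  unfolding weak_balance_def
proof (intro allI impI)
  fix \<theta> assume \<theta>: "test_function \<Omega>' \<theta>"
  then obtain K where K: "C1_xzt UNIV \<theta>" "compact K" "K \<subseteq> \<Omega>'" "\<And>x z t. (x, z, t) \<notin> K \<Longrightarrow> \<theta> x z t = 0"
    unfolding test_function_def by blast
  let ?f = "\<lambda>(x, z, t). A x z t * deriv (\<lambda>s. \<theta> x z s) t + B x z t * deriv (\<lambda>y. \<theta> y z t) x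
          + C x z t * deriv (\<lambda>v. \<theta> x v t) z + S x z t * \<theta> x z t"
  have "test_function \<Omega> \<theta>" using K assms(2) unfolding test_function_def by blast
  then have "(?f has_integral 0) \<Omega>" using assms(1)[unfolded weak_balance_def, rule_format] by blast
  moreover have "?f = (\<lambda>X. if X \<in> \<Omega>' then ?f X else 0)"
  proof
    fix X
    show "?f X = (if X \<in> \<Omega>' then ?f X else 0)"
    proof (cases "X \<in> K")
      case False
      then have "?f X = 0" using test_function_derivs_outside[OF K(1,2,4)] K(4) by (cases X) simp
      then show ?thesis by simp
    qed (use K(3) in auto)
  qed
  ultimately show "(?f has_integral 0) \<Omega>'"
    using has_integral_restrict[OF assms(2), of ?f 0] by (simp only:)
qed

lemma weak_balance_cong:
  assumes "weak_balance \<Omega> A B C S"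
    and "\<And>x z t. (x, z, t) \<in> \<Omega> \<Longrightarrow> A x z t = A' x z t \<and> B x z t = B' x z t \<and> C x z t = C' x z t \<and> S x z t = S' x z t"
  shows "weak_balance \<Omega> A' B' C' S'"
  unfolding weak_balance_def
proof (intro allI impI)
  fix \<theta> assume "test_function \<Omega> \<theta>"
  note I = assms(1)[unfolded weak_balance_def, rule_format, OF this]
  show "((\<lambda>(x, z, t). A' x z t * deriv (\<lambda>s. \<theta> x z s) t + B' x z t * deriv (\<lambda>y. \<theta> y z t) x
          + C' x z t * deriv (\<lambda>v. \<theta> x v t) z + S' x z t * \<theta> x z t) has_integral 0) \<Omega>"
    by (rule has_integral_eq[OF _ I]) (auto simp: assms(2))
qed

section \<open>One-dimensional arguments along a vertical line in a layer\<close>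

lemma C1_xzt_partial_z:
  assumes "C1_xzt J f" "t \<in> J"
  shows "((\<lambda>v. f x v t) has_real_derivative deriv (\<lambda>v. f x v t) z) (at z)"
proof -
  have X: "(x, z, t) \<in> UNIV \<times> UNIV \<times> J" using assms(2) by simp
  note D = C1_on_partial_xzt(2)[OF assms(1)[unfolded C1_xzt_def] X]
  show ?thesis using D unfolding DERIV_imp_deriv[OF D] .
qed

text \<open>The balance laws give the derivative only inside the open layer; continuity carries the
  affine formula up to the interfaces.\<close>

lemma affine_of_constant_deriv:
  fixes f :: "real \<Rightarrow> real"
  assumes "a < b" and d: "\<And>z. (f has_real_derivative f' z) (at z)"
    and c: "\<And>z. a < z \<Longrightarrow> z < b \<Longrightarrow> f' z = c" and z: "z \<in> {a..b}"
  shows "f z = f a + c * (z - a)"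
proof -
  have "f z - c * z = f a - c * a"
  proof (rule DERIV_isconst2[of a b "\<lambda>z. f z - c * z"])
    show "continuous_on {a..b} (\<lambda>z. f z - c * z)"
      by (intro continuous_intros continuous_at_imp_continuous_on ballI DERIV_isCont[OF d])
    show "((\<lambda>z. f z - c * z) has_real_derivative 0) (at z)" if "a < z" "z < b" for z
      using DERIV_diff[OF d[of z] DERIV_cmult[OF DERIV_ident, of c z UNIV]] c[OF that] by simp
  qed (use assms in auto)
  then show ?thesis by (simp add: algebra_simps)
qed

text \<open>With v the mean of f, the hypothesis says that the integral of the square of f - v is
  zero; a continuous nonnegative integrand with zero integral vanishes.\<close>

lemma equality_Cauchy_Schwarz_interval:
  fixes f :: "real \<Rightarrow> real"
  assumes ab: "a < b" and f: "continuous_on {a..b} f"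
    and eq: "integral {a..b} (\<lambda>z. (f z)\<^sup>2) = (integral {a..b} f)\<^sup>2 / (b - a)" and z: "z \<in> {a..b}"
  shows "f z = integral {a..b} f / (b - a)"
proof -
  define v where "v = integral {a..b} f / (b - a)"
  have i1: "(f has_integral v * (b - a)) {a..b}"
    using integrable_integral[OF integrable_continuous_interval[OF f]] ab by (simp add: v_def)
  have "continuous_on {a..b} (\<lambda>z. (f z)\<^sup>2)" by (intro continuous_intros f)
  from integrable_integral[OF integrable_continuous_interval[OF this]]
  have i2: "((\<lambda>z. (f z)\<^sup>2) has_integral v\<^sup>2 * (b - a)) {a..b}"
    using ab unfolding eq v_def by (simp add: power2_eq_square)
  have i3: "((\<lambda>z. v\<^sup>2) has_integral (b - a) *\<^sub>R v\<^sup>2) {a..b}"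
    using has_integral_const_real[of "v\<^sup>2" a b] ab by simp
  from has_integral_add[OF has_integral_diff[OF i2 has_integral_mult_right[OF i1, of "2 * v"]] i3]
  have "((\<lambda>z. (f z)\<^sup>2 - 2 * v * f z + v\<^sup>2) has_integral 0) (cbox a b)"
    by (simp add: power2_eq_square algebra_simps)
  then have "(f z)\<^sup>2 - 2 * v * f z + v\<^sup>2 = 0"
  proof (rule has_integral_0_cbox_imp_0[of a b "\<lambda>z. (f z)\<^sup>2 - 2 * v * f z + v\<^sup>2", rotated 2])
    show "continuous_on (cbox a b) (\<lambda>z. (f z)\<^sup>2 - 2 * v * f z + v\<^sup>2)"
      unfolding box_real by (intro continuous_intros f)
    show "0 \<le> (f z)\<^sup>2 - 2 * v * f z + v\<^sup>2" for z
      using zero_le_power2[of "f z - v"] by (simp add: power2_diff algebra_simps)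
  qed (use ab z in auto)
  then have "(f z - v)\<^sup>2 = 0" by (simp add: power2_diff algebra_simps)
  then show ?thesis by (simp add: v_def)
qed

section \<open>Open slabs between interfaces and layerwise extensions\<close>

context layered_flow
begin

lemma Z_mono: "i \<le> j \<Longrightarrow> j \<le> N \<Longrightarrow> t \<in> J \<Longrightarrow> Z i x t \<le> Z j x t"
proof (induction j)
  case (Suc j)
  then show ?case using Z_less[of "Suc j" t x] by (cases "i = Suc j") auto
qed simp

lemma Z_strict_mono: "i < j \<Longrightarrow> j \<le> N \<Longrightarrow> t \<in> J \<Longrightarrow> Z i x t < Z j x t"
  using Z_mono[of "Suc i" j t x] Z_less[of "Suc i" t x] by simp

text \<open>Three cases matter: \<open>slab (\<alpha> - 1) \<alpha>\<close> is an open layer,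
  \<open>slab (\<alpha> - 1) (\<alpha> + 1)\<close> is an open neighbourhood of the interface
  \<alpha>, and \<open>slab 0 N\<close> is the whole fluid domain.\<close>

definition slab :: "nat \<Rightarrow> nat \<Rightarrow> (real \<times> real \<times> real) set" where
  "slab i j = {(x, z, t). t \<in> J \<and> Z i x t < z \<and> z < Z j x t}"

lemma open_slab: "open (slab i j)"
proof -
  let ?S = "UNIV \<times> UNIV \<times> J :: (real \<times> real \<times> real) set"
  have S: "open ?S" using J by (intro open_Times) auto
  have c: "continuous_on ?S (\<lambda>X. Z k (fst X) (snd (snd X)))" for k
  proof -
    have "(\<lambda>X. (fst X, snd (snd X))) ` ?S \<subseteq> UNIV \<times> J" by auto
    moreover have "continuous_on ?S (\<lambda>X. (fst X, snd (snd X)))" by (intro continuous_intros)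
    ultimately show ?thesis
      using continuous_on_compose2[OF C1_on_imp_continuous_on[OF C1_xt_Z[unfolded C1_xt_def]], of ?S "\<lambda>X. (fst X, snd (snd X))" k]
      by simp
  qed
  have "open (?S \<inter> (\<lambda>X. (fst (snd X) - Z i (fst X) (snd (snd X)), Z j (fst X) (snd (snd X)) - fst (snd X))) -` ({0<..} \<times> {0<..}))"
    by (intro continuous_open_preimage continuous_intros c S open_Times open_greaterThan)
  also have "\<dots> = slab i j" unfolding slab_def by auto
  finally show ?thesis .
qed

text \<open>Strict ordering of the interfaces leaves only the two ends of a layer to be excluded.
  The bottom of layer 1 and the top of layer N are not interior, so they are kept: the boundary
  conditions are read there.\<close>

lemma not_interior_interface:
  assumes "\<alpha> \<in> {1..N}" "t \<in> J" "z \<in> {Z (\<alpha> - 1) x t..Z \<alpha> x t}"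
    and "z \<noteq> Z (\<alpha> - 1) x t \<or> \<alpha> = 1" "z \<noteq> Z \<alpha> x t \<or> \<alpha> = N"
  shows "z \<notin> (\<lambda>j. Z j x t) ` {1..<N}"
proof
  assume "z \<in> (\<lambda>j. Z j x t) ` {1..<N}"
  then obtain j where j: "1 \<le> j" "j < N" "z = Z j x t" by auto
  consider "j < \<alpha> - 1" | "j = \<alpha> - 1" | "j = \<alpha>" | "j > \<alpha>" by linarith
  then show False
  proof cases
    case 1
    moreover have "\<alpha> - 1 \<le> N" using assms(1) by auto
    ultimately show ?thesis using Z_strict_mono[of j "\<alpha> - 1" t x] assms j by auto
  next
    case 4 then show ?thesis using Z_strict_mono[of \<alpha> j t x] assms j by auto
  qed (use assms j in auto)
qed

text \<open>The end points form a null set, so the unconstrained values at interfaces do not affect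
  layer integrals.\<close>

lemma layer_int_cong:
  assumes "\<alpha> \<in> {1..N}" "t \<in> J"
    and "\<And>z. Z (\<alpha> - 1) x t < z \<Longrightarrow> z < Z \<alpha> x t \<Longrightarrow> f x z t = f' z"
  shows "layer_int zb l H \<alpha> f x t = integral {Z (\<alpha> - 1) x t..Z \<alpha> x t} f'"
  unfolding layer_int_def
  by (rule integral_spike[of "{Z (\<alpha> - 1) x t, Z \<alpha> x t}"]) (use assms(3) in auto)

lemma C1_on_xt_slab: "C1_xt J f \<Longrightarrow> C1_on (\<lambda>(x, z, t). f x t) (slab i j)"
proof -
  assume f: "C1_xt J f"
  have "C1_on (\<lambda>X. (\<lambda>(x, t). f x t) (fst X, snd (snd X))) (slab i j)"
    by (rule C1_on_compose[OF _ f[unfolded C1_xt_def]]) (auto intro!: C1_on_intros simp: slab_def)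
  then show ?thesis by (simp add: case_prod_unfold)
qed

lemma C1_on_xzt_slab: "C1_xzt J f \<Longrightarrow> C1_on (\<lambda>(x, z, t). f x z t) (slab i j)"
  unfolding C1_xzt_def by (erule C1_on_subset) (auto simp: slab_def)

lemma layerwise_C1E:
  assumes "layerwise_C1 N l zb J H f"
  obtains F where "\<And>\<alpha>. \<alpha> \<in> {1..N} \<Longrightarrow> C1_xzt J (F \<alpha>)"
    "\<And>\<alpha> x z t. \<alpha> \<in> {1..N} \<Longrightarrow> t \<in> J \<Longrightarrow> z \<in> {Z (\<alpha> - 1) x t..Z \<alpha> x t} \<Longrightarrow>
       z \<noteq> Z (\<alpha> - 1) x t \<or> \<alpha> = 1 \<Longrightarrow> z \<noteq> Z \<alpha> x t \<or> \<alpha> = N \<Longrightarrow> f x z t = F \<alpha> x z t"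
proof -
  from assms obtain F where F: "\<forall>\<alpha>\<in>{1..N}. C1_xzt J (F \<alpha>) \<and>
     (\<forall>x. \<forall>t\<in>J. \<forall>z\<in>{Z (\<alpha> - 1) x t..Z \<alpha> x t}. z \<notin> (\<lambda>j. Z j x t) ` {1..<N} \<longrightarrow> f x z t = F \<alpha> x z t)"
    unfolding layerwise_C1_def by (auto dest!: bchoice)
  show ?thesis
  proof (rule that[of F])
    show "f x z t = F \<alpha> x z t" if "\<alpha> \<in> {1..N}" "t \<in> J" "z \<in> {Z (\<alpha> - 1) x t..Z \<alpha> x t}"
       "z \<noteq> Z (\<alpha> - 1) x t \<or> \<alpha> = 1" "z \<noteq> Z \<alpha> x t \<or> \<alpha> = N" for \<alpha> x z t
      using F not_interior_interface[OF that] that by blast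
  qed (use F in blast)
qed

section \<open>Derivation of the layer-averaged system from an Euler solution\<close>

lemma euler_imp_layer_averaged:
  fixes \<eta> :: "real \<Rightarrow> real \<Rightarrow> real" and u w p :: "real \<Rightarrow> real \<Rightarrow> real \<Rightarrow> real"
  defines "q \<equiv> \<lambda>\<alpha>. layer_int zb l H \<alpha> (\<lambda>x z t. phi zb \<eta> x z t * u x z t)"
    and "r \<equiv> \<lambda>\<alpha>. layer_int zb l H \<alpha> (\<lambda>x z t. phi zb \<eta> x z t * w x z t)"
  assumes Hd: "H = depth zb \<eta>" and euler: "euler_solution g zb J \<eta> u w p"
    and lu: "layerwise_C1 N l zb J H u" and lw: "layerwise_C1 N l zb J H w" and lp: "layerwise_C1 N l zb J H p"
    and closure: "\<And>\<alpha> x t. \<alpha> \<in> {1..N} \<Longrightarrow> t \<in> J \<Longrightarrow>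
        layer_int zb l H \<alpha> (\<lambda>x z t. phi zb \<eta> x z t * (u x z t)\<^sup>2) x t
          = (q \<alpha> x t)\<^sup>2 / layer_int zb l H \<alpha> (phi zb \<eta>) x t"
  shows "layer_averaged_solution g N l zb J H q r"
proof -
  let ?\<phi> = "phi zb \<eta>" and ?\<Omega> = "fluid_domain zb \<eta> J"
  define v where "v = layer_velocity l H q"
  have mass_w: "weak_balance ?\<Omega> ?\<phi> (\<lambda>x z t. ?\<phi> x z t * u x z t) (\<lambda>x z t. ?\<phi> x z t * w x z t) (\<lambda>x z t. 0)"
    and mom_w: "weak_balance ?\<Omega> (\<lambda>x z t. ?\<phi> x z t * u x z t)
          (\<lambda>x z t. ?\<phi> x z t * (u x z t)\<^sup>2 + p x z t)
          (\<lambda>x z t. ?\<phi> x z t * u x z t * w x z t) (\<lambda>x z t. 0)"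
    and pres_w: "weak_balance ?\<Omega> (\<lambda>x z t. 0) (\<lambda>x z t. 0) p (\<lambda>x z t. - ?\<phi> x z t * g)"
    and kin_s: "\<And>x t. t \<in> J \<Longrightarrow> deriv (\<lambda>s. \<eta> x s) t + u x (\<eta> x t) t * deriv (\<lambda>y. \<eta> y t) x - w x (\<eta> x t) t = 0"
    and kin_b: "\<And>x t. t \<in> J \<Longrightarrow> u x (zb x) t * deriv zb x - w x (zb x) t = 0"
    and p_s: "\<And>x t. t \<in> J \<Longrightarrow> p x (\<eta> x t) t = 0"
    using euler unfolding euler_solution_def Let_def by blast+
  have ZN: "Z N x t = \<eta> x t" for x t
  proof -
    have "H x t = \<eta> x t - zb x" by (simp add: Hd depth_def)
    then show ?thesis by (simp add: Z_N)
  qed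
  have \<Omega>: "?\<Omega> = slab 0 N" unfolding fluid_domain_def slab_def ZN by auto
  have sub: "slab i j \<subseteq> ?\<Omega>" if "i \<le> N" "j \<le> N" for i j
  proof
    fix X assume "X \<in> slab i j"
    then obtain x z t where X: "X = (x, z, t)" "t \<in> J" "Z i x t < z" "z < Z j x t"
      unfolding slab_def by blast
    have "Z 0 x t < z" "z < Z N x t"
      using Z_mono[OF le0 that(1) X(2), of x] Z_mono[OF that(2) order_refl X(2), of x] X(3,4) by linarith+
    then show "X \<in> ?\<Omega>" unfolding \<Omega> slab_def X(1) using X(2) by simp
  qed
  obtain U where U: "\<And>\<alpha>. \<alpha> \<in> {1..N} \<Longrightarrow> C1_xzt J (U \<alpha>)"
    and Ue: "\<And>\<alpha> x z t. \<alpha> \<in> {1..N} \<Longrightarrow> t \<in> J \<Longrightarrow> z \<in> {Z (\<alpha> - 1) x t..Z \<alpha> x t} \<Longrightarrow>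
       z \<noteq> Z (\<alpha> - 1) x t \<or> \<alpha> = 1 \<Longrightarrow> z \<noteq> Z \<alpha> x t \<or> \<alpha> = N \<Longrightarrow> u x z t = U \<alpha> x z t"
    using layerwise_C1E[OF lu] by blast
  obtain W where W: "\<And>\<alpha>. \<alpha> \<in> {1..N} \<Longrightarrow> C1_xzt J (W \<alpha>)"
    and We: "\<And>\<alpha> x z t. \<alpha> \<in> {1..N} \<Longrightarrow> t \<in> J \<Longrightarrow> z \<in> {Z (\<alpha> - 1) x t..Z \<alpha> x t} \<Longrightarrow>
       z \<noteq> Z (\<alpha> - 1) x t \<or> \<alpha> = 1 \<Longrightarrow> z \<noteq> Z \<alpha> x t \<or> \<alpha> = N \<Longrightarrow> w x z t = W \<alpha> x z t"
    using layerwise_C1E[OF lw] by blast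
  obtain P where P: "\<And>\<alpha>. \<alpha> \<in> {1..N} \<Longrightarrow> C1_xzt J (P \<alpha>)"
    and Pe: "\<And>\<alpha> x z t. \<alpha> \<in> {1..N} \<Longrightarrow> t \<in> J \<Longrightarrow> z \<in> {Z (\<alpha> - 1) x t..Z \<alpha> x t} \<Longrightarrow>
       z \<noteq> Z (\<alpha> - 1) x t \<or> \<alpha> = 1 \<Longrightarrow> z \<noteq> Z \<alpha> x t \<or> \<alpha> = N \<Longrightarrow> p x z t = P \<alpha> x z t"
    using layerwise_C1E[OF lp] by blast
  have \<phi>_slab: "?\<phi> x z t = 1" if "(x, z, t) \<in> ?\<Omega>" for x z t
    using that by (auto simp: fluid_domain_def phi_def)
  have \<phi>_layer: "?\<phi> x z t = 1" if "\<alpha> \<in> {1..N}" "t \<in> J" "Z (\<alpha> - 1) x t < z" "z < Z \<alpha> x t" for \<alpha> x z t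
  proof -
    have "\<alpha> - 1 \<le> N" "\<alpha> \<le> N" using that(1) by auto
    from subsetD[OF sub[OF this]] show ?thesis using that by (intro \<phi>_slab) (auto simp: slab_def)
  qed
  have uv: "U \<alpha> x z t = v \<alpha> x t" if a: "\<alpha> \<in> {1..N}" and t: "t \<in> J" and z: "z \<in> {Z (\<alpha> - 1) x t..Z \<alpha> x t}" for \<alpha> x z t
  proof -
    note lt = Z_less[OF a t, of x]
    have c: "continuous_on {Z (\<alpha> - 1) x t..Z \<alpha> x t} (\<lambda>z. U \<alpha> x z t)"
      using C1_xzt_partial_z[OF U[OF a] t] by (meson DERIV_isCont continuous_at_imp_continuous_on)
    have 1: "q \<alpha> x t = integral {Z (\<alpha> - 1) x t..Z \<alpha> x t} (\<lambda>z. U \<alpha> x z t)"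
      unfolding q_def using \<phi>_layer[OF a t] Ue[OF a t] by (intro layer_int_cong[OF a t]) auto
    have 2: "layer_int zb l H \<alpha> (\<lambda>x z t. ?\<phi> x z t * (u x z t)\<^sup>2) x t
        = integral {Z (\<alpha> - 1) x t..Z \<alpha> x t} (\<lambda>z. (U \<alpha> x z t)\<^sup>2)"
      using \<phi>_layer[OF a t] Ue[OF a t] by (intro layer_int_cong[OF a t]) auto
    have 3: "layer_int zb l H \<alpha> ?\<phi> x t = integral {Z (\<alpha> - 1) x t..Z \<alpha> x t} (\<lambda>z. 1)"
      using \<phi>_layer[OF a t] by (intro layer_int_cong[OF a t]) auto
    have 4: "layer_int zb l H \<alpha> ?\<phi> x t = Z \<alpha> x t - Z (\<alpha> - 1) x t"
      unfolding 3 using lt by simp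
    from equality_Cauchy_Schwarz_interval[OF lt c closure[OF a t, of x, unfolded 4 1 2] z]
    show ?thesis unfolding v_def layer_velocity_def 1 Z_diff[OF a] .
  qed
  have v: "C1_xt J (v \<alpha>)" if a: "\<alpha> \<in> {1..N}" for \<alpha>
  proof -
    \<comment> \<open>The layer velocity is the trace of U along the upper interface. This gives its
      regularity without differentiating an integral with moving ends.\<close>
    have "C1_on (\<lambda>X. (\<lambda>(x, z, t). U \<alpha> x z t) (fst X, (\<lambda>(x, t). Z \<alpha> x t) X, snd X)) (UNIV \<times> J)"
      by (rule C1_on_compose[OF _ U[OF a, unfolded C1_xzt_def]])
        (auto intro!: C1_on_intros C1_xt_Z[unfolded C1_xt_def])
    then show ?thesis unfolding C1_xt_def
    proof (rule C1_on_cong_open)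
      show "open ((UNIV :: real set) \<times> J)" using J by (intro open_Times) auto
      show "(\<lambda>(x, z, t). U \<alpha> x z t) (fst X, (\<lambda>(x, t). Z \<alpha> x t) X, snd X) = (\<lambda>(x, t). v \<alpha> x t) X"
        if "X \<in> UNIV \<times> J" for X
        using that uv[OF a, of "snd X" "Z \<alpha> (fst X) (snd X)" "fst X"] Z_less[OF a, of "snd X" "fst X"]
        by (auto simp: case_prod_unfold)
    qed
  qed
  have q_eq: "q \<alpha> x t = h \<alpha> x t * v \<alpha> x t" if "\<alpha> \<in> {1..N}" "t \<in> J" for \<alpha> x t
    using h_pos[OF that, of x] unfolding v_def layer_velocity_def by simp
  have q: "C1_xt J (q \<alpha>)" if a: "\<alpha> \<in> {1..N}" for \<alpha>
  proof -
    have "C1_on (\<lambda>X. (\<lambda>(x, t). h \<alpha> x t) X * (\<lambda>(x, t). v \<alpha> x t) X) (UNIV \<times> J)"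
      by (intro C1_on_mult C1_xt_h[unfolded C1_xt_def] v[OF a, unfolded C1_xt_def])
    then show ?thesis unfolding C1_xt_def
      by (rule C1_on_cong_open) (use J in \<open>auto simp: q_eq[OF a] intro!: open_Times\<close>)
  qed
  have layer: "?\<phi> x z t = 1 \<and> u x z t = v \<alpha> x t \<and> w x z t = W \<alpha> x z t \<and> p x z t = P \<alpha> x z t"
    if "\<alpha> \<in> {1..N}" "(x, z, t) \<in> slab (\<alpha> - 1) \<alpha>" for \<alpha> x z t
    using that \<phi>_layer[of \<alpha> t x z] Ue[of \<alpha> t z x] We[of \<alpha> t z x] Pe[of \<alpha> t z x] uv[of \<alpha> t z x]
    unfolding slab_def by auto
  have slab_sub: "slab (\<alpha> - 1) \<alpha> \<subseteq> ?\<Omega>" if "\<alpha> \<in> {1..N}" for \<alpha>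
    using that by (intro sub) auto
  have C1c: "C1_on (\<lambda>(x, z, t). c) S" for c :: real and S :: "(real \<times> real \<times> real) set"
    by (simp add: case_prod_unfold C1_on_const)
  note cont = C1_on_imp_continuous_on
  have \<phi>c: "continuous_on S (\<lambda>(x, z, t). - ?\<phi> x z t * g)" if "S \<subseteq> ?\<Omega>" for S
    by (rule continuous_on_eq[OF continuous_on_const[of _ "- g"]]) (use that \<phi>_slab in force)
  have slab2: "(x, z, t) \<in> slab \<alpha> (\<alpha> + 1)" if "(x, z, t) \<in> slab (\<alpha> - 1) (\<alpha> + 1)" "Z \<alpha> x t < z" for \<alpha> x z t
    using that unfolding slab_def by auto
  have slab1: "(x, z, t) \<in> slab (\<alpha> - 1) \<alpha>" if "(x, z, t) \<in> slab (\<alpha> - 1) (\<alpha> + 1)" "z < Z \<alpha> x t" for \<alpha> x z t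
    using that unfolding slab_def by auto
  have Z_slab: "(x, Z \<alpha> x t, t) \<in> slab (\<alpha> - 1) (\<alpha> + 1)" if "\<alpha> \<in> {1..<N}" "t \<in> J" for \<alpha> x t
    using that Z_less[of \<alpha> t x] Z_less[of "\<alpha> + 1" t x] unfolding slab_def by auto
  have dP: "deriv (\<lambda>v. P \<alpha> x v t) z = - g" if a: "\<alpha> \<in> {1..N}" and X: "(x, z, t) \<in> slab (\<alpha> - 1) \<alpha>" for \<alpha> x z t
  proof -
    have "weak_balance (slab (\<alpha> - 1) \<alpha>) (\<lambda>x z t. 0) (\<lambda>x z t. 0) (P \<alpha>) (\<lambda>x z t. - g)"
      by (rule weak_balance_cong[OF weak_balance_subset[OF pres_w slab_sub[OF a]]]) (use layer[OF a] in auto)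
    from weak_balance_interior[OF this open_slab order_refl X C1c C1c C1_on_xzt_slab[OF P[OF a]] cont[OF C1c]]
    show ?thesis by simp
  qed
  have P_affine: "P \<alpha> x z t = P \<alpha> x (Z (\<alpha> - 1) x t) t - g * (z - Z (\<alpha> - 1) x t)"
    if a: "\<alpha> \<in> {1..N}" and t: "t \<in> J" and z: "z \<in> {Z (\<alpha> - 1) x t..Z \<alpha> x t}" for \<alpha> x z t
  proof -
    have "P \<alpha> x z t = P \<alpha> x (Z (\<alpha> - 1) x t) t + - g * (z - Z (\<alpha> - 1) x t)"
      by (rule affine_of_constant_deriv[OF Z_less[OF a t] C1_xzt_partial_z[OF P[OF a] t] dP[OF a] z])
        (use t in \<open>auto simp: slab_def\<close>)
    then show ?thesis by simp
  qed
  \<comment> \<open>With A = B = 0 the flux through the graph is the vertical one alone, so the jump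
    condition is continuity of p.\<close>
  have P_jump: "P (\<alpha> + 1) x (Z \<alpha> x t) t = P \<alpha> x (Z \<alpha> x t) t" if a: "\<alpha> \<in> {1..<N}" and t: "t \<in> J" for \<alpha> x t
  proof -
    have a': "\<alpha> \<in> {1..N}" "\<alpha> + 1 \<in> {1..N}" using a by auto
    have s: "slab (\<alpha> - 1) (\<alpha> + 1) \<subseteq> ?\<Omega>" using a by (intro sub) auto
    note above = layer[OF a'(2), unfolded add_diff_cancel_right', OF slab2] and below = layer[OF a'(1) slab1]
    show ?thesis
      using weak_balance_jump[where \<gamma> = "Z \<alpha>" and ?A1.0 = "\<lambda>x z t. 0" and ?A2.0 = "\<lambda>x z t. 0"
          and ?B1.0 = "\<lambda>x z t. 0" and ?B2.0 = "\<lambda>x z t. 0" and ?C1.0 = "P (\<alpha> + 1)" and ?C2.0 = "P \<alpha>",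
          OF pres_w open_slab s J t C1_xt_Z Z_slab[OF a t] cont[OF C1c] cont[OF C1c]
          cont[OF C1_on_xzt_slab[OF P[OF a'(2)]]] cont[OF C1c] cont[OF C1c]
          cont[OF C1_on_xzt_slab[OF P[OF a'(1)]]] \<phi>c[OF s]] above below by simp
  qed
  have P_top: "P \<alpha> x (Z \<alpha> x t) t = g * (Z N x t - Z \<alpha> x t)" if a: "\<alpha> \<in> {1..N}" and t: "t \<in> J" for \<alpha> x t
  proof -
    have "\<alpha> \<le> N" "1 \<le> \<alpha>" using a by auto
    then show ?thesis
    \<comment> \<open>Descends from the free surface, where p = 0: each step crosses a layer by
      \<open>P_affine\<close> and an interface by \<open>P_jump\<close>.\<close>
    proof (induction \<alpha> rule: inc_induct)
      case base
      have "p x (Z N x t) t = P N x (Z N x t) t"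
        using N t Z_less[of N t x] by (intro Pe) auto
      then show ?case using p_s[OF t, of x] unfolding ZN by simp
    next
      case (step n)
      then have n: "n \<in> {1..<N}" "Suc n \<in> {1..N}" by auto
      show ?case
        using P_jump[OF n(1) t, of x] P_affine[OF n(2) t, of "Z (Suc n) x t" x] step Z_less[OF n(2) t, of x]
        by (simp add: algebra_simps)
    qed
  qed
  have P_eq: "P \<alpha> x z t = g * (Z N x t - z)"
    if a: "\<alpha> \<in> {1..N}" and t: "t \<in> J" and z: "z \<in> {Z (\<alpha> - 1) x t..Z \<alpha> x t}" for \<alpha> x z t
    using P_affine[OF a t z] P_affine[OF a t, of "Z \<alpha> x t" x] P_top[OF a t, of x] Z_less[OF a t, of x]
    by (simp add: algebra_simps)
  \<comment> \<open>A single C1 formula for the pressure in all layers, so that the same field can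
    stand on both sides of an interface in the momentum jump.\<close>
  define Pg where "Pg x z t = g * (Z N x t - z)" for x z t
  have Pg: "C1_xzt J Pg"
  proof -
    have "C1_on (\<lambda>X. (\<lambda>(x, t). Z N x t) (fst X, snd (snd X))) (UNIV \<times> UNIV \<times> J)"
      by (rule C1_on_compose[OF _ C1_xt_Z[unfolded C1_xt_def]]) (auto intro!: C1_on_intros)
    then show ?thesis unfolding C1_xzt_def Pg_def case_prod_unfold
      by (intro C1_on_mult C1_on_diff C1_on_intros) simp
  qed
  have layer': "p x z t = Pg x z t" if "\<alpha> \<in> {1..N}" "(x, z, t) \<in> slab (\<alpha> - 1) \<alpha>" for \<alpha> x z t
    using layer[OF that] P_eq[OF that(1), of t z x] that(2) unfolding slab_def Pg_def by auto
  define vx where "vx \<alpha> x t = deriv (\<lambda>y. v \<alpha> y t) x" for \<alpha> x t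
  have vx: "((\<lambda>y. v \<alpha> y t) has_real_derivative vx \<alpha> x t) (at x)" if "\<alpha> \<in> {1..N}" "t \<in> J" for \<alpha> x t
    unfolding vx_def by (rule C1_xt_partials(1)[OF v[OF that(1)] that(2)])
  have C1v: "C1_on (\<lambda>(x, z, t). v \<alpha> x t) (slab i j)" if "\<alpha> \<in> {1..N}" for \<alpha> i j
    by (rule C1_on_xt_slab[OF v[OF that]])
  have C1W: "C1_on (\<lambda>(x, z, t). W \<alpha> x z t) (slab i j)" if "\<alpha> \<in> {1..N}" for \<alpha> i j
    by (rule C1_on_xzt_slab[OF W[OF that]])
  have C1B: "C1_on (\<lambda>(x, z, t). (v \<alpha> x t)\<^sup>2 + Pg x z t) (slab i j)" if a: "\<alpha> \<in> {1..N}" for \<alpha> i j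
    using C1_on_add[OF C1_on_mult[OF C1v[OF a] C1v[OF a]] C1_on_xzt_slab[OF Pg]]
    by (simp add: case_prod_unfold power2_eq_square)
  have C1C: "C1_on (\<lambda>(x, z, t). v \<alpha> x t * W \<alpha> x z t) (slab i j)" if a: "\<alpha> \<in> {1..N}" for \<alpha> i j
    using C1_on_mult[OF C1v[OF a] C1W[OF a]] by (simp add: case_prod_unfold)
  have dW: "deriv (\<lambda>z. W \<alpha> x z t) z = - vx \<alpha> x t" if a: "\<alpha> \<in> {1..N}" and X: "(x, z, t) \<in> slab (\<alpha> - 1) \<alpha>" for \<alpha> x z t
  proof -
    have "weak_balance (slab (\<alpha> - 1) \<alpha>) (\<lambda>x z t. 1) (\<lambda>x z t. v \<alpha> x t) (W \<alpha>) (\<lambda>x z t. 0)"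
      by (rule weak_balance_cong[OF weak_balance_subset[OF mass_w slab_sub[OF a]]]) (use layer[OF a] in auto)
    from weak_balance_interior[OF this open_slab order_refl X C1c C1v[OF a] C1W[OF a] cont[OF C1c]]
    show ?thesis by (simp add: vx_def)
  qed
  have W_affine: "W \<alpha> x z t = W \<alpha> x (Z (\<alpha> - 1) x t) t + - vx \<alpha> x t * (z - Z (\<alpha> - 1) x t)"
    if a: "\<alpha> \<in> {1..N}" and t: "t \<in> J" and z: "z \<in> {Z (\<alpha> - 1) x t..Z \<alpha> x t}" for \<alpha> x z t
    by (rule affine_of_constant_deriv[OF Z_less[OF a t] C1_xzt_partial_z[OF W[OF a] t] dW[OF a] z])
      (use t in \<open>auto simp: slab_def\<close>)
  have vt: "deriv (\<lambda>s. v \<alpha> x s) t + v \<alpha> x t * vx \<alpha> x t + g * deriv (\<lambda>y. Z N y t) x = 0"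
    if a: "\<alpha> \<in> {1..N}" and t: "t \<in> J" for \<alpha> x t
  proof -
    \<comment> \<open>Any interior height serves: W enters only through its z derivative, which is -
      vx throughout the layer. The horizontal flux contributes 2 v vx and the vertical one - v
      vx.\<close>
    define z where "z = (Z (\<alpha> - 1) x t + Z \<alpha> x t) / 2"
    have X: "(x, z, t) \<in> slab (\<alpha> - 1) \<alpha>" using Z_less[OF a t, of x] t unfolding z_def slab_def by simp
    have "weak_balance (slab (\<alpha> - 1) \<alpha>) (\<lambda>x z t. v \<alpha> x t) (\<lambda>x z t. (v \<alpha> x t)\<^sup>2 + Pg x z t)
        (\<lambda>x z t. v \<alpha> x t * W \<alpha> x z t) (\<lambda>x z t. 0)"
      by (rule weak_balance_cong[OF weak_balance_subset[OF mom_w slab_sub[OF a]]])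
        (use layer[OF a] layer'[OF a] in auto)
    from weak_balance_interior[OF this open_slab order_refl X C1v[OF a] C1B[OF a] C1C[OF a] cont[OF C1c]]
    have "deriv (\<lambda>s. v \<alpha> x s) t + deriv (\<lambda>y. (v \<alpha> y t)\<^sup>2 + Pg y z t) x
        + deriv (\<lambda>z. v \<alpha> x t * W \<alpha> x z t) z = 0" .
    moreover have "((\<lambda>y. (v \<alpha> y t)\<^sup>2 + Pg y z t) has_real_derivative
        2 * v \<alpha> x t * vx \<alpha> x t + g * deriv (\<lambda>y. Z N y t) x) (at x)"
      unfolding Pg_def by (rule derivative_eq_intros vx[OF a t] Z_derivs(1)[OF t] refl | simp)+
    then have "deriv (\<lambda>y. (v \<alpha> y t)\<^sup>2 + Pg y z t) x = 2 * v \<alpha> x t * vx \<alpha> x t + g * deriv (\<lambda>y. Z N y t) x"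
      by (rule DERIV_imp_deriv)
    moreover have "deriv (\<lambda>z. v \<alpha> x t * W \<alpha> x z t) z = v \<alpha> x t * - vx \<alpha> x t"
      using DERIV_imp_deriv[OF DERIV_cmult[OF C1_xzt_partial_z[OF W[OF a] t], of "v \<alpha> x t"]] dW[OF a X] by simp
    ultimately show ?thesis by simp
  qed
  have main: "exchange l H q 0 x t = 0 \<and> exchange l H q N x t = 0 \<and>
      (\<forall>\<alpha>\<in>{1..N}.
          deriv (\<lambda>s. h \<alpha> x s) t + deriv (\<lambda>y. q \<alpha> y t) x = exchange l H q \<alpha> x t - exchange l H q (\<alpha> - 1) x t \<and>
          deriv (\<lambda>s. q \<alpha> x s) t + deriv (\<lambda>y. (q \<alpha> y t)\<^sup>2 / h \<alpha> y t + layer_pressure g N l H \<alpha> y t) x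
            = upwind_velocity l H q \<alpha> x t * exchange l H q \<alpha> x t
              - upwind_velocity l H q (\<alpha> - 1) x t * exchange l H q (\<alpha> - 1) x t
              + interface_pressure g N l H \<alpha> x t * deriv (\<lambda>y. Z \<alpha> y t) x
              - interface_pressure g N l H (\<alpha> - 1) x t * deriv (\<lambda>y. Z (\<alpha> - 1) y t) x \<and>
          deriv (\<lambda>s. h \<alpha> x s * midpoint_z zb l H \<alpha> x s) t
            + deriv (\<lambda>y. h \<alpha> y t * midpoint_z zb l H \<alpha> y t * layer_velocity l H q \<alpha> y t) x
            = r \<alpha> x t + Z \<alpha> x t * exchange l H q \<alpha> x t - Z (\<alpha> - 1) x t * exchange l H q (\<alpha> - 1) x t)"
    if t: "t \<in> J" for x t
  proof -
    define Zx where "Zx \<alpha> = deriv (\<lambda>y. Z \<alpha> y t) x" for \<alpha>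
    define Zt where "Zt \<alpha> = deriv (\<lambda>s. Z \<alpha> x s) t" for \<alpha>
    define hx where "hx \<alpha> = deriv (\<lambda>y. h \<alpha> y t) x" for \<alpha>
    define ht where "ht \<alpha> = deriv (\<lambda>s. h \<alpha> x s) t" for \<alpha>
    define \<zeta> where "\<zeta> \<alpha> = Z \<alpha> x t" for \<alpha>
    define V where "V \<alpha> = v \<alpha> x t" for \<alpha>
    define Vx where "Vx \<alpha> = vx \<alpha> x t" for \<alpha>
    define Vt where "Vt \<alpha> = deriv (\<lambda>s. v \<alpha> x s) t" for \<alpha>
    define \<Gamma> where "\<Gamma> \<alpha> = exchange l H q \<alpha> x t" for \<alpha>
    \<comment> \<open>\<open>Gm\<close> and \<open>Gp\<close> are the mass flux through interface
      \<alpha> seen from the layer below and from the layer above. \<open>Gm\<close> has meaning for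
      \<alpha> \<ge> 1 and \<open>Gp\<close> for \<alpha> < N.\<close>
    define Gm where "Gm \<alpha> = Zt \<alpha> + V \<alpha> * Zx \<alpha> - W \<alpha> x (\<zeta> \<alpha>) t" for \<alpha>
    define Gp where "Gp \<alpha> = Zt \<alpha> + V (\<alpha> + 1) * Zx \<alpha> - W (\<alpha> + 1) x (\<zeta> \<alpha>) t" for \<alpha>
    have D: "((\<lambda>y. Z \<alpha> y t) has_real_derivative Zx \<alpha>) (at x)" "((\<lambda>s. Z \<alpha> x s) has_real_derivative Zt \<alpha>) (at t)"
      "((\<lambda>y. h \<alpha> y t) has_real_derivative hx \<alpha>) (at x)" "((\<lambda>s. h \<alpha> x s) has_real_derivative ht \<alpha>) (at t)" for \<alpha>
      unfolding Zx_def Zt_def hx_def ht_def by (rule Z_derivs h_derivs t)+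
    have Dv: "((\<lambda>y. v \<alpha> y t) has_real_derivative Vx \<alpha>) (at x)" "((\<lambda>s. v \<alpha> x s) has_real_derivative Vt \<alpha>) (at t)"
      if "\<alpha> \<in> {1..N}" for \<alpha>
      unfolding Vx_def Vt_def vx_def by (rule C1_xt_partials v that t)+
    have hd: "hx \<alpha> = Zx \<alpha> - Zx (\<alpha> - 1)" "ht \<alpha> = Zt \<alpha> - Zt (\<alpha> - 1)" "h \<alpha> x t = \<zeta> \<alpha> - \<zeta> (\<alpha> - 1)"
      if "\<alpha> \<in> {1..N}" for \<alpha>
      unfolding hx_def ht_def Zx_def Zt_def \<zeta>_def by (rule h_deriv_diff Z_diff that t)+
    have W_top: "W \<alpha> x (\<zeta> \<alpha>) t = W \<alpha> x (\<zeta> (\<alpha> - 1)) t - Vx \<alpha> * h \<alpha> x t" if a: "\<alpha> \<in> {1..N}" for \<alpha>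
      using W_affine[OF a t, of "\<zeta> \<alpha>" x] Z_less[OF a t, of x] hd(3)[OF a] unfolding \<zeta>_def Vx_def by simp
    have jump: "Gp \<alpha> = Gm \<alpha>" "V (\<alpha> + 1) * Gp \<alpha> = V \<alpha> * Gm \<alpha>" if a: "\<alpha> \<in> {1..<N}" for \<alpha>
    proof -
      have a': "\<alpha> \<in> {1..N}" "\<alpha> + 1 \<in> {1..N}" using a by auto
      have s: "slab (\<alpha> - 1) (\<alpha> + 1) \<subseteq> ?\<Omega>" using a by (intro sub) auto
      note above = layer[OF a'(2), unfolded add_diff_cancel_right', OF slab2] and below = layer[OF a'(1) slab1]
      note above' = layer'[OF a'(2), unfolded add_diff_cancel_right', OF slab2] and below' = layer'[OF a'(1) slab1]
      \<comment> \<open>For the mass equation the flux through the graph is minus G.\<close>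
      have "W (\<alpha> + 1) x (Z \<alpha> x t) t - Zt \<alpha> * 1 - Zx \<alpha> * v (\<alpha> + 1) x t
          = W \<alpha> x (Z \<alpha> x t) t - Zt \<alpha> * 1 - Zx \<alpha> * v \<alpha> x t"
        unfolding Zt_def Zx_def
        by (rule weak_balance_jump[where \<gamma> = "Z \<alpha>" and ?A1.0 = "\<lambda>x z t. 1" and ?A2.0 = "\<lambda>x z t. 1"
          and ?B1.0 = "\<lambda>x z t. v (\<alpha> + 1) x t" and ?B2.0 = "\<lambda>x z t. v \<alpha> x t" and ?C1.0 = "W (\<alpha> + 1)" and ?C2.0 = "W \<alpha>",
          OF mass_w open_slab s J t C1_xt_Z Z_slab[OF a t] cont[OF C1c] cont[OF C1v[OF a'(2)]]
          cont[OF C1W[OF a'(2)]] cont[OF C1c] cont[OF C1v[OF a'(1)]]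
          cont[OF C1W[OF a'(1)]] cont[OF C1c]]) (use above below in simp_all)
      then show 1: "Gp \<alpha> = Gm \<alpha>" unfolding Gp_def Gm_def V_def \<zeta>_def by (simp add: algebra_simps)
      \<comment> \<open>For the momentum equation the flux is minus v G minus the pressure times the
        interface slope; the pressure part is common to both sides.\<close>
      have "v (\<alpha> + 1) x t * W (\<alpha> + 1) x (Z \<alpha> x t) t - Zt \<alpha> * v (\<alpha> + 1) x t
            - Zx \<alpha> * ((v (\<alpha> + 1) x t)\<^sup>2 + Pg x (Z \<alpha> x t) t)
          = v \<alpha> x t * W \<alpha> x (Z \<alpha> x t) t - Zt \<alpha> * v \<alpha> x t - Zx \<alpha> * ((v \<alpha> x t)\<^sup>2 + Pg x (Z \<alpha> x t) t)"
        unfolding Zt_def Zx_def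
        by (rule weak_balance_jump[where \<gamma> = "Z \<alpha>"
          and ?A1.0 = "\<lambda>x z t. v (\<alpha> + 1) x t" and ?A2.0 = "\<lambda>x z t. v \<alpha> x t"
          and ?B1.0 = "\<lambda>x z t. (v (\<alpha> + 1) x t)\<^sup>2 + Pg x z t" and ?B2.0 = "\<lambda>x z t. (v \<alpha> x t)\<^sup>2 + Pg x z t"
          and ?C1.0 = "\<lambda>x z t. v (\<alpha> + 1) x t * W (\<alpha> + 1) x z t" and ?C2.0 = "\<lambda>x z t. v \<alpha> x t * W \<alpha> x z t",
          OF mom_w open_slab s J t C1_xt_Z Z_slab[OF a t] cont[OF C1v[OF a'(2)]] cont[OF C1B[OF a'(2)]]
          cont[OF C1C[OF a'(2)]] cont[OF C1v[OF a'(1)]] cont[OF C1B[OF a'(1)]]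
          cont[OF C1C[OF a'(1)]] cont[OF C1c]]) (use above below above' below' in simp_all)
      then show "V (\<alpha> + 1) * Gp \<alpha> = V \<alpha> * Gm \<alpha>"
        unfolding Gp_def Gm_def V_def \<zeta>_def by (simp add: power2_eq_square algebra_simps)
    qed
    have bottom: "Gp 0 = 0"
    proof -
      have 1: "1 \<in> {1..N}" using N by simp
      have lt: "zb x < Z 1 x t" using Z_less[OF 1 t, of x] by simp
      have "u x (zb x) t = U 1 x (zb x) t" "w x (zb x) t = W 1 x (zb x) t"
        by ((rule Ue[OF 1 t] We[OF 1 t]; use lt in auto))+
      moreover have "U 1 x (zb x) t = v 1 x t" using lt by (intro uv[OF 1 t]) simp
      moreover have "Zt 0 = 0" unfolding Zt_def by (rule Z_0_deriv_t)
      moreover have "Zx 0 = deriv zb x" unfolding Zx_def by simp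
      ultimately show ?thesis
        using kin_b[OF t, of x] unfolding Gp_def V_def \<zeta>_def by simp
    qed
    have top: "Gm N = 0"
    proof -
      have 1: "N \<in> {1..N}" using N by simp
      note lt = Z_less[OF 1 t, of x]
      have "u x (Z N x t) t = U N x (Z N x t) t" "w x (Z N x t) t = W N x (Z N x t) t"
        by ((rule Ue[OF 1 t] We[OF 1 t]; use lt in auto))+
      moreover have "U N x (Z N x t) t = v N x t" using lt by (intro uv[OF 1 t]) simp
      ultimately show ?thesis
        using kin_s[OF t, of x] unfolding Gm_def V_def Zt_def Zx_def \<zeta>_def ZN by simp
    qed
    have qx: "((\<lambda>y. q \<alpha> y t) has_real_derivative hx \<alpha> * V \<alpha> + h \<alpha> x t * Vx \<alpha>) (at x)" if a: "\<alpha> \<in> {1..N}" for \<alpha>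
      using DERIV_mult[OF D(3) Dv(1)[OF a], of \<alpha>] unfolding q_eq[OF a t] V_def by (simp add: mult_ac)
    have qt: "((\<lambda>s. q \<alpha> x s) has_real_derivative ht \<alpha> * V \<alpha> + h \<alpha> x t * Vt \<alpha>) (at t)" if a: "\<alpha> \<in> {1..N}" for \<alpha>
    proof -
      have "((\<lambda>s. h \<alpha> x s * v \<alpha> x s) has_real_derivative ht \<alpha> * V \<alpha> + h \<alpha> x t * Vt \<alpha>) (at t)"
        using DERIV_mult[OF D(4) Dv(2)[OF a], of \<alpha>] unfolding V_def by (simp add: mult_ac)
      then show ?thesis
        by (rule has_field_derivative_transform_within_open[OF _ J t]) (simp add: q_eq[OF a])
    qed
    \<comment> \<open>Incompressibility integrated over the layer: h Vx is the drop of W across it,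
      and the moving ends supply the rest. At both ends the velocity is that of layer \<alpha>,
      hence \<open>Gp\<close> at the lower interface.\<close>
    have mass: "ht \<alpha> + (hx \<alpha> * V \<alpha> + h \<alpha> x t * Vx \<alpha>) = Gm \<alpha> - Gp (\<alpha> - 1)" if a: "\<alpha> \<in> {1..N}" for \<alpha>
    proof -
      have "\<alpha> - 1 + 1 = \<alpha>" using a by simp
      then show ?thesis
        unfolding Gp_def Gm_def hd(1,2)[OF a] W_top[OF a] by (simp add: algebra_simps)
    qed
    \<comment> \<open>The common value of both fluxes. Index 0 is set apart because
      \<open>Gm 0\<close> would refer to a layer below the bottom.\<close>
    define Gc where "Gc \<alpha> = (if \<alpha> = 0 then 0 else Gm \<alpha>)" for \<alpha>
    have Gc: "Gm \<alpha> = Gc \<alpha>" "Gp (\<alpha> - 1) = Gc (\<alpha> - 1)" if "\<alpha> \<in> {1..N}" for \<alpha>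
    proof -
      show "Gm \<alpha> = Gc \<alpha>" using that by (simp add: Gc_def)
      show "Gp (\<alpha> - 1) = Gc (\<alpha> - 1)"
      proof (cases "\<alpha> = 1")
        case False
        then have "\<alpha> - 1 \<in> {1..<N}" using that by auto
        from jump(1)[OF this] show ?thesis using False that by (simp add: Gc_def)
      qed (simp add: Gc_def bottom)
    qed
    \<comment> \<open>Telescoping the mass balances from the bottom identifies the exchange term,
      defined by derivatives of partial sums, with the flux read off at the interface.\<close>
    have \<Gamma>: "\<Gamma> \<alpha> = Gc \<alpha>" if "\<alpha> \<le> N" for \<alpha>
    proof -
      have "\<Gamma> \<alpha> = (\<Sum>j=1..\<alpha>. deriv (\<lambda>s. h j x s) t + deriv (\<lambda>y. q j y t) x)"
        unfolding \<Gamma>_def by (rule exchange_eq[OF q t that])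
      also have "\<dots> = (\<Sum>j=1..\<alpha>. Gc j - Gc (j - 1))"
      proof (rule sum.cong[OF refl])
        fix j assume "j \<in> {1..\<alpha>}"
        then have j: "j \<in> {1..N}" using that by auto
        show "deriv (\<lambda>s. h j x s) t + deriv (\<lambda>y. q j y t) x = Gc j - Gc (j - 1)"
          unfolding DERIV_imp_deriv[OF qx[OF j]] DERIV_imp_deriv[OF D(4)] mass[OF j] Gc[OF j] ..
      qed
      also have "\<dots> = Gc \<alpha>" unfolding sum_telescope_1 by (simp add: Gc_def)
      finally show ?thesis .
    qed
    have G0: "\<Gamma> 0 = 0" "\<Gamma> N = 0" using \<Gamma>[of 0] \<Gamma>[of N] N top by (auto simp: Gc_def)
    have up: "upwind_velocity l H q \<alpha> x t * \<Gamma> \<alpha> = V \<alpha> * \<Gamma> \<alpha>"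
      "upwind_velocity l H q \<alpha> x t * \<Gamma> \<alpha> = V (\<alpha> + 1) * \<Gamma> \<alpha>" if "\<alpha> \<le> N" for \<alpha>
    proof -
      \<comment> \<open>In the interior this is G [u] = 0. At \<alpha> = 0 and \<alpha> = N one
        velocity belongs to a nonexistent layer, but there \<Gamma> vanishes.\<close>
      have "V (\<alpha> + 1) * \<Gamma> \<alpha> = V \<alpha> * \<Gamma> \<alpha>"
      proof (cases "\<alpha> = 0 \<or> \<alpha> = N")
        case False
        then have "\<alpha> \<in> {1..<N}" using that by auto
        from jump[OF this] show ?thesis using False \<Gamma>[OF that] by (simp add: Gc_def)
      qed (use G0 in auto)
      moreover have "upwind_velocity l H q \<alpha> x t = V \<alpha> \<or> upwind_velocity l H q \<alpha> x t = V (\<alpha> + 1)"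
        unfolding upwind_velocity_def V_def v_def by simp
      ultimately show "upwind_velocity l H q \<alpha> x t * \<Gamma> \<alpha> = V \<alpha> * \<Gamma> \<alpha>"
        "upwind_velocity l H q \<alpha> x t * \<Gamma> \<alpha> = V (\<alpha> + 1) * \<Gamma> \<alpha>" by auto
    qed
    have mass': "ht \<alpha> + (hx \<alpha> * V \<alpha> + h \<alpha> x t * Vx \<alpha>) = \<Gamma> \<alpha> - \<Gamma> (\<alpha> - 1)" if a: "\<alpha> \<in> {1..N}" for \<alpha>
    proof -
      have "\<alpha> \<le> N" "\<alpha> - 1 \<le> N" using a by auto
      then show ?thesis using mass[OF a] Gc[OF a] \<Gamma> by simp
    qed
    have mom': "ht \<alpha> * V \<alpha> + h \<alpha> x t * Vt \<alpha> + deriv (\<lambda>y. (q \<alpha> y t)\<^sup>2 / h \<alpha> y t + layer_pressure g N l H \<alpha> y t) x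
            = upwind_velocity l H q \<alpha> x t * \<Gamma> \<alpha> - upwind_velocity l H q (\<alpha> - 1) x t * \<Gamma> (\<alpha> - 1)
              + interface_pressure g N l H \<alpha> x t * Zx \<alpha> - interface_pressure g N l H (\<alpha> - 1) x t * Zx (\<alpha> - 1)"
      if a: "\<alpha> \<in> {1..N}" for \<alpha>
    proof -
      have b: "\<alpha> \<le> N" "\<alpha> - 1 \<le> N" "\<alpha> - 1 + 1 = \<alpha>" using a by auto
      have v': "layer_velocity l H q \<alpha> x t = V \<alpha>" unfolding V_def v_def ..
      have Vt: "Vt \<alpha> = - V \<alpha> * Vx \<alpha> - g * deriv (\<lambda>y. Z N y t) x"
        using vt[OF a t, of x] unfolding Vt_def V_def Vx_def by linarith
      \<comment> \<open>The surface slope inside Vt cancels the one from the momentum flux; what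
        remains is the velocity times the mass balance.\<close>
      have "ht \<alpha> * V \<alpha> + h \<alpha> x t * Vt \<alpha> + (2 * V \<alpha> * (hx \<alpha> * V \<alpha> + h \<alpha> x t * Vx \<alpha>) - (V \<alpha>)\<^sup>2 * hx \<alpha>)
          + g * h \<alpha> x t * deriv (\<lambda>y. Z N y t) x = V \<alpha> * (ht \<alpha> + (hx \<alpha> * V \<alpha> + h \<alpha> x t * Vx \<alpha>))"
        unfolding Vt by (simp add: power2_eq_square algebra_simps)
      also have "\<dots> = V \<alpha> * \<Gamma> \<alpha> - V \<alpha> * \<Gamma> (\<alpha> - 1)"
        unfolding mass'[OF a] by (simp add: algebra_simps)
      finally show ?thesis
        \<comment> \<open>The upper interface uses the first form of \<open>up\<close> and the lower
          one the second, so that both exchange terms carry the velocity of layer \<alpha>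
          itself.\<close>
        unfolding momentum_flux_deriv[where q = q and \<alpha> = \<alpha>, OF a t q[OF a]] v'
          DERIV_imp_deriv[OF qx[OF a]] up(1)[OF b(1)] up(2)[OF b(2), unfolded b(3)]
          hx_def[symmetric] Zx_def[symmetric] by linarith
    qed
    have third: "deriv (\<lambda>s. h \<alpha> x s * midpoint_z zb l H \<alpha> x s) t
            + deriv (\<lambda>y. h \<alpha> y t * midpoint_z zb l H \<alpha> y t * layer_velocity l H q \<alpha> y t) x
            = r \<alpha> x t + \<zeta> \<alpha> * \<Gamma> \<alpha> - \<zeta> (\<alpha> - 1) * \<Gamma> (\<alpha> - 1)" if a: "\<alpha> \<in> {1..N}" for \<alpha>
    proof -
      have b: "\<alpha> \<le> N" "\<alpha> - 1 \<le> N" "\<alpha> - 1 + 1 = \<alpha>" using a by auto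
      note lt = Z_less[OF a t, of x]
      define wb where "wb = W \<alpha> x (\<zeta> (\<alpha> - 1)) t"
      have r: "r \<alpha> x t = h \<alpha> x t * wb - (h \<alpha> x t)\<^sup>2 / 2 * Vx \<alpha>"
      proof -
        \<comment> \<open>W is affine in z with slope - Vx and value wb at the base of the layer, so
          its integral is explicit.\<close>
        have "r \<alpha> x t = integral {\<zeta> (\<alpha> - 1)..\<zeta> \<alpha>} (\<lambda>z. wb + \<zeta> (\<alpha> - 1) * Vx \<alpha> + - Vx \<alpha> * z)"
          unfolding r_def \<zeta>_def
        proof (rule layer_int_cong[OF a t])
          fix z assume z: "Z (\<alpha> - 1) x t < z" "z < Z \<alpha> x t"
          show "?\<phi> x z t * w x z t = wb + Z (\<alpha> - 1) x t * Vx \<alpha> + - Vx \<alpha> * z"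
            using layer[OF a, of x z t] W_affine[OF a t, of z x] z t
            unfolding slab_def wb_def Vx_def \<zeta>_def by (simp add: algebra_simps)
        qed
        also have "\<dots> = (\<zeta> \<alpha> - \<zeta> (\<alpha> - 1)) * (wb + \<zeta> (\<alpha> - 1) * Vx \<alpha>) + - Vx \<alpha> * (((\<zeta> \<alpha>)\<^sup>2 - (\<zeta> (\<alpha> - 1))\<^sup>2) / 2)"
          using lt has_integral_const_real[of "wb + \<zeta> (\<alpha> - 1) * Vx \<alpha>" "\<zeta> (\<alpha> - 1)" "\<zeta> \<alpha>"]
          by (intro integral_unique has_integral_add has_integral_mult_right ident_has_integral)
            (auto simp: \<zeta>_def)
        finally show ?thesis unfolding hd(3)[OF a] by (simp add: power2_eq_square field_simps)
      qed
      have 1: "((\<lambda>s. ((Z \<alpha> x s)\<^sup>2 - (Z (\<alpha> - 1) x s)\<^sup>2) / 2) has_real_derivative \<zeta> \<alpha> * Zt \<alpha> - \<zeta> (\<alpha> - 1) * Zt (\<alpha> - 1)) (at t)"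
        unfolding \<zeta>_def by (rule derivative_eq_intros D refl | simp)+
      have 2: "((\<lambda>y. ((Z \<alpha> y t)\<^sup>2 - (Z (\<alpha> - 1) y t)\<^sup>2) / 2) has_real_derivative \<zeta> \<alpha> * Zx \<alpha> - \<zeta> (\<alpha> - 1) * Zx (\<alpha> - 1)) (at x)"
        unfolding \<zeta>_def by (rule derivative_eq_intros D refl | simp)+
      \<comment> \<open>With both exchange terms expressed through wb and Vx, the third equation
        becomes a polynomial identity in the interface heights, their slopes and rates, V, Vx and
        wb.\<close>
      have b2: "\<Gamma> \<alpha> = Zt \<alpha> + V \<alpha> * Zx \<alpha> - (wb - Vx \<alpha> * h \<alpha> x t)"
        using \<Gamma>[OF b(1)] Gc(1)[OF a] W_top[OF a] unfolding Gm_def wb_def by simp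
      have b1: "\<Gamma> (\<alpha> - 1) = Zt (\<alpha> - 1) + V \<alpha> * Zx (\<alpha> - 1) - wb"
        using \<Gamma>[OF b(2)] Gc(2)[OF a] unfolding Gp_def wb_def b(3) by simp
      note lhs = DERIV_imp_deriv[OF 1] DERIV_imp_deriv[OF DERIV_mult[OF 2 Dv(1)[OF a]]]
      show ?thesis
        unfolding thickness_midpoint[OF a] v_def[symmetric] lhs r b1 b2 V_def[symmetric] \<zeta>_def[symmetric] hd(3)[OF a]
        by (simp add: power2_eq_square field_simps)
    qed
    show ?thesis
      using G0 mass' mom' third qx qt
      unfolding \<Gamma>_def[symmetric] \<zeta>_def[symmetric] Zx_def[symmetric] ht_def[symmetric]
      by (auto simp only: DERIV_imp_deriv[OF qx] DERIV_imp_deriv[OF qt])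
  qed
  show ?thesis
    unfolding layer_averaged_solution_def Let_def
    using H q H_pos main by blast
qed

end

theorem proposition3p1:
  fixes g :: real and N :: nat and l :: "nat \<Rightarrow> real" and zb :: "real \<Rightarrow> real" and J :: "real set"
  assumes "g > 0" and "N \<ge> 1"
    and "\<forall>j\<in>{1..N}. l j > 0" and "(\<Sum>j=1..N. l j) = 1"
    and "C1_on zb UNIV" and "open J"
  shows
    "(\<forall>\<eta> u w p. let H = depth zb \<eta>; \<phi> = phi zb \<eta>;
         q = (\<lambda>\<alpha>. layer_int zb l H \<alpha> (\<lambda>x z t. \<phi> x z t * u x z t));
         r = (\<lambda>\<alpha>. layer_int zb l H \<alpha> (\<lambda>x z t. \<phi> x z t * w x z t))
       in
         euler_solution g zb J \<eta> u w p \<and>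
         layerwise_C1 N l zb J H u \<and> layerwise_C1 N l zb J H w \<and> layerwise_C1 N l zb J H p \<and>
         (\<forall>\<alpha>\<in>{1..N}. \<forall>x. \<forall>t\<in>J.
            layer_int zb l H \<alpha> (\<lambda>x z t. \<phi> x z t * (u x z t)\<^sup>2) x t
              = (q \<alpha> x t)\<^sup>2 / layer_int zb l H \<alpha> \<phi> x t \<and>
            layer_int zb l H \<alpha> (\<lambda>x z t. \<phi> x z t * z * u x z t) x t
              = layer_int zb l H \<alpha> (\<lambda>x z t. \<phi> x z t * z) x t
                * (q \<alpha> x t / layer_int zb l H \<alpha> \<phi> x t)) \<and>
         (\<forall>\<alpha>\<in>{1..<N}. \<forall>x. \<forall>t\<in>J.
            u x (interface zb l H \<alpha> x t) t = upwind_velocity l H q \<alpha> x t)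
         \<longrightarrow> layer_averaged_solution g N l zb J H q r)
     \<and>
     (\<forall>H q r. layer_averaged_solution g N l zb J H q r \<longrightarrow>
       (\<forall>x. \<forall>t\<in>J.
          deriv (\<lambda>s. \<Sum>\<alpha>=1..N. layer_energy g l zb H q \<alpha> x s) t
          + deriv (\<lambda>y. \<Sum>\<alpha>=1..N. layer_velocity l H q \<alpha> y t
              * (layer_energy g l zb H q \<alpha> y t + layer_pressure g N l H \<alpha> y t)) x
          = - (1 / 2) * (\<Sum>\<alpha>=1..N.
              (layer_velocity l H q (\<alpha> + 1) x t - layer_velocity l H q \<alpha> x t)\<^sup>2
                * \<bar>exchange l H q \<alpha> x t\<bar>)))"
proof (rule conjI)
  have layers: "layered_flow N l zb J H" if "C1_xt J H" "\<And>x t. t \<in> J \<Longrightarrow> H x t > 0" for H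
    using assms that by unfold_locales auto
  show "\<forall>H q r. layer_averaged_solution g N l zb J H q r \<longrightarrow>
       (\<forall>x. \<forall>t\<in>J.
          deriv (\<lambda>s. \<Sum>\<alpha>=1..N. layer_energy g l zb H q \<alpha> x s) t
          + deriv (\<lambda>y. \<Sum>\<alpha>=1..N. layer_velocity l H q \<alpha> y t
              * (layer_energy g l zb H q \<alpha> y t + layer_pressure g N l H \<alpha> y t)) x
          = - (1 / 2) * (\<Sum>\<alpha>=1..N.
              (layer_velocity l H q (\<alpha> + 1) x t - layer_velocity l H q \<alpha> x t)\<^sup>2
                * \<bar>exchange l H q \<alpha> x t\<bar>))"
  proof (intro allI impI ballI)
    fix H q r x t
    assume sol: "layer_averaged_solution g N l zb J H q r" and t: "t \<in> J"
    then have "layered_flow N l zb J H"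
      by (intro layers) (auto simp: layer_averaged_solution_def)
    then show "deriv (\<lambda>s. \<Sum>\<alpha>=1..N. layer_energy g l zb H q \<alpha> x s) t
          + deriv (\<lambda>y. \<Sum>\<alpha>=1..N. layer_velocity l H q \<alpha> y t
              * (layer_energy g l zb H q \<alpha> y t + layer_pressure g N l H \<alpha> y t)) x
          = - (1 / 2) * (\<Sum>\<alpha>=1..N.
              (layer_velocity l H q (\<alpha> + 1) x t - layer_velocity l H q \<alpha> x t)\<^sup>2
                * \<bar>exchange l H q \<alpha> x t\<bar>)"
      using sol t by (rule layered_flow.energy_equality)
  qed
  show "\<forall>\<eta> u w p. let H = depth zb \<eta>; \<phi> = phi zb \<eta>;
         q = (\<lambda>\<alpha>. layer_int zb l H \<alpha> (\<lambda>x z t. \<phi> x z t * u x z t));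
         r = (\<lambda>\<alpha>. layer_int zb l H \<alpha> (\<lambda>x z t. \<phi> x z t * w x z t))
       in
         euler_solution g zb J \<eta> u w p \<and>
         layerwise_C1 N l zb J H u \<and> layerwise_C1 N l zb J H w \<and> layerwise_C1 N l zb J H p \<and>
         (\<forall>\<alpha>\<in>{1..N}. \<forall>x. \<forall>t\<in>J.
            layer_int zb l H \<alpha> (\<lambda>x z t. \<phi> x z t * (u x z t)\<^sup>2) x t
              = (q \<alpha> x t)\<^sup>2 / layer_int zb l H \<alpha> \<phi> x t \<and>
            layer_int zb l H \<alpha> (\<lambda>x z t. \<phi> x z t * z * u x z t) x t
              = layer_int zb l H \<alpha> (\<lambda>x z t. \<phi> x z t * z) x t
                * (q \<alpha> x t / layer_int zb l H \<alpha> \<phi> x t)) \<and>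
         (\<forall>\<alpha>\<in>{1..<N}. \<forall>x. \<forall>t\<in>J.
            u x (interface zb l H \<alpha> x t) t = upwind_velocity l H q \<alpha> x t)
         \<longrightarrow> layer_averaged_solution g N l zb J H q r"
    unfolding Let_def
  proof (intro allI impI, elim conjE)
    fix \<eta> u w p
    assume euler: "euler_solution g zb J \<eta> u w p"
      and lC1: "layerwise_C1 N l zb J (depth zb \<eta>) u" "layerwise_C1 N l zb J (depth zb \<eta>) w"
        "layerwise_C1 N l zb J (depth zb \<eta>) p"
      and closure: "\<forall>\<alpha>\<in>{1..N}. \<forall>x. \<forall>t\<in>J.
            layer_int zb l (depth zb \<eta>) \<alpha> (\<lambda>x z t. phi zb \<eta> x z t * (u x z t)\<^sup>2) x t
              = (layer_int zb l (depth zb \<eta>) \<alpha> (\<lambda>x z t. phi zb \<eta> x z t * u x z t) x t)\<^sup>2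
                / layer_int zb l (depth zb \<eta>) \<alpha> (phi zb \<eta>) x t \<and>
            layer_int zb l (depth zb \<eta>) \<alpha> (\<lambda>x z t. phi zb \<eta> x z t * z * u x z t) x t
              = layer_int zb l (depth zb \<eta>) \<alpha> (\<lambda>x z t. phi zb \<eta> x z t * z) x t
                * (layer_int zb l (depth zb \<eta>) \<alpha> (\<lambda>x z t. phi zb \<eta> x z t * u x z t) x t
                  / layer_int zb l (depth zb \<eta>) \<alpha> (phi zb \<eta>) x t)"
    have \<eta>: "C1_xt J \<eta>" and pos: "\<And>x t. t \<in> J \<Longrightarrow> depth zb \<eta> x t > 0"
      using euler unfolding euler_solution_def by blast+
    have "C1_on (\<lambda>X. (\<lambda>(x, t). \<eta> x t) X - zb (fst X)) (UNIV \<times> J)"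
      by (intro C1_on_diff \<eta>[unfolded C1_xt_def] C1_on_compose[OF C1_on_fst_snd(1) assms(5)]) simp
    then have "C1_xt J (depth zb \<eta>)"
      unfolding C1_xt_def depth_def by (simp add: case_prod_unfold)
    then have "layered_flow N l zb J (depth zb \<eta>)" using pos by (rule layers)
    then interpret layered_flow g N l zb J "depth zb \<eta>" .
    show "layer_averaged_solution g N l zb J (depth zb \<eta>)
       (\<lambda>\<alpha>. layer_int zb l (depth zb \<eta>) \<alpha> (\<lambda>x z t. phi zb \<eta> x z t * u x z t))
       (\<lambda>\<alpha>. layer_int zb l (depth zb \<eta>) \<alpha> (\<lambda>x z t. phi zb \<eta> x z t * w x z t))"
      by (rule euler_imp_layer_averaged[OF refl euler lC1]) (use closure in blast)
  qed
qed

end
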